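(* Let $z_1,z_2,z_3\in\mathbb{C}\setminus\{0,1\}$ be pairwise distinct, let $c_0,\dots,c_5\in\mathbb{C}$ satisfy $c_0+\cdots+c_5=0$ and $4c_j\notin\mathbb{Z}$ for $j=0,\dots,5$, and let $X$, $\nabla$, $\nabla^\vee$ and the cohomology intersection form $\langle\cdot,\cdot\rangle_{\mathrm{ch}}:H^1(X;\nabla)\times H^1(X;\nabla^\vee)\to\mathbb{C}$ be as defined in the context. Consider the $1$-forms on $X$ $$\varphi_1=\frac{dx}{x-1},\quad \varphi_2=\frac{dx}{x(x-1)},\quad \varphi_3=\frac{(1-z_1)\,dx}{(x-1)(x-z_1)},\quad \varphi_4=\frac{(1-z_2)\,dx}{(x-1)(x-z_2)},$$ $$\varphi_5=\frac{x\,dx}{y},\quad \varphi_6=\frac{dx}{y},\quad \varphi_7=(1-z_1)\frac{x\,dx}{(x-z_1)y},\quad \varphi_8=(1-z_2)\frac{x\,dx}{(x-z_2)y}.$$ Then the intersection matrix $C=(\langle\varphi_i,\varphi_j\rangle_{\mathrm{ch}})_{i,j=1,\dots,8}$ (where $\varphi_i$ is regarded as a class in $H^1(X;\nabla)$ and $\varphi_j$ as a class in $H^1(X;\nabla^\vee)$) is $$C=2\pi\sqrt{-1}\begin{pmatrix} C(1) & O\\ O& C(-1)\end{pmatrix},$$ where $$C(1)=\begin{pmatrix} \frac{c_4+c_5}{c_4c_5} & \frac{1}{c_4} & \frac{1}{c_4} & \frac{1}{c_4} \\ \frac{1}{c_4} & \frac{c_4+c_0}{c_4c_0} & \frac{1}{c_4}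 & \frac{1}{c_4} \\ \frac{1}{c_4} & \frac{1}{c_4} & \frac{c_4+c_1}{c_4c_1} & \frac{1}{c_4} \\ \frac{1}{c_4} & \frac{1}{c_4} & \frac{1}{c_4} & \frac{c_4+c_2}{c_4c_2} \end{pmatrix},$$ $$C(-1)=\frac{2}{z_1-z_2}\begin{pmatrix} 0& 0&-\frac{z_1}{(2c_1+\frac{1}{2})(z_1-z_3)} &\frac{z_2}{(2c_2+\frac{1}{2})(z_2-z_3)} \\ 0& 0&-\frac{1}{(2c_1+\frac{1}{2})(z_1-z_3)} &\frac{1}{(2c_2+\frac{1}{2})(z_2-z_3)} \\ -\frac{z_1}{(2c_1-\frac{1}{2})(z_1-z_3)}& -\frac{1}{(2c_1-\frac{1}{2})(z_1-z_3)}& C_{33}&C_{34}\\ \frac{z_2}{(2c_2-\frac{1}{2})(z_2-z_3)}& \frac{1}{(2c_2-\frac{1}{2})(z_2-z_3)}& C_{43}&C_{44} \end{pmatrix},$$ $$C_{33}=\frac{(1-z_1)z_1}{(2c_1-\frac{1}{2})(2c_1+\frac{1}{2})(z_1-z_3)}\left(\frac{2c_0-2c_1}{z_1}+\frac{2c_2+2c_1}{z_1-z_2}+\frac{2c_3+2c_1}{z_1-z_3}+\frac{2c_1+2c_4}{z_1-1}\right),$$ $$C_{34}=\frac{-1}{z_1-z_2}\left(\frac{z_1(1-z_2)}{(2c_1-\frac{1}{2})(z_1-z_3)}+\frac{z_2(1-z_1)}{(2c_2+\frac{1}{2})(z_2-z_3)}\right),$$ $$C_{43}=\frac{-1}{z_1-z_2}\left(\frac{z_1(1-z_2)}{(2c_1+\frac{1}{2})(z_1-z_3)}+\frac{z_2(1-z_1)}{(2c_2-\frac{1}{2})(z_2-z_3)}\right),$$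 $$C_{44}=-\frac{(1-z_2)z_2}{(2c_2-\frac{1}{2})(2c_2+\frac{1}{2})(z_2-z_3)}\left(\frac{2c_0-2c_2}{z_2}+\frac{2c_1+2c_2}{z_2-z_1}+\frac{2c_3+2c_2}{z_2-z_3}+\frac{2c_2+2c_4}{z_2-1}\right).$$
   Context: Put $z_0=0$, $z_4=1$. Let $\bar X$ be the smooth projective genus two curve $y^2=x(x-1)(x-z_1)(x-z_2)(x-z_3)$, and set $P_0=(0,0)$, $P_j=(z_j,0)$ for $j=1,2,3$, $P_4=(1,0)$, and $P_5$ = the point at infinity. Let $X=\bar X\setminus\{P_0,\dots,P_5\}$. Let $T=\prod_{j=0}^4(x-z_j)^{2c_j}$, a multivalued function on $X$; its local exponent at $P_j$ (in a local coordinate of $\bar X$ at $P_j$) is $4c_j$ for $j=0,\dots,5$. Define $\nabla=d+d\log T\wedge$ and $\nabla^\vee=d-d\log T\wedge$, acting on regular functions of $X$. The twisted de Rham cohomology groups are $H^1(X;\nabla)=\Omega^1_X(X)/\nabla\mathcal{O}_X(X)$ and $H^1(X;\nabla^\vee)=\Omega^1_X(X)/\nabla^\vee\mathcal{O}_X(X)$. The cohomology intersection form is the pairing $\langle\varphi,\varphi'\rangle_{\mathrm{ch}}=\int_X \mathrm{reg}(\varphi)\wedge\varphi'$, where $\mathrm{reg}(\varphi)$ is a compactly supported smooth representative of the class of $\varphi$. Under the assumption $4c_j\notin\mathbb{Z}$ it is given by $$\langle\varphi,\varphi'\rangle_{\mathrm{ch}}=2\pi\sqrt{-1}\sum_{j=0}^{5}\mathrm{Res}_{P_j}(\psi_j\varphi'),$$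 where $\psi_j$ is the unique meromorphic (Laurent) solution of $\nabla\psi_j=\varphi$ near $P_j$. *)

theory Defs
  imports "HOL-Analysis.Analysis" "Jordan_Normal_Form.Matrix"
begin

text \<open>Throughout, \<open>z 0, \<dots>, z 4\<close> are the finite branch points (with \<open>z 0 = 0\<close>, \<open>z 4 = 1\<close>) and
  \<open>c 0, \<dots>, c 5\<close> the exponents. A point of the affine curve is a pair \<open>(x, y)\<close>.\<close>

type_synonym pt = "complex \<times> complex"

definition quintic :: "(nat \<Rightarrow> complex) \<Rightarrow> complex \<Rightarrow> complex" where
  "quintic z x = (\<Prod>j\<le>4. x - z j)"

text \<open>The affine curve is the projective one without the point at infinity \<open>P\<^sub>5\<close>.\<close>

definition curveX :: "(nat \<Rightarrow> complex) \<Rightarrow> pt set" where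
  "curveX z = {(x, y). y\<^sup>2 = quintic z x} - {(z j, 0) | j. j \<le> 4}"

text \<open>\<open>X\<close> is affine: it is the locus \<open>y \<noteq> 0\<close> of the smooth affine curve, so its ring of
  regular functions is the localization at \<open>y\<close> of the coordinate ring of that curve.
  In \<open>P \<in> \<complex>[x][y]\<close> the outer variable is \<open>y\<close>. Only the values on \<open>X\<close> matter.\<close>

definition regular_fun :: "(nat \<Rightarrow> complex) \<Rightarrow> (pt \<Rightarrow> complex) \<Rightarrow> bool" where
  "regular_fun z g \<longleftrightarrow>
     (\<exists>(P :: complex poly poly) n. \<forall>(x, y)\<in>curveX z. g (x, y) = poly (poly P [:y:]) x / y ^ n)"


subsection \<open>Smooth functions and 1-forms on \<open>X\<close>\<close>

fun Ck_on :: "nat \<Rightarrow> 'a::real_normed_vector set \<Rightarrow> ('a \<Rightarrow> 'b::real_normed_vector) \<Rightarrow> bool" where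
  "Ck_on 0 U f \<longleftrightarrow> continuous_on U f"
| "Ck_on (Suc k) U f \<longleftrightarrow>
     (\<forall>x\<in>U. f differentiable (at x)) \<and> (\<forall>v. Ck_on k U (\<lambda>x. frechet_derivative f (at x) v))"

text \<open>The function \<open>x\<close> is a local coordinate at every point of \<open>X\<close>. Near \<open>p = (x\<^sub>0, y\<^sub>0)\<close> its
  inverse is \<open>x \<mapsto> (x, s(x))\<close>, where \<open>s\<close> is the holomorphic branch of the square root of the
  quintic with \<open>s(x\<^sub>0) = y\<^sub>0\<close>; thus \<open>in_chart z g p\<close> is \<open>g\<close> written in the coordinate \<open>x\<close> near \<open>p\<close>
  (meaningful for arguments close to \<open>x\<^sub>0\<close>).\<close>

definition in_chart :: "(nat \<Rightarrow> complex) \<Rightarrow> (pt \<Rightarrow> 'b) \<Rightarrow> pt \<Rightarrow> complex \<Rightarrow> 'b" where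
  "in_chart z g p x = g (x, snd p * csqrt (quintic z x / quintic z (fst p)))"

definition smooth_onX :: "(nat \<Rightarrow> complex) \<Rightarrow> (pt \<Rightarrow> 'b::real_normed_vector) \<Rightarrow> bool" where
  "smooth_onX z g \<longleftrightarrow>
     (\<forall>p\<in>curveX z. \<exists>U. open U \<and> fst p \<in> U \<and> (\<forall>k. Ck_on k U (in_chart z g p)))"

text \<open>Since \<open>dx\<close> has neither zeros nor poles on \<open>X\<close>, every complex valued 1-form on \<open>X\<close> is
  uniquely \<open>a dx + b d(cnj x)\<close> with functions \<open>a, b\<close>
  on \<open>X\<close>; it is encoded as \<open>p \<mapsto> (a p, b p)\<close>.\<close>

type_synonym form = "pt \<Rightarrow> complex \<times> complex"

definition dx_form :: "(complex \<Rightarrow> complex \<Rightarrow> complex) \<Rightarrow> form" where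
  "dx_form h = (\<lambda>(x, y). (h x y, 0))"

definition regular_form :: "(nat \<Rightarrow> complex) \<Rightarrow> form \<Rightarrow> bool" where
  "regular_form z \<phi> \<longleftrightarrow> regular_fun z (\<lambda>p. fst (\<phi> p)) \<and> (\<forall>p\<in>curveX z. snd (\<phi> p) = 0)"

text \<open>The exterior derivative, through the Wirtinger derivatives in the coordinate \<open>x\<close>.\<close>

definition ext_d :: "(nat \<Rightarrow> complex) \<Rightarrow> (pt \<Rightarrow> complex) \<Rightarrow> form" where
  "ext_d z g p =
     (let D = frechet_derivative (in_chart z g p) (at (fst p))
      in ((D 1 - \<i> * D \<i>) / 2, (D 1 + \<i> * D \<i>) / 2))"

definition compact_supp :: "(nat \<Rightarrow> complex) \<Rightarrow> form \<Rightarrow> bool" where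
  "compact_supp z \<rho> \<longleftrightarrow> (\<exists>K. compact K \<and> K \<subseteq> curveX z \<and> (\<forall>p\<in>curveX z - K. \<rho> p = (0, 0)))"

text \<open>The coefficient of \<open>\<phi> \<and> \<psi>\<close> with respect to \<open>dx \<and> d(cnj x)\<close>.\<close>

definition wedge :: "form \<Rightarrow> form \<Rightarrow> pt \<Rightarrow> complex" where
  "wedge \<phi> \<psi> p = fst (\<phi> p) * snd (\<psi> p) - snd (\<phi> p) * fst (\<psi> p)"

text \<open>The integral over \<open>X\<close>, with its complex orientation, of \<open>F dx \<and> d(cnj x)\<close>. Here
  \<open>dx \<and> d(cnj x) = -2\<i> du \<and> dv\<close> for \<open>x = u + \<i>v\<close>, and \<open>x\<close> makes \<open>X\<close> an unramified double covering
  of the plane minus five points, whence the sum over the fibre.\<close>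

definition integralX :: "(nat \<Rightarrow> complex) \<Rightarrow> (pt \<Rightarrow> complex) \<Rightarrow> complex" where
  "integralX z F = (LINT x|lborel. (\<Sum>y\<in>{y. (x, y) \<in> curveX z}. - 2 * \<i> * F (x, y)))"


subsection \<open>Twisted cohomology\<close>

text \<open>\<open>T = \<Prod>\<^sub>j (x - z\<^sub>j) powr (2 c\<^sub>j)\<close> is multivalued, but its logarithmic differential is not.\<close>

definition dlogT :: "(nat \<Rightarrow> complex) \<Rightarrow> (nat \<Rightarrow> complex) \<Rightarrow> form" where
  "dlogT z c = dx_form (\<lambda>x y. \<Sum>j\<le>4. 2 * c j / (x - z j))"

definition nabla :: "(nat \<Rightarrow> complex) \<Rightarrow> (nat \<Rightarrow> complex) \<Rightarrow> (pt \<Rightarrow> complex) \<Rightarrow> form" where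
  "nabla z c g p = ext_d z g p + (g p * fst (dlogT z c p), g p * snd (dlogT z c p))"

definition nabla_dual :: "(nat \<Rightarrow> complex) \<Rightarrow> (nat \<Rightarrow> complex) \<Rightarrow> (pt \<Rightarrow> complex) \<Rightarrow> form" where
  "nabla_dual z c g p = ext_d z g p - (g p * fst (dlogT z c p), g p * snd (dlogT z c p))"

text \<open>Congruence of regular 1-forms modulo the image under the connection \<open>N\<close> of the regular
  functions; forms agreeing on \<open>X\<close> are thereby identified as well.\<close>

definition cohomologous ::
    "(nat \<Rightarrow> complex) \<Rightarrow> ((pt \<Rightarrow> complex) \<Rightarrow> form) \<Rightarrow> (form \<times> form) set" where
  "cohomologous z N =
     {(\<phi>, \<psi>). regular_form z \<phi> \<and> regular_form z \<psi> \<and>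
        (\<exists>g. regular_fun z g \<and> (\<forall>p\<in>curveX z. \<psi> p = \<phi> p + N g p))}"

definition H1 :: "(nat \<Rightarrow> complex) \<Rightarrow> ((pt \<Rightarrow> complex) \<Rightarrow> form) \<Rightarrow> form set set" where
  "H1 z N = {\<phi>. regular_form z \<phi>} // cohomologous z N"

definition cls :: "(nat \<Rightarrow> complex) \<Rightarrow> ((pt \<Rightarrow> complex) \<Rightarrow> form) \<Rightarrow> form \<Rightarrow> form set" where
  "cls z N \<phi> = cohomologous z N `` {\<phi>}"

lemma cls_in_H1: "regular_form z \<phi> \<Longrightarrow> cls z N \<phi> \<in> H1 z N"
  unfolding H1_def cls_def by (auto intro: quotientI)

text \<open>\<open>\<rho>\<close> is a compactly supported smooth representative \<open>reg \<phi>\<close> of the class of \<open>\<phi>\<close>.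
  It is automatically \<open>\<nabla>\<close>-closed because \<open>\<phi>\<close> is.\<close>

definition is_reg ::
    "(nat \<Rightarrow> complex) \<Rightarrow> (nat \<Rightarrow> complex) \<Rightarrow> form \<Rightarrow> form \<Rightarrow> bool" where
  "is_reg z c \<phi> \<rho> \<longleftrightarrow>
     smooth_onX z \<rho> \<and> compact_supp z \<rho> \<and>
     (\<exists>g. smooth_onX z g \<and> (\<forall>p\<in>curveX z. \<rho> p = \<phi> p - nabla z c g p))"

text \<open>The cohomology intersection form on \<open>H\<^sup>1(X;\<nabla>) \<times> H\<^sup>1(X;\<nabla>\<^sup>\<or>)\<close>. The value is the integral
  for any choice of representatives; evaluating the description operator requires that such representatives exist and that the integral
  does not depend on them.\<close>

definition intersection_form ::
    "(nat \<Rightarrow> complex) \<Rightarrow> (nat \<Rightarrow> complex) \<Rightarrow> form set \<Rightarrow> form set \<Rightarrow> complex" where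
  "intersection_form z c \<Phi> \<Phi>' =
     (THE v. \<exists>\<phi>\<in>\<Phi>. \<exists>\<phi>'\<in>\<Phi>'. \<exists>\<rho>. is_reg z c \<phi> \<rho> \<and> v = integralX z (wedge \<rho> \<phi>'))"


subsection \<open>The 1-forms and the blocks of the intersection matrix\<close>

text \<open>\<open>basis_forms z ! i\<close> is \<open>\<phi>\<^sub>i\<^sub>+\<^sub>1\<close>.\<close>

definition basis_forms :: "(nat \<Rightarrow> complex) \<Rightarrow> form list" where
  "basis_forms z =
    [dx_form (\<lambda>x y. 1 / (x - 1)),
     dx_form (\<lambda>x y. 1 / (x * (x - 1))),
     dx_form (\<lambda>x y. (1 - z 1) / ((x - 1) * (x - z 1))),
     dx_form (\<lambda>x y. (1 - z 2) / ((x - 1) * (x - z 2))),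
     dx_form (\<lambda>x y. x / y),
     dx_form (\<lambda>x y. 1 / y),
     dx_form (\<lambda>x y. (1 - z 1) * (x / ((x - z 1) * y))),
     dx_form (\<lambda>x y. (1 - z 2) * (x / ((x - z 2) * y)))]"

definition C_plus :: "(nat \<Rightarrow> complex) \<Rightarrow> complex mat" where
  "C_plus c = mat_of_rows_list 4
    [[(c 4 + c 5) / (c 4 * c 5), 1 / c 4, 1 / c 4, 1 / c 4],
     [1 / c 4, (c 4 + c 0) / (c 4 * c 0), 1 / c 4, 1 / c 4],
     [1 / c 4, 1 / c 4, (c 4 + c 1) / (c 4 * c 1), 1 / c 4],
     [1 / c 4, 1 / c 4, 1 / c 4, (c 4 + c 2) / (c 4 * c 2)]]"

definition C33 :: "(nat \<Rightarrow> complex) \<Rightarrow> (nat \<Rightarrow> complex) \<Rightarrow> complex" where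
  "C33 z c = (1 - z 1) * z 1 / ((2 * c 1 - 1/2) * (2 * c 1 + 1/2) * (z 1 - z 3)) *
     ((2 * c 0 - 2 * c 1) / z 1 + (2 * c 2 + 2 * c 1) / (z 1 - z 2)
      + (2 * c 3 + 2 * c 1) / (z 1 - z 3) + (2 * c 1 + 2 * c 4) / (z 1 - 1))"

definition C34 :: "(nat \<Rightarrow> complex) \<Rightarrow> (nat \<Rightarrow> complex) \<Rightarrow> complex" where
  "C34 z c = (-1) / (z 1 - z 2) *
     (z 1 * (1 - z 2) / ((2 * c 1 - 1/2) * (z 1 - z 3))
      + z 2 * (1 - z 1) / ((2 * c 2 + 1/2) * (z 2 - z 3)))"

definition C43 :: "(nat \<Rightarrow> complex) \<Rightarrow> (nat \<Rightarrow> complex) \<Rightarrow> complex" where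
  "C43 z c = (-1) / (z 1 - z 2) *
     (z 1 * (1 - z 2) / ((2 * c 1 + 1/2) * (z 1 - z 3))
      + z 2 * (1 - z 1) / ((2 * c 2 - 1/2) * (z 2 - z 3)))"

definition C44 :: "(nat \<Rightarrow> complex) \<Rightarrow> (nat \<Rightarrow> complex) \<Rightarrow> complex" where
  "C44 z c = - ((1 - z 2) * z 2 / ((2 * c 2 - 1/2) * (2 * c 2 + 1/2) * (z 2 - z 3))) *
     ((2 * c 0 - 2 * c 2) / z 2 + (2 * c 1 + 2 * c 2) / (z 2 - z 1)
      + (2 * c 3 + 2 * c 2) / (z 2 - z 3) + (2 * c 2 + 2 * c 4) / (z 2 - 1))"

definition C_minus :: "(nat \<Rightarrow> complex) \<Rightarrow> (nat \<Rightarrow> complex) \<Rightarrow> complex mat" where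
  "C_minus z c = (2 / (z 1 - z 2)) \<cdot>\<^sub>m mat_of_rows_list 4
    [[0, 0, - (z 1 / ((2 * c 1 + 1/2) * (z 1 - z 3))), z 2 / ((2 * c 2 + 1/2) * (z 2 - z 3))],
     [0, 0, - (1 / ((2 * c 1 + 1/2) * (z 1 - z 3))), 1 / ((2 * c 2 + 1/2) * (z 2 - z 3))],
     [- (z 1 / ((2 * c 1 - 1/2) * (z 1 - z 3))), - (1 / ((2 * c 1 - 1/2) * (z 1 - z 3))),
        C33 z c, C34 z c],
     [z 2 / ((2 * c 2 - 1/2) * (z 2 - z 3)), 1 / ((2 * c 2 - 1/2) * (z 2 - z 3)),
        C43 z c, C44 z c]]"

end

theory Submission
  imports Defs "HOL-Complex_Analysis.Complex_Analysis"
begin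

text \<open>Splitting functions on the curve as \<open>k0(x) + y k1(x)\<close> turns the intersection form into two integrals
  \<open>\<integral> (\<partial>\<kappa>/\<partial>(cnj x)) H\<close> over the plane minus the branch points, where \<open>\<kappa>' + (\<Sum> a j / (x - z j)) \<kappa> = F\<close> and
  \<open>\<kappa>\<close> is holomorphic off a compact set, with \<open>a j = 2 c j\<close> for the even and \<open>a j = 2 c j + 1/2\<close> for the odd part.
  Since no exponent is an integer, such a \<open>\<kappa>\<close> agrees near every puncture with the unique Laurent
  solution there: two choices differ by a compactly supported function, which does not change the
  integral. For the \<open>\<kappa>\<close> glued from the Laurent solutions by radial cutoffs, Stokes' formula turns
  the integral into the sum of the residues.\<close>

section \<open>Calculus of \<^const>\<open>Ck_on\<close>\<close>

text \<open>The condition that \<open>4 * c j\<close> is no integer says exactly that neither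
  \<open>2 * c j\<close> nor \<open>2 * c j + 1/2\<close> is one. The planar exponents sum to
  \<open>-2 * c 5\<close> and \<open>-2 * c 5 + 5/2\<close>, so index 5 supplies the same condition
  at infinity.

  The intersection form is a definite description. Its value must therefore be attained, and must
  not depend on the two representatives or on the regularization. This is why planar values are
  quantified over every solution and every exact summand.

  Contours are avoided. Residues enter through one explicit area integral, that of
  \<open>dzb (cut p r) x / (x - p)\<close>, with value \<open>-pi\<close>. Together with
  \<open>-2 * \<i>\<close> from the area form and two sheets this gives the factor
  \<open>4 * pi * \<i>\<close>. Compared with \<open>2 * pi * \<i>\<close> there remains a 2, which
  cancels in \<open>2 / (2 * c j)\<close> in the even block and stands in front of the odd
  block.\<close>

lemma has_derivative_cong_open:
  assumes "open U" "x \<in> U" "\<And>x. x \<in> U \<Longrightarrow> f x = g x" "(f has_derivative D) (at x)"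
  shows "(g has_derivative D) (at x)"
  using has_derivative_transform_within_open[OF assms(4,1,2)] assms(3) by auto

lemma Ck_on_cong:
  assumes "open U" "\<And>x. x \<in> U \<Longrightarrow> f x = g x" "Ck_on k U f"
  shows "Ck_on k U g"
  using assms(2,3)
proof (induction k arbitrary: f g)
  case 0
  then show ?case by (simp add: continuous_on_eq)
next
  case (Suc k)
  have d: "(g has_derivative frechet_derivative f (at x)) (at x)" if "x \<in> U" for x
    by (rule has_derivative_cong_open[OF assms(1) that, of f])
       (use Suc.prems that in \<open>auto simp: frechet_derivative_works[symmetric]\<close>)
  then have e: "frechet_derivative f (at x) = frechet_derivative g (at x)" if "x \<in> U" for x
    using that by (metis frechet_derivative_at)
  have "Ck_on k U (\<lambda>x. frechet_derivative g (at x) v)" for v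
    by (rule Suc.IH[of "\<lambda>x. frechet_derivative f (at x) v"]) (use e Suc.prems in auto)
  then show ?case using d by (auto simp: differentiable_def)
qed

text \<open>The derivative may be given in closed form; otherwise each closure property would first
  have to identify \<open>frechet_derivative\<close>, which is a choice operator.\<close>

lemma Ck_on_Suc:
  assumes "open U" "\<And>x. x \<in> U \<Longrightarrow> (f has_derivative D x) (at x)" "\<And>v. Ck_on k U (\<lambda>x. D x v)"
  shows "Ck_on (Suc k) U f"
proof -
  have "D x = frechet_derivative f (at x)" if "x \<in> U" for x
    using assms(2)[OF that] by (metis frechet_derivative_at)
  then have "Ck_on k U (\<lambda>x. frechet_derivative f (at x) v)" for v
    by (intro Ck_on_cong[OF assms(1) _ assms(3)[of v]]) simp
  then show ?thesis using assms(2) by (auto simp: differentiable_def)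
qed

lemma Ck_on_SucD:
  assumes "Ck_on (Suc k) U f"
  shows "x \<in> U \<Longrightarrow> (f has_derivative frechet_derivative f (at x)) (at x)"
    and "Ck_on k U (\<lambda>x. frechet_derivative f (at x) v)"
  using assms by (auto simp: frechet_derivative_works[symmetric])

lemma Ck_on_lower:
  assumes "Ck_on (Suc k) U f"
  shows "Ck_on k U f"
  using assms
proof (induction k arbitrary: f)
  case 0
  then show ?case
    by (auto intro!: continuous_at_imp_continuous_on differentiable_imp_continuous_within)
qed auto

lemma Ck_on_subset: "Ck_on k U f \<Longrightarrow> V \<subseteq> U \<Longrightarrow> Ck_on k V f"
  by (induction k arbitrary: f) (auto intro: continuous_on_subset)

text \<open>\<open>Ck_on\<close> takes derivatives in full neighbourhoods (\<open>at x\<close>, not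
  within \<open>U\<close>), so it depends only on the germs of \<open>f\<close> at the points of
  \<open>U\<close>.\<close>

lemma Ck_on_local:
  assumes "\<And>x. x \<in> U \<Longrightarrow> \<exists>V. open V \<and> x \<in> V \<and> Ck_on k V f"
  shows "Ck_on k U f"
  using assms
proof (induction k arbitrary: f)
  case 0
  show ?case
    unfolding Ck_on.simps
  proof (rule continuous_at_imp_continuous_on, rule ballI)
    fix x assume "x \<in> U"
    from 0[OF this] show "isCont f x" using continuous_on_eq_continuous_at by auto
  qed
next
  case (Suc k)
  have "Ck_on k U (\<lambda>x. frechet_derivative f (at x) v)" for v
    by (rule Suc.IH) (use Suc.prems in fastforce)
  then show ?case using Suc.prems by fastforce
qed

lemma Ck_on_const: "Ck_on k U (\<lambda>x. c)"
proof (induction k arbitrary: c)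
  case (Suc k)
  have "frechet_derivative (\<lambda>x. c) (at x) = (\<lambda>v. 0)" for x :: 'a
    by (metis frechet_derivative_at has_derivative_const)
  then show ?case using Suc by auto
qed simp

lemma Ck_on_id: "open U \<Longrightarrow> Ck_on k U (\<lambda>x. x)"
  by (cases k) (auto intro!: Ck_on_Suc[where D = "\<lambda>x v. v"] Ck_on_const simp del: Ck_on.simps(2))

lemma Ck_on_bounded_linear:
  assumes L: "bounded_linear L" and U: "open U" and "Ck_on k U f"
  shows "Ck_on k U (\<lambda>x. L (f x))"
  using assms(3)
proof (induction k arbitrary: f)
  case 0
  then show ?case using bounded_linear.continuous_on[OF L] by auto
next
  case (Suc k)
  show ?case
    by (rule Ck_on_Suc[OF U bounded_linear.has_derivative[OF L Ck_on_SucD(1)[OF Suc.prems]]])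
      (use Suc Ck_on_SucD(2) in blast)+
qed

lemma Ck_on_add:
  assumes U: "open U" and "Ck_on k U f" "Ck_on k U g"
  shows "Ck_on k U (\<lambda>x. f x + g x)"
  using assms(2,3)
proof (induction k arbitrary: f g)
  case 0
  then show ?case by (auto intro: continuous_on_add)
next
  case (Suc k)
  show ?case
    by (rule Ck_on_Suc[OF U has_derivative_add[OF Ck_on_SucD(1)[OF Suc.prems(1)] Ck_on_SucD(1)[OF Suc.prems(2)]]])
      (use Suc Ck_on_SucD(2) in blast)+
qed

lemma (in bounded_bilinear) Ck_on:
  assumes U: "open U" and "Ck_on k U f" "Ck_on k U g"
  shows "Ck_on k U (\<lambda>x. prod (f x) (g x))"
  using assms(2,3)
proof (induction k arbitrary: f g)
  case 0
  then show ?case by (auto intro: continuous_on)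
next
  case (Suc k)
  show ?case
    by (rule Ck_on_Suc[OF U FDERIV[OF Ck_on_SucD(1)[OF Suc.prems(1)] Ck_on_SucD(1)[OF Suc.prems(2)]]])
      (auto intro!: Ck_on_add U Suc.IH Ck_on_SucD(2) Ck_on_lower[OF Suc.prems(1)] Ck_on_lower[OF Suc.prems(2)]
        Suc.prems simp del: Ck_on.simps)
qed

lemmas Ck_on_mult = bounded_bilinear.Ck_on[OF bounded_bilinear_mult]
lemmas Ck_on_uminus = Ck_on_bounded_linear[OF bounded_linear_minus[OF bounded_linear_ident]]

lemma Ck_on_diff:
  assumes "open U" "Ck_on k U f" "Ck_on k U g"
  shows "Ck_on k U (\<lambda>x. f x - g x)"
  using Ck_on_add[OF assms(1,2) Ck_on_uminus[OF assms(1,3)]] by simp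

lemma Ck_on_sum:
  assumes "open U" "\<And>i. i \<in> I \<Longrightarrow> Ck_on k U (f i)"
  shows "Ck_on k U (\<lambda>x. \<Sum>i\<in>I. f i x)"
  using assms(2)
  by (induction I rule: infinite_finite_induct) (auto intro!: Ck_on_const Ck_on_add assms(1))

lemma Ck_on_Pair:
  assumes "open U" "Ck_on k U f" "Ck_on k U g"
  shows "Ck_on k U (\<lambda>x. (f x, g x))"
proof -
  have "bounded_linear (\<lambda>x::'b. (x, 0::'c))" "bounded_linear (\<lambda>x::'c. (0::'b, x))"
    by (intro bounded_linear_Pair bounded_linear_ident bounded_linear_zero)+
  from Ck_on_add[OF assms(1) Ck_on_bounded_linear[OF this(1) assms(1,2)] Ck_on_bounded_linear[OF this(2) assms(1,3)]]
  show ?thesis by simp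
qed

text \<open>The derivative is \<open>- inverse f * f' * inverse f\<close>, so the induction keeps
  \<open>f\<close> fixed and reuses the claim for \<open>inverse f\<close> itself at the lower
  order.\<close>

lemma Ck_on_inverse:
  fixes f :: "'a::real_normed_vector \<Rightarrow> 'b::real_normed_field"
  assumes U: "open U" and nz: "\<And>x. x \<in> U \<Longrightarrow> f x \<noteq> 0" and "Ck_on k U f"
  shows "Ck_on k U (\<lambda>x. inverse (f x))"
  using assms(3)
proof (induction k)
  case 0
  then show ?case using nz by (auto intro: continuous_on_inverse)
next
  case (Suc k)
  show ?case
    by (rule Ck_on_Suc[OF U Deriv.has_derivative_inverse[OF nz Ck_on_SucD(1)[OF Suc.prems]]])
      (auto intro!: Ck_on_uminus Ck_on_mult U Suc.IH Ck_on_SucD(2) Ck_on_lower[OF Suc.prems]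
        Suc.prems simp del: Ck_on.simps(2))
qed

text \<open>The induction generalizes over the outer function, because the derivative contains
  \<open>h'\<close> composed with \<open>g\<close>. A real middle variable makes the chain rule a
  product of scalars.\<close>

lemma Ck_on_compose_real:
  assumes U: "open U" and "\<And>k. Ck_on k UNIV h" and "\<And>k. Ck_on k U g"
  shows "Ck_on k U (\<lambda>x. h (g x :: real) :: real)"
  using assms(2)
proof (induction k arbitrary: h)
  case 0
  then have "continuous_on UNIV h" "continuous_on U g" using assms(3)[of 0] by (metis Ck_on.simps(1))+
  then show ?case by (auto intro: continuous_on_compose2)
next
  case (Suc k)
  have d: "((\<lambda>x. h (g x)) has_derivative
      (\<lambda>v. frechet_derivative h (at (g x)) 1 * frechet_derivative g (at x) v)) (at x)" if "x \<in> U" for x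
  proof -
    have 1: "(g has_derivative frechet_derivative g (at x)) (at x)"
      by (rule Ck_on_SucD(1)[OF assms(3) that])
    have 2: "(h has_derivative frechet_derivative h (at (g x))) (at (g x))"
      using Ck_on_SucD(1)[OF Suc.prems, of "g x"] by simp
    have "linear (frechet_derivative h (at (g x)))" using 2 has_derivative_linear by blast
    then have "frechet_derivative h (at (g x)) r = frechet_derivative h (at (g x)) 1 * r" for r
      using linear_cmul[of "frechet_derivative h (at (g x))" r 1] unfolding real_scaleR_def mult_1_right
      by (metis mult.commute)
    then show ?thesis
      by (intro has_derivative_eq_rhs[OF diff_chain_at[OF 1 2, unfolded o_def]] ext)
  qed
  show ?case
    by (rule Ck_on_Suc[OF U d])
      (use Suc.IH[of "\<lambda>x. frechet_derivative h (at x) 1"] Ck_on_SucD(2)[OF Suc.prems]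
        Ck_on_SucD(2)[OF assms(3)] in \<open>auto intro!: Ck_on_mult U simp del: Ck_on.simps\<close>)
qed

lemma Ck_on_holomorphic:
  assumes U: "open U" and "g holomorphic_on U"
  shows "Ck_on k U g"
  using assms(2)
proof (induction k arbitrary: g)
  case 0
  then show ?case by (auto intro: holomorphic_on_imp_continuous_on)
next
  case (Suc k)
  show ?case
    by (rule Ck_on_Suc[OF U, where D = "\<lambda>x v. deriv g x * v"])
      (use Suc holomorphic_derivI[OF Suc.prems U] in
        \<open>auto intro!: Ck_on_mult Ck_on_const U holomorphic_deriv simp: has_field_derivative_def\<close>)
qed

definition smooth_on :: "'a::real_normed_vector set \<Rightarrow> ('a \<Rightarrow> 'b::real_normed_vector) \<Rightarrow> bool" where
  "smooth_on U f \<longleftrightarrow> (\<forall>k. Ck_on k U f)"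

lemma smooth_onI: "(\<And>k. Ck_on k U f) \<Longrightarrow> smooth_on U f"
  and smooth_onD: "smooth_on U f \<Longrightarrow> Ck_on k U f"
  by (auto simp: smooth_on_def)

lemma smooth_on_subset: "smooth_on U f \<Longrightarrow> V \<subseteq> U \<Longrightarrow> smooth_on V f"
  by (auto simp: smooth_on_def intro: Ck_on_subset simp del: Ck_on.simps)

lemma smooth_on_cong: "open U \<Longrightarrow> smooth_on U f \<Longrightarrow> (\<And>x. x \<in> U \<Longrightarrow> f x = g x) \<Longrightarrow> smooth_on U g"
  using Ck_on_cong by (metis smooth_on_def)

lemma smooth_on_local:
  assumes "\<And>x. x \<in> U \<Longrightarrow> \<exists>V. open V \<and> x \<in> V \<and> smooth_on V f"
  shows "smooth_on U f"
  using assms by (intro smooth_onI Ck_on_local) (meson smooth_onD)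

lemma smooth_on_Un:
  assumes "open U" "open V" "smooth_on U f" "smooth_on V f"
  shows "smooth_on (U \<union> V) f"
  using assms by (intro smooth_on_local) blast

lemma smooth_on_frechet: "smooth_on U f \<Longrightarrow> smooth_on U (\<lambda>x. frechet_derivative f (at x) v)"
  unfolding smooth_on_def by (intro allI Ck_on_SucD(2)) simp

lemma smooth_on_imp_differentiable: "smooth_on U f \<Longrightarrow> x \<in> U \<Longrightarrow> f differentiable (at x)"
  using Ck_on.simps(2) smooth_on_def by blast

lemma smooth_on_imp_continuous_on: "smooth_on U f \<Longrightarrow> continuous_on U f"
  by (metis Ck_on.simps(1) smooth_on_def)

lemma smooth_on_const: "smooth_on U (\<lambda>x. c)"
  and smooth_on_id: "open U \<Longrightarrow> smooth_on U (\<lambda>x. x)"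
  and smooth_on_add: "open U \<Longrightarrow> smooth_on U f \<Longrightarrow> smooth_on U g \<Longrightarrow> smooth_on U (\<lambda>x. f x + g x)"
  and smooth_on_diff: "open U \<Longrightarrow> smooth_on U f \<Longrightarrow> smooth_on U g \<Longrightarrow> smooth_on U (\<lambda>x. f x - g x)"
  and smooth_on_uminus: "open U \<Longrightarrow> smooth_on U f \<Longrightarrow> smooth_on U (\<lambda>x. - f x)"
  and smooth_on_Pair: "open U \<Longrightarrow> smooth_on U f \<Longrightarrow> smooth_on U h \<Longrightarrow> smooth_on U (\<lambda>x. (f x, h x))"
  and smooth_on_sum: "open U \<Longrightarrow> (\<And>i. i \<in> I \<Longrightarrow> smooth_on U (F i)) \<Longrightarrow> smooth_on U (\<lambda>x. \<Sum>i\<in>I. F i x)"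
  and smooth_on_bounded_linear: "bounded_linear L \<Longrightarrow> open U \<Longrightarrow> smooth_on U f \<Longrightarrow> smooth_on U (\<lambda>x. L (f x))"
  by (simp_all add: smooth_on_def Ck_on_const Ck_on_id Ck_on_add Ck_on_diff Ck_on_uminus Ck_on_Pair
      Ck_on_sum Ck_on_bounded_linear del: Ck_on.simps)

lemma smooth_on_mult:
  fixes f g :: "'a::real_normed_vector \<Rightarrow> 'b::real_normed_algebra"
  shows "open U \<Longrightarrow> smooth_on U f \<Longrightarrow> smooth_on U g \<Longrightarrow> smooth_on U (\<lambda>x. f x * g x)"
  by (simp add: smooth_on_def Ck_on_mult del: Ck_on.simps)

lemma smooth_on_divide:
  fixes f g :: "'a::real_normed_vector \<Rightarrow> 'b::real_normed_field"
  assumes "open U" "smooth_on U f" "smooth_on U g" "\<And>x. x \<in> U \<Longrightarrow> g x \<noteq> 0"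
  shows "smooth_on U (\<lambda>x. f x / g x)"
  unfolding divide_inverse using assms by (intro smooth_onI Ck_on_mult Ck_on_inverse) (auto intro: smooth_onD)

lemma smooth_on_holomorphic: "open U \<Longrightarrow> g holomorphic_on U \<Longrightarrow> smooth_on U g"
  by (simp add: smooth_on_def Ck_on_holomorphic del: Ck_on.simps)

lemma smooth_on_compose_real:
  "open U \<Longrightarrow> smooth_on UNIV h \<Longrightarrow> smooth_on U g \<Longrightarrow> smooth_on U (\<lambda>x. h (g x :: real) :: real)"
  by (simp add: smooth_on_def Ck_on_compose_real del: Ck_on.simps)


section \<open>A smooth radial cutoff function\<close>

text \<open>The powers of \<open>t\<close> in the denominator make the linear span of the family
  closed under differentiation, so smoothness follows by one induction for all \<open>n\<close> at
  once.\<close>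

definition flat_exp :: "nat \<Rightarrow> real \<Rightarrow> real" where
  "flat_exp n t = (if t > 0 then exp (- (1 / t)) / t ^ n else 0)"

lemma flat_exp_tendsto_0: "(flat_exp n \<longlongrightarrow> 0) (at 0)"
proof -
  have "((\<lambda>t. inverse t ^ n / exp (inverse t)) \<longlongrightarrow> 0) (at_right (0::real))"
    by (rule filterlim_compose[OF tendsto_power_div_exp_0 filterlim_inverse_at_top_right])
  then have "((\<lambda>t. exp (- (1 / t)) / t ^ n) \<longlongrightarrow> 0) (at_right (0::real))"
    by (simp add: exp_minus field_simps)
  then have "(flat_exp n \<longlongrightarrow> 0) (at_right 0)"
    by (rule Lim_transform_eventually)
       (auto simp: flat_exp_def eventually_at_right_less intro: eventually_mono[OF eventually_at_right_less])
  moreover have "(flat_exp n \<longlongrightarrow> 0) (at_left 0)"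
    by (rule Lim_transform_eventually[OF tendsto_const])
       (auto simp: flat_exp_def eventually_at_filter)
  ultimately show ?thesis by (simp add: filterlim_split_at)
qed

lemma has_real_derivative_flat_exp:
  "(flat_exp n has_real_derivative flat_exp (n + 2) t - n * flat_exp (n + 1) t) (at t)"
proof (cases t "0::real" rule: linorder_cases)
  case less
  have "((\<lambda>x. 0) has_real_derivative 0) (at t)" by simp
  then have "(flat_exp n has_real_derivative 0) (at t)"
    by (rule DERIV_cong_ev[THEN iffD1, rotated -1])
       (use less in \<open>auto simp: flat_exp_def eventually_nhds intro!: exI[of _ "{..<0}"]\<close>)
  then show ?thesis using less by (simp add: flat_exp_def)
next
  case equal
  \<comment> \<open>The difference quotient at 0 is \<open>flat_exp (Suc n) h\<close>.\<close>
  have "((\<lambda>h. (flat_exp n (0 + h) - flat_exp n 0) / h) \<longlongrightarrow> 0) (at 0)"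
    by (rule Lim_transform_eventually[OF flat_exp_tendsto_0[of "Suc n"]])
       (auto simp: flat_exp_def eventually_at_filter)
  then show ?thesis using equal by (simp add: DERIV_def flat_exp_def)
next
  case greater
  have 1: "(inverse has_real_derivative - ((inverse t)\<^sup>2)) (at t)"
    using DERIV_inverse[of t UNIV] greater by (simp add: power2_eq_square)
  have d: "((\<lambda>t. exp (- inverse t) * inverse t ^ n) has_real_derivative
      exp (- inverse t) * (- (- ((inverse t)\<^sup>2))) * inverse t ^ n
      + (n * ((- ((inverse t)\<^sup>2)) * inverse t ^ (n - Suc 0))) * exp (- inverse t)) (at t)"
    by (intro DERIV_mult DERIV_fun_exp DERIV_minus DERIV_power 1)
  have "n * (((inverse t)\<^sup>2) * inverse t ^ (n - Suc 0)) = n * inverse t ^ (n + 1)"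
    by (cases n) (simp_all add: power2_eq_square)
  then have e: "(n * ((- ((inverse t)\<^sup>2)) * inverse t ^ (n - Suc 0))) * exp (- inverse t)
      = - (n * (exp (- inverse t) * inverse t ^ (n + 1)))"
    by (simp add: mult.commute mult.left_commute)
  have "((\<lambda>t. exp (- inverse t) * inverse t ^ n) has_real_derivative
      exp (- inverse t) * inverse t ^ (n + 2) - n * (exp (- inverse t) * inverse t ^ (n + 1))) (at t)"
    by (rule DERIV_cong[OF d]) (unfold e, simp add: power_add power2_eq_square mult.commute mult.left_commute)
  then have "((\<lambda>t. exp (- (1 / t)) / t ^ n) has_real_derivative flat_exp (n + 2) t - n * flat_exp (n + 1) t) (at t)"
    using greater unfolding flat_exp_def by (simp only: divide_inverse power_inverse if_True mult_1_left)
  then show ?thesis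
    by (rule DERIV_cong_ev[THEN iffD1, rotated -1])
       (use greater in \<open>auto simp: flat_exp_def eventually_nhds intro!: exI[of _ "{0<..}"]\<close>)
qed

lemma smooth_on_flat_exp: "smooth_on UNIV (flat_exp n)"
proof (rule smooth_onI)
  show "Ck_on k UNIV (flat_exp n)" for k
  proof (induction k arbitrary: n)
    case 0
    then show ?case
      using has_real_derivative_flat_exp by (auto intro!: continuous_at_imp_continuous_on intro: DERIV_isCont)
  next
    case (Suc k)
    show ?case
      by (rule Ck_on_Suc[OF open_UNIV has_real_derivative_flat_exp[THEN has_field_derivative_imp_has_derivative]])
         (intro Ck_on_mult Ck_on_diff Ck_on_const Suc open_UNIV)
  qed
qed

definition profile :: "real \<Rightarrow> real" where
  "profile s = flat_exp 0 (1/2 - s) / (flat_exp 0 (1/2 - s) + flat_exp 0 (s - 1/4))"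

lemma profile_eq_1: "s \<le> 1/4 \<Longrightarrow> profile s = 1"
  and profile_eq_0: "s \<ge> 1/2 \<Longrightarrow> profile s = 0"
  by (auto simp: profile_def flat_exp_def)

lemma smooth_on_profile: "smooth_on UNIV profile"
proof -
  have "flat_exp 0 (1/2 - s) + flat_exp 0 (s - 1/4) > 0" for s
    by (auto simp: flat_exp_def intro: add_pos_nonneg add_nonneg_pos)
  then show ?thesis
    unfolding profile_def[abs_def]
    by (intro smooth_on_divide smooth_on_add smooth_on_compose_real[OF _ smooth_on_flat_exp]
        smooth_on_diff smooth_on_const smooth_on_id open_UNIV) (simp add: less_imp_neq[symmetric])
qed

text \<open>The squared distance is smooth at \<open>p\<close>, unlike the norm. Since
  \<open>profile\<close> drops from 1 to 0 between \<open>1/4\<close> and \<open>1/2\<close>, the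
  cutoff is 1 up to radius \<open>r / 2\<close> and 0 from \<open>3/4 * r\<close> on:
  \<open>(3/4)^2 = 9/16\<close> exceeds \<open>1/2\<close>.\<close>

definition cut :: "complex \<Rightarrow> real \<Rightarrow> complex \<Rightarrow> complex" where
  "cut p r x = of_real (profile ((norm (x - p) / r)\<^sup>2))"

lemma smooth_on_cut: "open U \<Longrightarrow> smooth_on U (cut p r)"
proof -
  assume U: "open U"
  have *: "(norm (x - p) / r)\<^sup>2 = ((Re x - Re p) * (Re x - Re p) + (Im x - Im p) * (Im x - Im p)) * inverse (r\<^sup>2)" for x
    unfolding power_divide cmod_power2 by (simp add: power2_eq_square divide_inverse)
  show ?thesis
    unfolding cut_def[abs_def] *
    by (intro smooth_on_bounded_linear[OF bounded_linear_of_real] smooth_on_compose_real[OF _ smooth_on_profile]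
        smooth_on_add smooth_on_mult smooth_on_diff smooth_on_const U
        smooth_on_bounded_linear[OF bounded_linear_Re] smooth_on_bounded_linear[OF bounded_linear_Im] smooth_on_id)
qed

lemma cut_eq_1:
  assumes "r > 0" "norm (x - p) \<le> r / 2"
  shows "cut p r x = 1"
proof -
  have "norm (x - p) / r \<le> 1/2" using assms by (simp add: field_simps)
  then have "(norm (x - p) / r)\<^sup>2 \<le> (1/2)\<^sup>2" using assms by (intro power_mono) auto
  then show ?thesis by (simp add: cut_def profile_eq_1 power2_eq_square)
qed

lemma cut_eq_0:
  assumes "r > 0" "norm (x - p) \<ge> 3/4 * r"
  shows "cut p r x = 0"
proof -
  have "norm (x - p) / r \<ge> 3/4" using assms by (simp add: field_simps)
  then have "(norm (x - p) / r)\<^sup>2 \<ge> (3/4)\<^sup>2" using assms by (intro power_mono) auto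
  moreover have "(3/4::real)\<^sup>2 \<ge> 1/2" by (simp add: power2_eq_square)
  ultimately show ?thesis by (simp add: cut_def profile_eq_0)
qed

section \<open>Wirtinger derivatives and the Stokes formula in the plane\<close>

definition dz :: "(complex \<Rightarrow> complex) \<Rightarrow> complex \<Rightarrow> complex" where
  "dz f x = (frechet_derivative f (at x) 1 - \<i> * frechet_derivative f (at x) \<i>) / 2"

definition dzb :: "(complex \<Rightarrow> complex) \<Rightarrow> complex \<Rightarrow> complex" where
  "dzb f x = (frechet_derivative f (at x) 1 + \<i> * frechet_derivative f (at x) \<i>) / 2"

lemma dz_eqI: "(f has_derivative D) (at x) \<Longrightarrow> dz f x = (D 1 - \<i> * D \<i>) / 2"
  and dzb_eqI: "(f has_derivative D) (at x) \<Longrightarrow> dzb f x = (D 1 + \<i> * D \<i>) / 2"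
  unfolding dz_def dzb_def by (drule frechet_derivative_at, simp)+

lemma dz_cong:
  assumes "open U" "x \<in> U" "\<And>x. x \<in> U \<Longrightarrow> f x = g x" "f differentiable (at x)"
  shows "dz g x = dz f x" "dzb g x = dzb f x"
proof -
  note d = has_derivative_cong_open[OF assms(1,2,3) assms(4)[unfolded frechet_derivative_works]]
  show "dz g x = dz f x" by (subst dz_eqI[OF d]) (simp_all add: dz_def)
  show "dzb g x = dzb f x" by (subst dzb_eqI[OF d]) (simp_all add: dzb_def)
qed

lemma dz_mult:
  assumes "f differentiable (at x)" "g differentiable (at x)"
  shows "dz (\<lambda>x. f x * g x) x = dz f x * g x + f x * dz g x"
    and "dzb (\<lambda>x. f x * g x) x = dzb f x * g x + f x * dzb g x"
proof -
  note d = has_derivative_mult[OF assms[unfolded frechet_derivative_works]]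
  show "dz (\<lambda>x. f x * g x) x = dz f x * g x + f x * dz g x"
    by (subst dz_eqI[OF d]) (simp add: dz_def field_simps)
  show "dzb (\<lambda>x. f x * g x) x = dzb f x * g x + f x * dzb g x"
    by (subst dzb_eqI[OF d]) (simp add: dzb_def field_simps)
qed

lemma dz_add:
  assumes "f differentiable (at x)" "g differentiable (at x)"
  shows "dz (\<lambda>x. f x + g x) x = dz f x + dz g x"
    and "dzb (\<lambda>x. f x + g x) x = dzb f x + dzb g x"
proof -
  note d = has_derivative_add[OF assms[unfolded frechet_derivative_works]]
  show "dz (\<lambda>x. f x + g x) x = dz f x + dz g x"
    by (subst dz_eqI[OF d]) (simp add: dz_def field_simps)
  show "dzb (\<lambda>x. f x + g x) x = dzb f x + dzb g x"
    by (subst dzb_eqI[OF d]) (simp add: dzb_def field_simps)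
qed

lemma dz_diff:
  assumes "f differentiable (at x)" "g differentiable (at x)"
  shows "dz (\<lambda>x. f x - g x) x = dz f x - dz g x"
    and "dzb (\<lambda>x. f x - g x) x = dzb f x - dzb g x"
proof -
  note d = has_derivative_diff[OF assms[unfolded frechet_derivative_works]]
  show "dz (\<lambda>x. f x - g x) x = dz f x - dz g x"
    by (subst dz_eqI[OF d]) (simp add: dz_def field_simps)
  show "dzb (\<lambda>x. f x - g x) x = dzb f x - dzb g x"
    by (subst dzb_eqI[OF d]) (simp add: dzb_def field_simps)
qed

lemma dz_field_derivative:
  assumes "(g has_field_derivative g') (at x)"
  shows "dz g x = g'" "dzb g x = 0"
  using assms by (simp_all add: has_field_derivative_def dz_eqI dzb_eqI algebra_simps)

lemma dz_const [simp]: "dz (\<lambda>x. c) x = 0" "dzb (\<lambda>x. c) x = 0"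
  using dz_field_derivative[OF DERIV_const[of c]] by auto

lemma dz_sum:
  assumes "\<And>i. i \<in> I \<Longrightarrow> f i differentiable (at x)"
  shows "dz (\<lambda>x. \<Sum>i\<in>I. f i x) x = (\<Sum>i\<in>I. dz (f i) x)"
    and "dzb (\<lambda>x. \<Sum>i\<in>I. f i x) x = (\<Sum>i\<in>I. dzb (f i) x)"
  using assms
  by (induction I rule: infinite_finite_induct) (auto simp: dz_add differentiable_sum)

text \<open>Turns \<open>dzb f x = 0\<close> into complex differentiability, which is how solutions
  are recognized as holomorphic off a compact set.\<close>

lemma frechet_derivative_Wirtinger:
  assumes "f differentiable (at x)"
  shows "frechet_derivative f (at x) v = dz f x * v + dzb f x * cnj v"
proof -
  have l: "linear (frechet_derivative f (at x))"
    using assms by (rule linear_frechet_derivative)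
  have "frechet_derivative f (at x) v = frechet_derivative f (at x) (Re v *\<^sub>R 1 + Im v *\<^sub>R \<i>)"
    by (metis complex_eq scaleR_conv_of_real mult.commute mult.right_neutral)
  also have "\<dots> = of_real (Re v) * frechet_derivative f (at x) 1 + of_real (Im v) * frechet_derivative f (at x) \<i>"
    by (simp only: linear_add[OF l] linear_cmul[OF l]) (simp add: scaleR_conv_of_real)
  also have "\<dots> = dz f x * v + dzb f x * cnj v"
    unfolding dz_def dzb_def complex_eq_iff by (simp add: field_simps)
  finally show ?thesis .
qed

lemma smooth_on_dz: "open U \<Longrightarrow> smooth_on U f \<Longrightarrow> smooth_on U (dz f)"
  and smooth_on_dzb: "open U \<Longrightarrow> smooth_on U f \<Longrightarrow> smooth_on U (dzb f)"
  unfolding dz_def[abs_def] dzb_def[abs_def]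
  by (auto intro!: smooth_on_divide smooth_on_diff smooth_on_add smooth_on_mult smooth_on_const smooth_on_frechet)

lemma dz_locally_const: "open U \<Longrightarrow> x \<in> U \<Longrightarrow> (\<And>x. x \<in> U \<Longrightarrow> f x = c) \<Longrightarrow> dz f x = 0"
  "open U \<Longrightarrow> x \<in> U \<Longrightarrow> (\<And>x. x \<in> U \<Longrightarrow> f x = c) \<Longrightarrow> dzb f x = 0"
  using dz_cong[of U x "\<lambda>x. c" f] by auto

section \<open>Symmetry of second derivatives\<close>

text \<open>The mean value theorem is applied twice to the second difference: along \<open>v\<close>
  to the increment in direction \<open>w\<close>, then along \<open>w\<close> to the derivative in
  direction \<open>v\<close>. Real values are what yields an exact intermediate point.\<close>

lemma mixed_difference_mean_value:
  fixes f :: "'a::real_normed_vector \<Rightarrow> real"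
  assumes C2: "Ck_on 2 U f"
    and sub: "\<And>s t. 0 \<le> s \<Longrightarrow> s \<le> h \<Longrightarrow> 0 \<le> t \<Longrightarrow> t \<le> h \<Longrightarrow> x + s *\<^sub>R v + t *\<^sub>R w \<in> U" and h: "h > 0"
  obtains s t where "0 \<le> s" "s \<le> h" "0 \<le> t" "t \<le> h"
    "f (x + h *\<^sub>R v + h *\<^sub>R w) - f (x + h *\<^sub>R v) - f (x + h *\<^sub>R w) + f x
      = h * (h * frechet_derivative (\<lambda>y. frechet_derivative f (at y) v) (at (x + s *\<^sub>R v + t *\<^sub>R w)) w)"
proof -
  let ?D = "\<lambda>v y. frechet_derivative f (at y) v"
  have along: "((\<lambda>s. g (p + s *\<^sub>R u)) has_real_derivative frechet_derivative g (at (p + s *\<^sub>R u)) u) (at s)"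
    if "g differentiable (at (p + s *\<^sub>R u))" for g :: "'a \<Rightarrow> real" and p u s
  proof -
    have 1: "((\<lambda>s. p + s *\<^sub>R u) has_derivative (\<lambda>s. s *\<^sub>R u)) (at s)"
      by (auto intro!: derivative_eq_intros)
    have 2: "(g has_derivative frechet_derivative g (at (p + s *\<^sub>R u))) (at (p + s *\<^sub>R u))"
      using that by (simp add: frechet_derivative_works)
    have "((\<lambda>s. g (p + s *\<^sub>R u)) has_derivative (\<lambda>r. frechet_derivative g (at (p + s *\<^sub>R u)) (r *\<^sub>R u))) (at s)"
      using diff_chain_at[OF 1 2] by (simp add: o_def)
    moreover have "frechet_derivative g (at (p + s *\<^sub>R u)) (r *\<^sub>R u) = frechet_derivative g (at (p + s *\<^sub>R u)) u * r" for r
      using linear_cmul[OF linear_frechet_derivative[OF that]] by (simp add: mult.commute)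
    ultimately show ?thesis
      unfolding has_field_derivative_def by (rule has_derivative_eq_rhs[OF _ ext])
  qed
  have C2': "Ck_on (Suc (Suc 0)) U f" using C2 by (simp add: numeral_2_eq_2)
  have df: "f differentiable (at y)" if "y \<in> U" for y using C2' that by auto
  have dD: "?D v differentiable (at y)" if "y \<in> U" for y using C2' that by auto
  let ?g = "\<lambda>s. f ((x + h *\<^sub>R w) + s *\<^sub>R v) - f (x + s *\<^sub>R v)"
  have "\<exists>s>0. s < h \<and> ?g h - ?g 0 = (h - 0) * (?D v ((x + h *\<^sub>R w) + s *\<^sub>R v) - ?D v (x + s *\<^sub>R v))"
  proof (rule MVT2[OF h, of ?g])
    fix s assume s: "0 \<le> s" "s \<le> h"
    have "(x + h *\<^sub>R w) + s *\<^sub>R v \<in> U" "x + s *\<^sub>R v \<in> U"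
      using sub[of s h] sub[of s 0] s h by (auto simp: algebra_simps)
    then show "(?g has_real_derivative ?D v ((x + h *\<^sub>R w) + s *\<^sub>R v) - ?D v (x + s *\<^sub>R v)) (at s)"
      by (intro DERIV_diff along df)
  qed
  then obtain s where s: "0 < s" "s < h"
    "?g h - ?g 0 = h * (?D v ((x + h *\<^sub>R w) + s *\<^sub>R v) - ?D v (x + s *\<^sub>R v))" by auto
  let ?k = "\<lambda>t. ?D v ((x + s *\<^sub>R v) + t *\<^sub>R w)"
  have "\<exists>t>0. t < h \<and> ?k h - ?k 0 = (h - 0) * frechet_derivative (?D v) (at ((x + s *\<^sub>R v) + t *\<^sub>R w)) w"
  proof (rule MVT2[OF h, of ?k])
    fix t assume t: "0 \<le> t" "t \<le> h"
    show "(?k has_real_derivative frechet_derivative (?D v) (at ((x + s *\<^sub>R v) + t *\<^sub>R w)) w) (at t)"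
      by (rule along, rule dD, rule sub) (use s t in auto)
  qed
  then obtain t where t: "0 < t" "t < h" "?k h - ?k 0 = h * frechet_derivative (?D v) (at ((x + s *\<^sub>R v) + t *\<^sub>R w)) w"
    by auto
  have "?D v ((x + h *\<^sub>R w) + s *\<^sub>R v) - ?D v (x + s *\<^sub>R v) = ?k h - ?k 0" by (simp add: algebra_simps)
  then have "?g h - ?g 0 = h * (h * frechet_derivative (?D v) (at (x + s *\<^sub>R v + t *\<^sub>R w)) w)"
    using s(3) t(3) by simp
  then show thesis
    by (intro that[of s t]) (use s t in \<open>auto simp: algebra_simps\<close>)
qed

text \<open>If the inequality failed, a constant \<open>c\<close> would separate the two mixed
  derivatives on a whole ball. But the second difference over a small parallelogram is symmetric in
  \<open>v\<close> and \<open>w\<close>, and it equals \<open>h * h\<close> times a value of either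
  of them.\<close>

lemma frechet_derivative_commute_le:
  fixes f :: "'a::real_normed_vector \<Rightarrow> real"
  assumes U: "open U" "x \<in> U" and C2: "Ck_on 2 U f"
  shows "frechet_derivative (\<lambda>y. frechet_derivative f (at y) v) (at x) w
    \<le> frechet_derivative (\<lambda>y. frechet_derivative f (at y) w) (at x) v"
proof (rule ccontr)
  let ?A = "\<lambda>v w y. frechet_derivative (\<lambda>y. frechet_derivative f (at y) v) (at y) w"
  assume "\<not> ?thesis"
  then obtain c where c: "?A w v x < c" "c < ?A v w x" using dense by (metis not_le)
  have cont: "isCont (?A v w) x" for v w
  proof -
    have "Ck_on (Suc (Suc 0)) U f" using C2 by (simp add: numeral_2_eq_2)
    then have "continuous_on U (?A v w)" by auto
    then show ?thesis using U continuous_on_eq_continuous_at by blast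
  qed
  have isCont_iff_tendsto_nhds: "isCont g x \<longleftrightarrow> (g \<longlongrightarrow> g x) (nhds x)" for g :: "'a \<Rightarrow> real"
    by (simp add: isCont_def tendsto_at_iff_tendsto_nhds)
  have "\<forall>\<^sub>F y in nhds x. y \<in> U \<and> ?A w v y < c \<and> c < ?A v w y"
    using order_tendstoD(2)[OF cont[unfolded isCont_iff_tendsto_nhds, of w v] c(1)]
      order_tendstoD(1)[OF cont[unfolded isCont_iff_tendsto_nhds, of v w] c(2)]
      eventually_nhds_in_open[OF U]
    by eventually_elim auto
  then obtain e where e: "e > 0" "\<And>y. dist y x < e \<Longrightarrow> y \<in> U \<and> ?A w v y < c \<and> c < ?A v w y"
    by (auto simp: eventually_nhds_metric)
  \<comment> \<open>Keeps the parallelogram with sides \<open>h v\<close> and \<open>h w\<close>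
    inside the ball of radius \<open>e\<close>; the summand 1 keeps the denominator positive when
    both vectors vanish.\<close>
  define h where "h = e / (norm v + norm w + 1)"
  have h: "h > 0" using e(1) by (simp add: h_def add_nonneg_pos)
  have he: "h * (norm v + norm w) < e"
  proof -
    have "h * (norm v + norm w + 1) = e" unfolding h_def by (simp add: add_nonneg_eq_0_iff)
    then show ?thesis using h by (simp add: algebra_simps)
  qed
  have near: "dist (x + s *\<^sub>R v + t *\<^sub>R w) x < e" if "0 \<le> s" "s \<le> h" "0 \<le> t" "t \<le> h" for s t
  proof -
    have "dist (x + s *\<^sub>R v + t *\<^sub>R w) x \<le> s * norm v + t * norm w"
      using norm_triangle_ineq[of "s *\<^sub>R v" "t *\<^sub>R w"] that by (simp add: dist_norm add.assoc)
    also have "\<dots> \<le> h * (norm v + norm w)"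
      using that by (simp add: distrib_left mult_right_mono add_mono)
    finally show ?thesis using he by simp
  qed
  obtain s t where st: "0 \<le> s" "s \<le> h" "0 \<le> t" "t \<le> h"
    "f (x + h *\<^sub>R v + h *\<^sub>R w) - f (x + h *\<^sub>R v) - f (x + h *\<^sub>R w) + f x = h * (h * ?A v w (x + s *\<^sub>R v + t *\<^sub>R w))"
    using mixed_difference_mean_value[OF C2, of h x v w] near e(2) h by metis
  have near': "dist (x + s *\<^sub>R w + t *\<^sub>R v) x < e" if "0 \<le> s" "s \<le> h" "0 \<le> t" "t \<le> h" for s t
    using near[of t s] that by (simp add: algebra_simps)
  obtain s' t' where st': "0 \<le> s'" "s' \<le> h" "0 \<le> t'" "t' \<le> h"
    "f (x + h *\<^sub>R w + h *\<^sub>R v) - f (x + h *\<^sub>R w) - f (x + h *\<^sub>R v) + f x = h * (h * ?A w v (x + s' *\<^sub>R w + t' *\<^sub>R v))"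
    using mixed_difference_mean_value[OF C2, of h x w v] near' e(2) h by metis
  have "h * (h * ?A v w (x + s *\<^sub>R v + t *\<^sub>R w)) = h * (h * ?A w v (x + s' *\<^sub>R w + t' *\<^sub>R v))"
    using st(5) st'(5) by (simp add: algebra_simps)
  then have "?A v w (x + s *\<^sub>R v + t *\<^sub>R w) = ?A w v (x + s' *\<^sub>R w + t' *\<^sub>R v)" using h by simp
  moreover have "c < ?A v w (x + s *\<^sub>R v + t *\<^sub>R w)" using e(2)[OF near[OF st(1-4)]] by simp
  moreover have "?A w v (x + s' *\<^sub>R w + t' *\<^sub>R v) < c" using e(2)[OF near'[OF st'(1-4)]] by simp
  ultimately show False by linarith
qed

lemma frechet_derivative_bounded_linear:
  assumes "bounded_linear L" "f differentiable (at x)"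
  shows "frechet_derivative (\<lambda>x. L (f x)) (at x) v = L (frechet_derivative f (at x) v)"
  using frechet_derivative_at[OF bounded_linear.has_derivative[OF assms(1) assms(2)[unfolded frechet_derivative_works]]]
  by metis

lemma frechet_derivative_commute:
  fixes f :: "'a::real_normed_vector \<Rightarrow> complex"
  assumes U: "open U" "x \<in> U" and sm: "smooth_on U f"
  shows "frechet_derivative (\<lambda>y. frechet_derivative f (at y) v) (at x) w
    = frechet_derivative (\<lambda>y. frechet_derivative f (at y) w) (at x) v"
proof -
  \<comment> \<open>Real and imaginary parts reduce the claim to the real inequality, used in both
    orders.\<close>
  have *: "L (frechet_derivative (\<lambda>y. frechet_derivative f (at y) v) (at x) w)
    = L (frechet_derivative (\<lambda>y. frechet_derivative f (at y) w) (at x) v)"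
    if L: "bounded_linear L" for L :: "complex \<Rightarrow> real"
  proof -
    have e: "frechet_derivative (\<lambda>y. frechet_derivative (\<lambda>y. L (f y)) (at y) v) (at x) w
        = L (frechet_derivative (\<lambda>y. frechet_derivative f (at y) v) (at x) w)" for v w
    proof -
      have d: "(\<lambda>y. frechet_derivative f (at y) v) differentiable (at x)"
        by (rule smooth_on_imp_differentiable[OF smooth_on_frechet[OF sm] U(2)])
      have "((\<lambda>y. frechet_derivative (\<lambda>y. L (f y)) (at y) v) has_derivative
          (\<lambda>w. L (frechet_derivative (\<lambda>y. frechet_derivative f (at y) v) (at x) w))) (at x)"
      proof (rule has_derivative_cong_open[OF U, of "\<lambda>y. L (frechet_derivative f (at y) v)"])
        show "L (frechet_derivative f (at y) v) = frechet_derivative (\<lambda>y. L (f y)) (at y) v" if "y \<in> U" for y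
          by (rule frechet_derivative_bounded_linear[OF L smooth_on_imp_differentiable[OF sm that], symmetric])
        show "((\<lambda>y. L (frechet_derivative f (at y) v)) has_derivative
          (\<lambda>w. L (frechet_derivative (\<lambda>y. frechet_derivative f (at y) v) (at x) w))) (at x)"
          by (rule bounded_linear.has_derivative[OF L d[unfolded frechet_derivative_works]])
      qed
      from fun_cong[OF frechet_derivative_at[OF this], of w] show ?thesis by simp
    qed
    have "Ck_on 2 U (\<lambda>y. L (f y))" by (rule Ck_on_bounded_linear[OF L U(1) smooth_onD[OF sm]])
    from frechet_derivative_commute_le[OF U this, of v w] frechet_derivative_commute_le[OF U this, of w v]
    show ?thesis unfolding e by simp
  qed
  show ?thesis
    using *[OF bounded_linear_Re] *[OF bounded_linear_Im] by (rule complex_eqI)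
qed

lemma dz_dzb_commute:
  assumes U: "open U" "x \<in> U" and sm: "smooth_on U f"
  shows "dz (dzb f) x = dzb (dz f) x"
proof -
  let ?D = "\<lambda>v y. frechet_derivative f (at y) v"
  have d: "(?D v has_derivative frechet_derivative (?D v) (at x)) (at x)" for v
    using smooth_on_imp_differentiable[OF smooth_on_frechet[OF sm] U(2)]
    by (simp add: frechet_derivative_works)
  have 1: "(dzb f has_derivative (\<lambda>w. (frechet_derivative (?D 1) (at x) w + \<i> * frechet_derivative (?D \<i>) (at x) w) / 2)) (at x)"
    unfolding dzb_def[abs_def] by (intro bounded_linear.has_derivative[OF bounded_linear_divide] has_derivative_add has_derivative_mult_right d)
  have 2: "(dz f has_derivative (\<lambda>w. (frechet_derivative (?D 1) (at x) w - \<i> * frechet_derivative (?D \<i>) (at x) w) / 2)) (at x)"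
    unfolding dz_def[abs_def] by (intro bounded_linear.has_derivative[OF bounded_linear_divide] has_derivative_diff has_derivative_mult_right d)
  show ?thesis
    unfolding dz_eqI[OF 1] dzb_eqI[OF 2]
    using frechet_derivative_commute[OF U sm, of 1 \<i>] by (simp add: field_simps)
qed

section \<open>Integrals of derivatives of compactly supported functions\<close>

lemma set_integral_support:
  assumes "K \<subseteq> N" "\<And>x. x \<in> N - K \<Longrightarrow> F x = 0"
  shows "(LINT x:N|M. F x) = (LINT x:K|M. F x)"
proof -
  have "(\<lambda>x. indicat_real N x *\<^sub>R F x) = (\<lambda>x. indicat_real K x *\<^sub>R F x)"
    using assms by (intro ext) (auto simp: indicator_def)
  then show ?thesis by (simp add: set_lebesgue_integral_def)
qed

lemma set_integrable_support:
  fixes F :: "'a::euclidean_space \<Rightarrow> 'b::{banach, second_countable_topology}"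
  assumes "compact K" "K \<subseteq> N" "continuous_on N F" "\<And>x. x \<in> N - K \<Longrightarrow> F x = 0"
  shows "set_integrable lborel N F"
proof -
  have "(\<lambda>x. indicat_real N x *\<^sub>R F x) = (\<lambda>x. indicat_real K x *\<^sub>R F x)"
    using assms(2,4) by (intro ext) (auto simp: indicator_def)
  moreover have "integrable lborel (\<lambda>x. indicat_real K x *\<^sub>R F x)"
    using borel_integrable_compact[OF assms(1) continuous_on_subset[OF assms(3,2)]]
    by (simp add: indicator_scaleR_eq_if)
  ultimately show ?thesis by (simp add: set_integrable_def)
qed

lemma continuous_bounded_support_integrable:
  fixes F :: "'a::euclidean_space \<Rightarrow> 'b::{banach, second_countable_topology}"
  assumes "compact K" "continuous_on UNIV F" "\<And>x. x \<notin> K \<Longrightarrow> F x = 0"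
  shows "integrable lborel F"
  using set_integrable_support[OF assms(1) _ assms(2)] assms(3) by (simp add: set_integrable_def)

text \<open>By translation invariance every difference quotient has integral zero; dominated
  convergence passes to the derivative.\<close>

lemma integral_frechet_derivative_UNIV:
  fixes f :: "'a::euclidean_space \<Rightarrow> 'b::euclidean_space"
  assumes f: "Ck_on 1 UNIV f" and K: "compact K" and f0: "\<And>x. x \<notin> K \<Longrightarrow> f x = 0"
  shows "(LINT x|lborel. frechet_derivative f (at x) v) = 0"
proof -
  let ?D = "\<lambda>x. frechet_derivative f (at x) v"
  have C: "Ck_on (Suc 0) UNIV f" using f by simp
  have df: "(f has_derivative frechet_derivative f (at x)) (at x)" for x using Ck_on_SucD(1)[OF C] by simp
  have cD: "continuous_on UNIV ?D" using Ck_on_SucD(2)[OF C] by simp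
  have cf: "continuous_on UNIV f" using Ck_on_lower[OF C] by simp
  have D0: "?D x = 0" if "x \<notin> K" for x
  proof -
    have "((\<lambda>x. 0) has_derivative (\<lambda>v. 0)) (at x)" by simp
    then have "(f has_derivative (\<lambda>v. 0)) (at x)"
      by (rule has_derivative_cong_open[of "- K", rotated -1]) (use that f0 compact_imp_closed[OF K] in auto)
    then show ?thesis by (metis frechet_derivative_at)
  qed
  obtain B where B: "\<And>x. norm (?D x) \<le> B"
  proof -
    have "compact (?D ` K)" by (rule compact_continuous_image[OF continuous_on_subset[OF cD] K]) simp
    then have "bounded (?D ` K)" by (rule compact_imp_bounded)
    then obtain B where "\<And>x. x \<in> K \<Longrightarrow> norm (?D x) \<le> B" unfolding bounded_iff by blast
    then have "norm (?D x) \<le> max B 0" for x by (cases "x \<in> K") (use D0[of x] in \<open>simp_all add: max.coboundedI1\<close>)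
    then show thesis using that by blast
  qed
  obtain R where R: "\<And>x. x \<in> K \<Longrightarrow> norm x \<le> R" using compact_imp_bounded[OF K] unfolding bounded_iff by blast
  \<comment> \<open>The dominating function: \<open>B\<close> bounds the derivative, hence the
    quotients, and since each shift has length at most \<open>norm v\<close> the quotients vanish
    beyond radius \<open>R + norm v\<close>.\<close>
  let ?w = "\<lambda>x. indicat_real (cball 0 (R + norm v)) x *\<^sub>R B"
  let ?s = "\<lambda>n x. real (Suc n) *\<^sub>R (f (x + inverse (real (Suc n)) *\<^sub>R v) - f x)"
  have along: "((\<lambda>t. f (x + t *\<^sub>R v)) has_vector_derivative ?D (x + t *\<^sub>R v)) (at t)" for x t
  proof -
    have 1: "((\<lambda>t. x + t *\<^sub>R v) has_derivative (\<lambda>t. t *\<^sub>R v)) (at t)"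
      by (auto intro!: derivative_eq_intros)
    have "((\<lambda>t. f (x + t *\<^sub>R v)) has_derivative (\<lambda>r. frechet_derivative f (at (x + t *\<^sub>R v)) (r *\<^sub>R v))) (at t)"
      using diff_chain_at[OF 1 df] by (simp add: o_def)
    then show ?thesis
      unfolding has_vector_derivative_def
      by (rule has_derivative_eq_rhs) (rule ext, rule linear_cmul[OF has_derivative_linear[OF df]])
  qed
  have bnd: "norm (?s n x) \<le> norm (?w x)" for n x
  proof -
    have inv: "0 \<le> inverse (real (Suc n))" "inverse (real (Suc n)) \<le> 1" by (auto simp: field_simps)
    have "norm (f (x + inverse (real (Suc n)) *\<^sub>R v) - f (x + 0 *\<^sub>R v)) \<le> B * norm (inverse (real (Suc n)) - 0)"
    proof (rule differentiable_bound[of "{0..inverse (real (Suc n))}" _ "\<lambda>t r. r *\<^sub>R ?D (x + t *\<^sub>R v)"])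
      fix t
      show "((\<lambda>t. f (x + t *\<^sub>R v)) has_derivative (\<lambda>r. r *\<^sub>R ?D (x + t *\<^sub>R v))) (at t within {0..inverse (real (Suc n))})"
        using along[of x t] has_derivative_at_withinI unfolding has_vector_derivative_def by blast
      show "onorm (\<lambda>r. r *\<^sub>R ?D (x + t *\<^sub>R v)) \<le> B"
        by (rule onorm_le) (use B in \<open>simp add: mult.commute[of B] mult_left_mono\<close>)
    qed (use inv in auto)
    then have "norm (f (x + inverse (real (Suc n)) *\<^sub>R v) - f x) \<le> B / real (Suc n)"
      using inv by (simp add: divide_inverse del: of_nat_Suc)
    then have "real (Suc n) * norm (f (x + inverse (real (Suc n)) *\<^sub>R v) - f x) \<le> B"
      by (simp add: pos_le_divide_eq mult.commute del: of_nat_Suc)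
    then have 1: "norm (?s n x) \<le> B"
      by (simp del: of_nat_Suc)
    show ?thesis
    proof (cases "x \<in> cball 0 (R + norm v)")
      case True
      then show ?thesis using 1 by (simp add: abs_of_nonneg[OF order_trans[OF norm_ge_zero 1]])
    next
      case False
      then have "norm x > R + norm v" by simp
      moreover have "norm x \<le> norm (x + inverse (real (Suc n)) *\<^sub>R v) + norm (inverse (real (Suc n)) *\<^sub>R v)"
        using norm_triangle_ineq4[of "x + inverse (real (Suc n)) *\<^sub>R v" "inverse (real (Suc n)) *\<^sub>R v"] by simp
      moreover have "norm (inverse (real (Suc n)) *\<^sub>R v) \<le> norm v"
        using inv by (simp add: mult_left_le_one_le)
      ultimately have "norm (x + inverse (real (Suc n)) *\<^sub>R v) > R" "norm x > R" by (smt (verit) norm_ge_zero)+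
      then have "f (x + inverse (real (Suc n)) *\<^sub>R v) = 0" "f x = 0" using f0 R by (metis not_le)+
      then show ?thesis by simp
    qed
  qed
  have int_f: "integrable lborel f" by (rule continuous_bounded_support_integrable[OF K cf f0])
  have int_shift: "integrable lborel (\<lambda>x. f (x + t))" "(LINT x|lborel. f (x + t)) = (LINT x|lborel. f x)" for t
  proof -
    show "integrable lborel (\<lambda>x. f (x + t))"
      by (rule continuous_bounded_support_integrable[of "(\<lambda>x. x - t) ` K"])
        (use K f0 in \<open>auto intro!: compact_translation_subtract continuous_on_compose2[OF cf] continuous_intros
           simp: image_iff algebra_simps\<close>)
    have "f \<in> borel_measurable borel" using cf by (rule borel_measurable_continuous_onI)
    then show "(LINT x|lborel. f (x + t)) = (LINT x|lborel. f x)"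
      using lborel_distr_plus[of t] integral_distr[of "(+) t" lborel borel f] by (simp add: add.commute)
  qed
  have "(\<lambda>n. LINT x|lborel. ?s n x) \<longlonglongrightarrow> (LINT x|lborel. ?D x)"
  proof (rule integral_dominated_convergence[where w = "\<lambda>x. norm (?w x)"])
    show "?D \<in> borel_measurable lborel" using cD by (simp add: borel_measurable_continuous_onI)
    show "?s n \<in> borel_measurable lborel" for n
    proof -
      have "continuous_on UNIV (?s n)" by (intro continuous_intros continuous_on_compose2[OF cf] subset_UNIV)
      then show ?thesis by (simp add: borel_measurable_continuous_onI)
    qed
    show "integrable lborel (\<lambda>x. norm (?w x))"
      by (intro integrable_norm integrable_scaleR_left integrable_real_indicator) (auto simp: emeasure_lborel_cball_finite[unfolded infinity_ennreal_def])
    show "AE x in lborel. (\<lambda>n. ?s n x) \<longlonglongrightarrow> ?D x"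
    proof (rule AE_I2)
      fix x
      have "((\<lambda>h. (f (x + (0 + h) *\<^sub>R v) - f (x + 0 *\<^sub>R v)) /\<^sub>R h) \<longlongrightarrow> ?D (x + 0 *\<^sub>R v)) (at 0)"
      proof (rule LIM_zero_cancel, rule tendsto_norm_zero_cancel, rule Lim_transform_eventually)
        show "((\<lambda>h. norm (f (x + (0 + h) *\<^sub>R v) - f (x + 0 *\<^sub>R v) - h *\<^sub>R ?D (x + 0 *\<^sub>R v)) / norm h) \<longlongrightarrow> 0) (at 0)"
          using along[of x 0] unfolding has_vector_derivative_def has_derivative_at by blast
        show "\<forall>\<^sub>F h in at 0. norm (f (x + (0 + h) *\<^sub>R v) - f (x + 0 *\<^sub>R v) - h *\<^sub>R ?D (x + 0 *\<^sub>R v)) / norm h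
            = norm ((f (x + (0 + h) *\<^sub>R v) - f (x + 0 *\<^sub>R v)) /\<^sub>R h - ?D (x + 0 *\<^sub>R v))"
        proof (rule eventually_at_filter[THEN iffD2, OF always_eventually], intro allI impI)
          fix h :: real assume "h \<noteq> 0"
          then have "(f (x + (0 + h) *\<^sub>R v) - f (x + 0 *\<^sub>R v)) /\<^sub>R h - ?D (x + 0 *\<^sub>R v)
            = inverse h *\<^sub>R (f (x + (0 + h) *\<^sub>R v) - f (x + 0 *\<^sub>R v) - h *\<^sub>R ?D (x + 0 *\<^sub>R v))"
            by (simp add: scaleR_diff_right)
          then show "norm (f (x + (0 + h) *\<^sub>R v) - f (x + 0 *\<^sub>R v) - h *\<^sub>R ?D (x + 0 *\<^sub>R v)) / norm h
            = norm ((f (x + (0 + h) *\<^sub>R v) - f (x + 0 *\<^sub>R v)) /\<^sub>R h - ?D (x + 0 *\<^sub>R v))"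
            by (simp only: norm_scaleR) (simp add: field_simps)
        qed
      qed
      moreover have "filterlim (\<lambda>n. inverse (real (Suc n))) (at 0) sequentially"
        using LIMSEQ_inverse_real_of_nat by (auto simp: filterlim_at)
      ultimately have "(\<lambda>n. (f (x + inverse (real (Suc n)) *\<^sub>R v) - f x) /\<^sub>R inverse (real (Suc n))) \<longlonglongrightarrow> ?D x"
        by (auto dest: filterlim_compose)
      then show "(\<lambda>n. ?s n x) \<longlonglongrightarrow> ?D x" by simp
    qed
    show "AE x in lborel. norm (?s n x) \<le> norm (?w x)" for n using bnd by simp
  qed
  moreover have "(LINT x|lborel. ?s n x) = 0" for n
    using int_shift[of "inverse (real (Suc n)) *\<^sub>R v"] int_f by simp
  ultimately show ?thesis by (simp add: LIMSEQ_const_iff)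
qed

lemma smooth_on_extend_by_zero:
  assumes "open N" "compact K" "K \<subseteq> N" "smooth_on N f" "\<And>x. x \<in> N - K \<Longrightarrow> f x = 0"
  shows "smooth_on UNIV (\<lambda>x. if x \<in> N then f x else 0)"
proof -
  have "smooth_on N (\<lambda>x. if x \<in> N then f x else 0)"
    by (rule smooth_on_cong[OF assms(1,4)]) simp
  moreover have "smooth_on (- K) (\<lambda>x. if x \<in> N then f x else 0)"
    by (rule smooth_on_cong[OF _ smooth_on_const[of _ 0]]) (use assms compact_imp_closed in auto)
  ultimately have "smooth_on (N \<union> - K) (\<lambda>x. if x \<in> N then f x else 0)"
    using assms(1,2) by (intro smooth_on_Un) (auto intro: compact_imp_closed)
  moreover have "N \<union> - K = UNIV" using assms(3) by auto
  ultimately show ?thesis by simp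
qed

lemma set_integrable_Wirtinger:
  assumes N: "open N" and K: "compact K" "K \<subseteq> N" and f: "smooth_on N f" and f0: "\<And>x. x \<in> N - K \<Longrightarrow> f x = 0"
  shows "set_integrable lborel N (dz f)" "set_integrable lborel N (dzb f)"
proof -
  have "open (N - K)" using N K compact_imp_closed by (intro open_Diff) auto
  then have z: "dz f x = 0" "dzb f x = 0" if "x \<in> N - K" for x
    using dz_locally_const[of "N - K" x f 0] f0 that by auto
  show "set_integrable lborel N (dz f)"
    by (rule set_integrable_support[OF K smooth_on_imp_continuous_on[OF smooth_on_dz[OF N f]] z(1)])
  show "set_integrable lborel N (dzb f)"
    by (rule set_integrable_support[OF K smooth_on_imp_continuous_on[OF smooth_on_dzb[OF N f]] z(2)])
qed

text \<open>Extension by zero gives a smooth function on the whole plane, so no boundary term at the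
  holes of \<open>N\<close> ever arises.\<close>

lemma integral_Wirtinger_zero:
  assumes N: "open N" and K: "compact K" "K \<subseteq> N" and f: "smooth_on N f" and f0: "\<And>x. x \<in> N - K \<Longrightarrow> f x = 0"
  shows "(LINT x:N|lborel. dz f x) = 0" "(LINT x:N|lborel. dzb f x) = 0"
proof -
  let ?g = "\<lambda>x. if x \<in> N then f x else 0"
  have g: "smooth_on UNIV ?g" by (rule smooth_on_extend_by_zero[OF N K f f0])
  have g0: "?g x = 0" if "x \<notin> K" for x using f0 that by auto
  have int: "integrable lborel (\<lambda>x. frechet_derivative ?g (at x) v)" for v
  proof (rule continuous_bounded_support_integrable[OF K(1)])
    show "continuous_on UNIV (\<lambda>x. frechet_derivative ?g (at x) v)"
      by (rule smooth_on_imp_continuous_on[OF smooth_on_frechet[OF g]])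
    show "frechet_derivative ?g (at x) v = 0" if "x \<notin> K" for x
    proof -
      have "((\<lambda>x. 0) has_derivative (\<lambda>v. 0)) (at x)" by simp
      then have "(?g has_derivative (\<lambda>v. 0)) (at x)"
        by (rule has_derivative_cong_open[of "- K", rotated -1]) (use that g0 compact_imp_closed[OF K(1)] in auto)
      then show ?thesis by (metis frechet_derivative_at)
    qed
  qed
  have zero: "(LINT x|lborel. frechet_derivative ?g (at x) v) = 0" for v
    by (rule integral_frechet_derivative_UNIV[OF smooth_onD[OF g] K(1) g0])
  have off: "dz ?g x = 0" "dzb ?g x = 0" if "x \<notin> N" for x
    using dz_locally_const[of "- K" x ?g 0] that K g0 compact_imp_closed[OF K(1)] by auto
  have on: "dz ?g x = dz f x" "dzb ?g x = dzb f x" if "x \<in> N" for x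
    using dz_cong[OF N that, of f ?g] smooth_on_imp_differentiable[OF f that] by auto
  have "(LINT x:N|lborel. dz f x) = (LINT x|lborel. dz ?g x)"
    unfolding set_lebesgue_integral_def
    by (rule Bochner_Integration.integral_cong[OF refl]) (use off on in \<open>auto simp: indicator_def\<close>)
  also have "\<dots> = 0" unfolding dz_def using int zero by simp
  finally show "(LINT x:N|lborel. dz f x) = 0" .
  have "(LINT x:N|lborel. dzb f x) = (LINT x|lborel. dzb ?g x)"
    unfolding set_lebesgue_integral_def
    by (rule Bochner_Integration.integral_cong[OF refl]) (use off on in \<open>auto simp: indicator_def\<close>)
  also have "\<dots> = 0" unfolding dzb_def using int zero by simp
  finally show "(LINT x:N|lborel. dzb f x) = 0" .
qed

section \<open>A cutoff form of the residue theorem\<close>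

text \<open>The transition zone of \<open>cut p r\<close>, outside which the cutoff is locally
  constant.\<close>

definition annulus :: "complex \<Rightarrow> real \<Rightarrow> complex set" where
  "annulus p r = cball p (3/4 * r) - ball p (r / 2)"

lemma compact_annulus: "compact (annulus p r)"
  unfolding annulus_def by (intro compact_diff compact_cball open_ball)

lemma has_real_derivative_profile: "(profile has_real_derivative deriv profile s) (at s)"
proof -
  have "profile differentiable (at s)"
    using smooth_on_imp_differentiable[OF smooth_on_profile] by simp
  then show ?thesis
    using DERIV_deriv_iff_real_differentiable by blast
qed

lemma continuous_on_deriv_profile: "continuous_on UNIV (deriv profile)"
proof -
  have "deriv profile s = frechet_derivative profile (at s) 1" for s
  proof -
    have "frechet_derivative profile (at s) = (*) (deriv profile s)"
      using frechet_derivative_at[OF has_field_derivative_imp_has_derivative[OF has_real_derivative_profile]] by simp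
    then show ?thesis by simp
  qed
  then show ?thesis
    using smooth_on_imp_continuous_on[OF smooth_on_frechet[OF smooth_on_profile, of 1]] by simp
qed

text \<open>Chain rule: \<open>(x - p) * cnj (x - p)\<close> has derivative \<open>x - p\<close>
  with respect to \<open>cnj x\<close>. This factor later cancels the pole at
  \<open>p\<close>.\<close>

lemma dzb_cut:
  assumes "r > 0"
  shows "dzb (cut p r) x = of_real (deriv profile ((norm (x - p) / r)\<^sup>2)) * (x - p) / of_real (r\<^sup>2)"
proof -
  let ?P = "deriv profile ((norm (x - p) / r)\<^sup>2)"
  have n: "(norm (y - p) / r)\<^sup>2 = inner (y - p) (y - p) / r\<^sup>2" for y
    by (simp add: power_divide dot_square_norm)
  have "((\<lambda>y. inner (y - p) (y - p) / r\<^sup>2) has_derivative (\<lambda>v. (inner (x - p) v + inner v (x - p)) / r\<^sup>2)) (at x)"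
    by (intro bounded_linear.has_derivative[OF bounded_linear_divide]) (auto intro!: derivative_eq_intros)
  then have d: "((\<lambda>y. (norm (y - p) / r)\<^sup>2) has_derivative (\<lambda>v. 2 * inner (x - p) v / r\<^sup>2)) (at x)"
    unfolding n by (simp add: inner_commute)
  have "((\<lambda>y. profile ((norm (y - p) / r)\<^sup>2)) has_derivative (\<lambda>v. ?P * (2 * inner (x - p) v / r\<^sup>2))) (at x)"
    using diff_chain_at[OF d has_field_derivative_imp_has_derivative[OF has_real_derivative_profile]]
    by (simp add: o_def)
  then have "(cut p r has_derivative (\<lambda>v. of_real (?P * (2 * inner (x - p) v / r\<^sup>2)))) (at x)"
    unfolding cut_def[abs_def] by (rule bounded_linear.has_derivative[OF bounded_linear_of_real])
  from dzb_eqI[OF this] have "dzb (cut p r) x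
      = (of_real (?P * (2 * Re (x - p) / r\<^sup>2)) + \<i> * of_real (?P * (2 * Im (x - p) / r\<^sup>2))) / 2"
    by (simp add: inner_complex_def)
  also have "\<dots> = of_real ?P * (x - p) / of_real (r\<^sup>2)"
    using assms unfolding complex_eq_iff
    by (simp add: Re_divide_of_real Im_divide_of_real field_simps del: of_real_power)
  finally show ?thesis .
qed

text \<open>The area of a disc is linear in its squared radius, so the squared radius pushes
  Lebesgue measure on the plane forward to a constant multiple of Lebesgue measure on the
  half-line.\<close>

lemma integral_radial:
  fixes p :: complex
  assumes r: "r > 0" and g: "continuous_on UNIV g" and g0: "\<And>s. s \<ge> 1 \<Longrightarrow> g s = 0"
  shows "(LINT x|lborel. g ((norm (x - p) / r)\<^sup>2)) = pi * r\<^sup>2 * (LINT s:{0..1}|lborel. g s)"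
proof -
  \<comment> \<open>With the minus sign the preimages of the rays \<open>{a<..}\<close> are discs of
    finite area, so the two measures can be compared on these rays.\<close>
  let ?m = "\<lambda>x::complex. - ((norm (x - p) / r)\<^sup>2)"
  have m: "?m \<in> borel_measurable borel"
    by (intro borel_measurable_continuous_onI continuous_intros) (use r in auto)
  let ?N = "density lborel (\<lambda>s. ennreal (pi * r\<^sup>2 * indicat_real {..0} s))"
  have pre: "?m -` {a<..} = (if a < 0 then ball p (r * sqrt (- a)) else {})" for a
  proof -
    have "(norm (x - p) / r)\<^sup>2 < - a \<longleftrightarrow> a < 0 \<and> norm (x - p) < r * sqrt (- a)" for x
    proof (cases "a < 0")
      case True
      then have "(norm (x - p) / r)\<^sup>2 < - a \<longleftrightarrow> sqrt ((norm (x - p) / r)\<^sup>2) < sqrt (- a)"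
        by (simp only: real_sqrt_less_iff)
      then show ?thesis using True r by (simp add: pos_divide_less_eq mult.commute)
    next
      case False
      then show ?thesis by (smt (verit) zero_le_power2)
    qed
    moreover have "?m x > a \<longleftrightarrow> (norm (x - p) / r)\<^sup>2 < - a" for x by linarith
    ultimately show ?thesis
      by (auto simp: dist_norm norm_minus_commute)
  qed
  have em1: "emeasure (distr lborel borel ?m) {a<..} = ennreal (pi * r\<^sup>2 * max 0 (- a))" for a
  proof -
    have "emeasure (distr lborel borel ?m) {a<..} = emeasure lborel (?m -` {a<..})"
      using m by (subst emeasure_distr) (auto simp: space_borel)
    also have "\<dots> = ennreal (pi * r\<^sup>2 * max 0 (- a))"
      unfolding pre using r by (auto simp: emeasure_ball unit_ball_vol_2 power_mult_distrib max_def mult.assoc)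
    finally show ?thesis .
  qed
  have em2: "emeasure ?N {a<..} = ennreal (pi * r\<^sup>2 * max 0 (- a))" for a
  proof -
    have "emeasure ?N {a<..} = (\<integral>\<^sup>+ s. ennreal (pi * r\<^sup>2 * indicat_real {..0} s) * indicator {a<..} s \<partial>lborel)"
      by (subst emeasure_density) auto
    also have "\<dots> = (\<integral>\<^sup>+ s. ennreal (pi * r\<^sup>2) * indicator {a<..0} s \<partial>lborel)"
      by (intro nn_integral_cong) (auto simp: indicator_def)
    also have "\<dots> = ennreal (pi * r\<^sup>2) * emeasure lborel {a<..0}"
      by (subst nn_integral_cmult_indicator) auto
    also have "emeasure lborel {a<..0} = ennreal (max 0 (- a))"
      by (cases "a \<le> 0") (auto simp: max_def)
    finally show ?thesis by (simp add: ennreal_mult)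
  qed
  have eq: "distr lborel borel ?m = ?N"
    by (rule measure_eqI_lessThan) (auto simp: em1 em2)
  have gm: "(\<lambda>s. g (- s)) \<in> borel_measurable borel"
    by (intro borel_measurable_continuous_onI continuous_on_compose2[OF g] continuous_intros) auto
  have "(LINT x|lborel. g ((norm (x - p) / r)\<^sup>2)) = (LINT x|lborel. (\<lambda>s. g (- s)) (?m x))" by simp
  also have "\<dots> = (LINT s|?N. g (- s))"
    by (subst eq[symmetric], subst integral_distr) (use m gm in auto)
  also have "\<dots> = (LINT s|lborel. (pi * r\<^sup>2 * indicat_real {..0} s) *\<^sub>R g (- s))"
    by (subst integral_density) (use gm r in \<open>auto intro!: AE_I2\<close>)
  also have "\<dots> = (LINT s|lborel. (pi * r\<^sup>2 * indicat_real {..0} (- s)) *\<^sub>R g s)"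
    by (subst lborel_integral_real_affine[where c = "-1" and t = 0]) auto
  also have "\<dots> = (LINT s|lborel. (pi * r\<^sup>2) *\<^sub>R (indicat_real {0..1} s *\<^sub>R g s))"
    by (intro Bochner_Integration.integral_cong refl) (use g0 in \<open>auto simp: indicator_def\<close>)
  also have "\<dots> = pi * r\<^sup>2 * (LINT s:{0..1}|lborel. g s)"
    unfolding set_lebesgue_integral_def by simp
  finally show ?thesis .
qed

lemma deriv_profile_eq_0:
  assumes "s \<ge> 1" shows "deriv profile s = 0"
proof -
  have "((\<lambda>s. 0) has_real_derivative 0) (at s)" by simp
  then have "(profile has_real_derivative 0) (at s)"
    by (rule has_field_derivative_transform_within_open[of _ _ _ "{1/2<..}"]) (use assms in \<open>auto simp: profile_eq_0\<close>)
  then show ?thesis by (rule DERIV_imp_deriv)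
qed

text \<open>Once \<open>x - p\<close> is cancelled the integrand is radial, and what remains is the
  integral of \<open>deriv profile\<close>, namely \<open>profile 1 - profile 0 = -1\<close>. The
  constant takes the place of the contour integral of \<open>1 / (x - p)\<close>.\<close>

lemma integral_dzb_cut:
  assumes r: "r > 0"
  shows "(LINT x|lborel. dzb (cut p r) x / (x - p)) = - of_real pi"
proof -
  have ftc: "(LINT s:{0..1}|lborel. deriv profile s) = profile 1 - profile 0"
    unfolding set_lebesgue_integral_def real_scaleR_def mult.commute[of "indicat_real _ _"]
    by (rule integral_FTC_Icc_real) (use continuous_on_deriv_profile in
        \<open>auto intro: has_real_derivative_profile simp: continuous_on_eq_continuous_at\<close>)
  have "(LINT x|lborel. dzb (cut p r) x / (x - p))
      = (LINT x|lborel. of_real (deriv profile ((norm (x - p) / r)\<^sup>2) / r\<^sup>2))"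
  proof (rule integral_cong_AE)
    show "(\<lambda>x. dzb (cut p r) x / (x - p)) \<in> borel_measurable lborel"
      using borel_measurable_continuous_onI[OF smooth_on_imp_continuous_on[OF smooth_on_dzb[OF open_UNIV smooth_on_cut[OF open_UNIV]]]]
      by auto
    show "(\<lambda>x. complex_of_real (deriv profile ((norm (x - p) / r)\<^sup>2) / r\<^sup>2)) \<in> borel_measurable lborel"
      using r by (auto intro!: borel_measurable_continuous_onI continuous_intros continuous_on_compose2[OF continuous_on_deriv_profile])
    \<comment> \<open>At \<open>p\<close> itself the cancellation is invalid, since the quotient is
      0 by convention; one point is a null set.\<close>
    have "AE x in lborel. x \<noteq> p" by (rule AE_lborel_singleton)
    then show "AE x in lborel. dzb (cut p r) x / (x - p) = of_real (deriv profile ((norm (x - p) / r)\<^sup>2) / r\<^sup>2)"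
      by eventually_elim (simp add: dzb_cut[OF r])
  qed
  also have "\<dots> = of_real ((LINT x|lborel. deriv profile ((norm (x - p) / r)\<^sup>2)) / r\<^sup>2)"
    by simp
  also have "(LINT x|lborel. deriv profile ((norm (x - p) / r)\<^sup>2)) / r\<^sup>2 = - pi"
    using r by (simp add: integral_radial[OF r continuous_on_deriv_profile deriv_profile_eq_0] ftc profile_eq_0 profile_eq_1)
  finally show ?thesis by simp
qed

lemma dz_cut_eq_0:
  assumes "r > 0" "x \<notin> annulus p r"
  shows "dz (cut p r) x = 0" "dzb (cut p r) x = 0"
proof -
  have "x \<in> ball p (r / 2) \<or> x \<in> - cball p (3/4 * r)"
    using assms(2) by (auto simp: annulus_def)
  then have "dz (cut p r) x = 0 \<and> dzb (cut p r) x = 0"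
  proof
    assume x: "x \<in> ball p (r / 2)"
    have "cut p r y = 1" if "y \<in> ball p (r / 2)" for y
      using that by (intro cut_eq_1[OF assms(1)]) (auto simp: dist_norm norm_minus_commute)
    then show ?thesis using dz_locally_const[OF open_ball x] by blast
  next
    assume x: "x \<in> - cball p (3/4 * r)"
    have "cut p r y = 0" if "y \<in> - cball p (3/4 * r)" for y
      using that by (intro cut_eq_0[OF assms(1)]) (auto simp: dist_norm norm_minus_commute)
    then show ?thesis using dz_locally_const[of "- cball p (3/4 * r)" x] x by (metis closed_cball open_Compl)
  qed
  then show "dz (cut p r) x = 0" "dzb (cut p r) x = 0" by auto
qed

text \<open>The part with \<open>deriv P\<close> integrates to zero: it is
  \<open>dz (dzb \<chi> * P) - dzb (dz \<chi> * P)\<close>, where the second derivatives of the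
  cutoff \<open>\<chi>\<close> cancel. As \<open>P\<close> lives only on a neighbourhood of the
  annulus, it may be singular at \<open>p\<close>, which admits higher poles in
  \<open>w\<close>.\<close>

lemma integral_dzb_cut_residue:
  assumes r: "r > 0" and N: "open N" "annulus p r \<subseteq> N" and P: "P holomorphic_on N"
    and w: "\<And>x. x \<in> annulus p r \<Longrightarrow> w x = c / (x - p) + deriv P x"
  shows "(LINT x:annulus p r|lborel. dzb (cut p r) x * w x) = - of_real pi * c"
proof -
  let ?K = "annulus p r" and ?\<chi> = "cut p r"
  have sc: "smooth_on N ?\<chi>" and sP: "smooth_on N P"
    using smooth_on_cut smooth_on_holomorphic N P by blast+
  have pK: "p \<notin> ?K" using r by (auto simp: annulus_def)
  have cK: "continuous_on ?K (dzb ?\<chi>)"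
    by (rule continuous_on_subset[OF smooth_on_imp_continuous_on[OF smooth_on_dzb[OF N(1) sc]] N(2)])
  have cP: "continuous_on ?K (deriv P)"
    by (rule continuous_on_subset[OF holomorphic_on_imp_continuous_on[OF holomorphic_deriv[OF P N(1)]] N(2)])
  have "(LINT x:?K|lborel. dzb ?\<chi> x * w x) = (LINT x:?K|lborel. dzb ?\<chi> x * (c / (x - p)) + dzb ?\<chi> x * deriv P x)"
    unfolding set_lebesgue_integral_def
    by (intro Bochner_Integration.integral_cong refl) (auto simp: indicator_def w distrib_left)
  also have "\<dots> = (LINT x:?K|lborel. dzb ?\<chi> x * (c / (x - p))) + (LINT x:?K|lborel. dzb ?\<chi> x * deriv P x)"
    by (rule set_integral_add; rule set_integrable_support[of ?K])
      (use compact_annulus cK cP pK in \<open>auto intro!: continuous_intros\<close>)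
  also have "(LINT x:?K|lborel. dzb ?\<chi> x * (c / (x - p))) = (LINT x:UNIV|lborel. dzb ?\<chi> x * (c / (x - p)))"
    by (rule set_integral_support[symmetric]) (auto simp: dz_cut_eq_0[OF r])
  also have "\<dots> = (LINT x|lborel. c * (dzb ?\<chi> x / (x - p)))"
    by (simp add: set_lebesgue_integral_def mult.commute)
  also have "\<dots> = - of_real pi * c"
    using integral_dzb_cut[OF r, of p] by (simp del: times_divide_eq_right)
  also have "(LINT x:?K|lborel. dzb ?\<chi> x * deriv P x) = (LINT x:N|lborel. dzb ?\<chi> x * deriv P x)"
    by (rule set_integral_support[symmetric]) (use N in \<open>auto simp: dz_cut_eq_0[OF r]\<close>)
  also have "\<dots> = (LINT x:N|lborel. dz (\<lambda>x. dzb ?\<chi> x * P x) x - dzb (\<lambda>x. dz ?\<chi> x * P x) x)"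
    unfolding set_lebesgue_integral_def
  proof (intro Bochner_Integration.integral_cong refl)
    fix x
    have "dzb ?\<chi> x * deriv P x = dz (\<lambda>x. dzb ?\<chi> x * P x) x - dzb (\<lambda>x. dz ?\<chi> x * P x) x" if x: "x \<in> N"
    proof -
      have d: "dz ?\<chi> differentiable (at x)" "dzb ?\<chi> differentiable (at x)" "P differentiable (at x)"
        using smooth_on_imp_differentiable[OF _ x] smooth_on_dz[OF N(1) sc] smooth_on_dzb[OF N(1) sc] sP by auto
      have dP: "dz P x = deriv P x" "dzb P x = 0"
        using dz_field_derivative[OF holomorphic_derivI[OF P N(1) x]] by auto
      show ?thesis
        by (simp add: dz_mult d dP dz_dzb_commute[OF N(1) x sc])
    qed
    then show "indicat_real N x *\<^sub>R (dzb ?\<chi> x * deriv P x)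
        = indicat_real N x *\<^sub>R (dz (\<lambda>x. dzb ?\<chi> x * P x) x - dzb (\<lambda>x. dz ?\<chi> x * P x) x)"
      by (auto simp: indicator_def)
  qed
  also have "\<dots> = 0"
  proof -
    have s: "smooth_on N (\<lambda>x. dzb ?\<chi> x * P x)" "smooth_on N (\<lambda>x. dz ?\<chi> x * P x)"
      by (intro smooth_on_mult N smooth_on_dz smooth_on_dzb sc sP)+
    have z: "dzb ?\<chi> x * P x = 0" "dz ?\<chi> x * P x = 0" if "x \<in> N - ?K" for x
      using that by (auto simp: dz_cut_eq_0[OF r])
    have i1: "(LINT x:N|lborel. dz (\<lambda>x. dzb ?\<chi> x * P x) x) = 0"
      by (rule integral_Wirtinger_zero(1)[OF N(1) compact_annulus N(2) s(1) z(1)])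
    have i2: "(LINT x:N|lborel. dzb (\<lambda>x. dz ?\<chi> x * P x) x) = 0"
      by (rule integral_Wirtinger_zero(2)[OF N(1) compact_annulus N(2) s(2) z(2)])
    show ?thesis
      using set_integral_diff(2)[OF set_integrable_Wirtinger(1)[OF N(1) compact_annulus N(2) s(1) z(1)]
            set_integrable_Wirtinger(2)[OF N(1) compact_annulus N(2) s(2) z(2)]]
      unfolding i1 i2 diff_self .
  qed
  finally show ?thesis by simp
qed

section \<open>The local twisted equation\<close>

text \<open>An integrating factor: the exponential of a primitive, which exists because the disc is
  convex.\<close>

lemma exp_primitive:
  assumes "B holomorphic_on ball 0 r"
  obtains E where "E holomorphic_on ball 0 r" "\<And>t. E t \<noteq> 0"
    "\<And>t. t \<in> ball 0 r \<Longrightarrow> (E has_field_derivative B t * E t) (at t)"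
proof -
  obtain b where b: "\<And>t. t \<in> ball 0 r \<Longrightarrow> (b has_field_derivative B t) (at t within ball 0 r)"
    using holomorphic_convex_primitive'[OF convex_ball open_ball assms] by blast
  have d: "((\<lambda>t. exp (b t)) has_field_derivative B t * exp (b t)) (at t)" if "t \<in> ball 0 r" for t
  proof -
    have "(b has_field_derivative B t) (at t)" using b[OF that] at_within_open[OF that open_ball] by simp
    then show ?thesis by (auto intro!: derivative_eq_intros)
  qed
  show thesis
    by (rule that[of "\<lambda>t. exp (b t)"]) (use d in \<open>auto simp: holomorphic_on_open intro!: exI\<close>)
qed

text \<open>With \<open>E' = B E\<close> the substitution \<open>V = E U\<close> removes \<open>B\<close>; then \<open>l V + t V' = E G\<close> is solved
  by dividing the \<open>n\<close>-th Taylor coefficient by \<open>l + n\<close>.\<close>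

lemma local_solution_exists:
  fixes l :: complex
  assumes B: "B holomorphic_on ball 0 r" and G: "G holomorphic_on ball 0 r"
    and nz: "\<And>n::nat. l + of_nat n \<noteq> 0"
  obtains U where "U holomorphic_on ball 0 r"
    "\<And>t. t \<in> ball 0 r \<Longrightarrow> l * U t + t * deriv U t + t * B t * U t = G t"
proof -
  obtain E where E: "E holomorphic_on ball 0 r" "\<And>t. E t \<noteq> 0"
    "\<And>t. t \<in> ball 0 r \<Longrightarrow> (E has_field_derivative B t * E t) (at t)"
    using exp_primitive[OF B] by blast
  define M where "M = (\<lambda>t. E t * G t)"
  have M: "M holomorphic_on ball 0 r" unfolding M_def by (intro holomorphic_intros E G)
  define m where "m = (\<lambda>n. (deriv ^^ n) M 0 / fact n)"
  have ms: "(\<lambda>n. m n * t ^ n) sums M t" if "t \<in> ball 0 r" for t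
    using holomorphic_power_series[OF M that] by (simp add: m_def)
  define v where "v = (\<lambda>n. m n / (l + of_nat n))"
  \<comment> \<open>The inverses of the divisors are bounded, so the division does not shrink the
    disc of convergence.\<close>
  have "(\<lambda>n. inverse (l + of_nat n)) \<longlonglongrightarrow> 0"
    by (rule filterlim_compose[OF tendsto_inverse_0 tendsto_add_filterlim_at_infinity[OF tendsto_const tendsto_of_nat]])
  then have "Bseq (\<lambda>n. inverse (l + of_nat n))" by (intro convergent_imp_Bseq) (auto simp: convergent_def)
  then obtain C where C: "C > 0" "\<And>n. norm (inverse (l + of_nat n)) \<le> C" by (auto elim: BseqE)
  have vs: "summable (\<lambda>n. v n * of_real k ^ n)" if k: "0 \<le> k" "k < r" for k
  proof -
    obtain k' where k': "k < k'" "k' < r" using dense[OF k(2)] by blast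
    have "summable (\<lambda>n. m n * of_real k' ^ n)" using ms[of "of_real k'"] k k' by (auto simp: sums_iff)
    then have "summable (\<lambda>n. norm (m n * of_real k ^ n))"
      by (rule powser_insidea) (use k k' in auto)
    then have "summable (\<lambda>n. C * norm (m n * of_real k ^ n))" by (rule summable_mult)
    then show ?thesis
    proof (rule summable_comparison_test')
      fix n
      have "norm (v n * of_real k ^ n) = norm (inverse (l + of_nat n)) * norm (m n * of_real k ^ n)"
        by (simp add: v_def norm_divide norm_mult norm_inverse divide_inverse)
      also have "\<dots> \<le> C * norm (m n * of_real k ^ n)" using C(2)[of n] by (intro mult_right_mono) auto
      finally show "norm (v n * of_real k ^ n) \<le> C * norm (m n * of_real k ^ n)" .
    qed
  qed
  define V where "V = (\<lambda>t. \<Sum>n. v n * t ^ n)"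
  define V' where "V' = (\<lambda>t. \<Sum>n. diffs v n * t ^ n)"
  have V: "(V has_field_derivative V' t) (at t)" "l * V t + t * V' t = M t" if t: "t \<in> ball 0 r" for t
  proof -
    obtain k where k: "norm t < k" "k < r" using dense[of "norm t" r] t by auto
    then have k0: "0 \<le> k" using norm_ge_zero[of t] by linarith
    have sk: "summable (\<lambda>n. v n * of_real k ^ n)" by (rule vs[OF k0 k(2)])
    have nk: "norm t < norm (complex_of_real k)" using k k0 by simp
    show "(V has_field_derivative V' t) (at t)"
      unfolding V_def V'_def by (rule termdiffs_strong[OF sk nk])
    have s1: "(\<lambda>n. v n * t ^ n) sums V t"
      unfolding V_def using powser_inside[OF sk nk] by (rule summable_sums)
    have "summable (\<lambda>n. diffs v n * t ^ n)"
    proof (rule termdiff_converges[of _ k])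
      show "norm t < k" by (rule k)
      fix x :: complex assume "norm x < k"
      then show "summable (\<lambda>n. v n * x ^ n)" by (intro powser_inside[OF sk]) (use k0 in simp)
    qed
    then have s2: "(\<lambda>n. of_nat n * v n * t ^ (n - Suc 0)) sums V' t"
      unfolding V'_def by (rule diffs_equiv)
    have "(\<lambda>n. l * (v n * t ^ n) + t * (of_nat n * v n * t ^ (n - Suc 0))) sums (l * V t + t * V' t)"
      by (intro sums_add sums_mult s1 s2)
    moreover have "l * (v n * t ^ n) + t * (of_nat n * v n * t ^ (n - Suc 0)) = m n * t ^ n" for n
    proof -
      have "t * (of_nat n * v n * t ^ (n - Suc 0)) = of_nat n * v n * t ^ n" by (cases n) auto
      moreover have "(l + of_nat n) * v n = m n" using nz[of n] by (simp add: v_def)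
      ultimately show ?thesis by (metis distrib_right mult.assoc)
    qed
    ultimately show "l * V t + t * V' t = M t" using ms[OF t] sums_unique2 by auto
  qed
  define U where "U = (\<lambda>t. V t / E t)"
  have U: "(U has_field_derivative V' t / E t - B t * U t) (at t)" if "t \<in> ball 0 r" for t
  proof -
    have "((\<lambda>t. V t / E t) has_field_derivative (V' t * E t - V t * (B t * E t)) / (E t * E t)) (at t)"
      by (intro DERIV_divide V E that)
    moreover have "(V' t * E t - V t * (B t * E t)) / (E t * E t) = V' t / E t - B t * (V t / E t)"
      using E(2)[of t] by (simp add: field_simps)
    ultimately show ?thesis unfolding U_def by simp
  qed
  show thesis
  proof (rule that[of U])
    show "U holomorphic_on ball 0 r" unfolding holomorphic_on_open[OF open_ball] using U by blast
    fix t :: complex assume t: "t \<in> ball 0 r"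
    have "l * U t + t * deriv U t + t * B t * U t = (l * V t + t * V' t) / E t"
      unfolding DERIV_imp_deriv[OF U[OF t]] by (simp add: U_def algebra_simps add_divide_distrib)
    also have "\<dots> = G t" using V(2)[OF t] E(2)[of t] by (simp add: M_def)
    finally show "l * U t + t * deriv U t + t * B t * U t = G t" .
  qed
qed

text \<open>Comparison of the Taylor coefficients of orders 0 and 1. Since the solution on the curve
  is \<open>U / t\<close> and \<open>H\<close> has at most a simple pole, these two determine the
  residue.\<close>

lemma local_solution_values:
  assumes r: "r > 0" and U: "U holomorphic_on ball 0 r" and B: "B holomorphic_on ball 0 r"
    and eq: "\<And>t. t \<in> ball 0 r \<Longrightarrow> l * U t + t * deriv U t + t * B t * U t = G t"
  shows "l * U 0 = G 0" "(l + 1) * deriv U 0 = deriv G 0 - B 0 * U 0"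
proof -
  have 0: "0 \<in> ball (0::complex) r" using r by simp
  show "l * U 0 = G 0" using eq[OF 0] by simp
  have d: "((\<lambda>t. l * U t + t * (deriv U t + B t * U t)) has_field_derivative
      l * deriv U 0 + (1 * (deriv U 0 + B 0 * U 0) + deriv (\<lambda>t. deriv U t + B t * U t) 0 * 0)) (at 0)"
  proof (intro DERIV_add DERIV_cmult DERIV_mult DERIV_ident)
    show "(U has_field_derivative deriv U 0) (at 0)" by (rule holomorphic_derivI[OF U open_ball 0])
    have "(\<lambda>t. deriv U t + B t * U t) holomorphic_on ball 0 r"
      by (intro holomorphic_intros U B) auto
    then show "((\<lambda>t. deriv U t + B t * U t) has_field_derivative deriv (\<lambda>t. deriv U t + B t * U t) 0) (at 0)"
      by (rule holomorphic_derivI[OF _ open_ball 0])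
  qed
  have "(G has_field_derivative l * deriv U 0 + (1 * (deriv U 0 + B 0 * U 0) + deriv (\<lambda>t. deriv U t + B t * U t) 0 * 0)) (at 0)"
    by (rule has_field_derivative_transform_within_open[OF d open_ball 0]) (simp add: eq[symmetric] algebra_simps)
  then have "deriv G 0 = l * deriv U 0 + (deriv U 0 + B 0 * U 0)" using DERIV_imp_deriv by fastforce
  then show "(l + 1) * deriv U 0 = deriv G 0 - B 0 * U 0" by (simp add: algebra_simps)
qed

text \<open>Analytic continuation once around \<open>0\<close> multiplies a solution of the homogeneous equation
  by \<open>exp (- 2 \<pi> \<i> a) \<noteq> 1\<close>.\<close>

lemma homogeneous_solution_zero:
  assumes B: "B holomorphic_on ball 0 r" and a: "a \<notin> \<int>"
    and d: "\<And>t. t \<in> ball 0 r - {0} \<Longrightarrow> (\<delta> has_field_derivative - (a / t + B t) * \<delta> t) (at t)"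
    and t0: "t0 \<in> ball 0 r - {0}"
  shows "\<delta> t0 = 0"
proof -
  obtain E where E: "E holomorphic_on ball 0 r" "\<And>t. E t \<noteq> 0"
    "\<And>t. t \<in> ball 0 r \<Longrightarrow> (E has_field_derivative B t * E t) (at t)"
    using exp_primitive[OF B] by blast
  let ?w = "\<lambda>t. \<delta> t * E t"
  have w: "(?w has_field_derivative - (a / t) * ?w t) (at t)" if "t \<in> ball 0 r - {0}" for t
    by (rule DERIV_cong[OF DERIV_mult[OF d[OF that] E(3)]]) (use that in \<open>auto simp: algebra_simps\<close>)
  let ?p = "\<lambda>\<theta>::real. t0 * exp (\<i> * of_real \<theta>)"
  have p: "?p \<theta> \<in> ball 0 r - {0}" for \<theta> using t0 by (simp add: norm_mult)
  \<comment> \<open>Along the circle through \<open>t0\<close> the function \<open>w\<close> varies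
    like \<open>exp (- \<i> * a * \<theta>)\<close>; the extra factor compensates this and makes
    \<open>g\<close> constant.\<close>
  let ?g = "\<lambda>\<theta>::real. ?w (?p \<theta>) * exp (\<i> * a * of_real \<theta>)"
  have "(?g has_vector_derivative 0) (at \<theta>)" for \<theta>
  proof -
    let ?h = "\<lambda>\<theta>::complex. ?w (t0 * exp (\<i> * \<theta>)) * exp (\<i> * a * \<theta>)"
    have 1: "((\<lambda>\<theta>. t0 * exp (\<i> * \<theta>)) has_field_derivative \<i> * ?p \<theta>) (at (of_real \<theta>))"
      by (auto intro!: derivative_eq_intros)
    have 2: "((\<lambda>\<theta>. ?w (t0 * exp (\<i> * \<theta>))) has_field_derivative (- (a / ?p \<theta>) * ?w (?p \<theta>)) * (\<i> * ?p \<theta>)) (at (of_real \<theta>))"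
      by (rule DERIV_chain2[OF w[OF p] 1])
    have 3: "((\<lambda>\<theta>. exp (\<i> * a * \<theta>)) has_field_derivative \<i> * a * exp (\<i> * a * of_real \<theta>)) (at (of_real \<theta>))"
      by (auto intro!: derivative_eq_intros)
    have "(?h has_field_derivative 0) (at (of_real \<theta>))"
      by (rule DERIV_cong[OF DERIV_mult[OF 2 3]]) (use p[of \<theta>] in \<open>simp add: field_simps\<close>)
    then show ?thesis using has_vector_derivative_real_field by fastforce
  qed
  then obtain c where c: "\<And>\<theta>. ?g \<theta> = c"
    using has_vector_derivative_zero_constant[of UNIV ?g] by auto
  have "?g (2 * pi) = ?g 0" using c by metis
  moreover have "exp (\<i> * of_real (2 * pi)) = 1" using exp_two_pi_i by (simp add: mult.commute mult.left_commute)
  ultimately have "?w t0 * exp (\<i> * a * of_real (2 * pi)) = ?w t0" by simp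
  moreover have "exp (\<i> * a * of_real (2 * pi)) \<noteq> 1"
  proof
    assume "exp (\<i> * a * of_real (2 * pi)) = 1"
    then obtain n :: int where n: "Im a = 0" "Re a * (2 * pi) = of_int (2 * n) * pi"
      unfolding exp_eq_1 by auto
    then have "Re a = of_int n" by simp
    then have "a = of_int n" using n(1) by (simp add: complex_eq_iff)
    then show False using a by auto
  qed
  ultimately show ?thesis using E(2)[of t0] by simp
qed

section \<open>Splitting a function into residue term and exact part\<close>

lemma divided_difference:
  fixes f :: "complex \<Rightarrow> complex"
  assumes "f holomorphic_on ball 0 r"
  obtains g where "g holomorphic_on ball 0 r" "\<And>t. f t = f 0 + t * g t" "g 0 = deriv f 0"
proof (rule that)
  let ?g = "\<lambda>t. if t = 0 then deriv f 0 else (f t - f 0) / (t - 0)"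
  show "?g holomorphic_on ball 0 r" by (rule pole_lemma_open[OF assms open_ball])
qed auto

text \<open>Expansion to second order leaves a pure double pole and a regular remainder. Both have
  single-valued primitives on the punctured disc, and \<open>P\<close> is their sum.\<close>

lemma residue_form_double_pole:
  assumes V: "V holomorphic_on ball 0 r"
  obtains P where "P holomorphic_on ball p r - {p}"
    "\<And>x. x \<in> ball p r - {p} \<Longrightarrow> V (x - p) / (x - p)\<^sup>2 = deriv V 0 / (x - p) + deriv P x"
proof -
  obtain f where f: "f holomorphic_on ball 0 r" "\<And>t. V t = V 0 + t * f t" "f 0 = deriv V 0"
    using divided_difference[OF V] by metis
  obtain g where g: "g holomorphic_on ball 0 r" "\<And>t. f t = f 0 + t * g t"
    using divided_difference[OF f(1)] by metis
  obtain Q where Q: "\<And>t. t \<in> ball 0 r \<Longrightarrow> (Q has_field_derivative g t) (at t within ball 0 r)"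
    using holomorphic_convex_primitive'[OF convex_ball open_ball g(1)] by blast
  have D: "((\<lambda>x. Q (x - p) - V 0 / (x - p)) has_field_derivative g (x - p) + V 0 / (x - p)\<^sup>2) (at x)"
    if x: "x \<in> ball p r - {p}" for x
  proof -
    have m: "x - p \<in> ball 0 r" using x by (simp add: dist_norm norm_minus_commute)
    have "(Q has_field_derivative g (x - p)) (at (x - p))"
      using Q[OF m] at_within_open[OF m open_ball] by simp
    then have "((\<lambda>x. Q (x - p)) has_field_derivative g (x - p) * (1 - 0)) (at x)"
      by (rule DERIV_chain2) (intro DERIV_diff DERIV_ident DERIV_const)
    moreover have "((\<lambda>x. V 0 / (x - p)) has_field_derivative - (V 0 / (x - p)\<^sup>2)) (at x)"
      using x by (auto intro!: derivative_eq_intros simp: power2_eq_square field_simps)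
    ultimately show ?thesis using DERIV_diff by fastforce
  qed
  show thesis
  proof (rule that)
    show "(\<lambda>x. Q (x - p) - V 0 / (x - p)) holomorphic_on ball p r - {p}"
      unfolding holomorphic_on_open[OF open_Diff[OF open_ball closed_singleton]] using D by blast
    fix x assume x: "x \<in> ball p r - {p}"
    have "V (x - p) = V 0 + (x - p) * (deriv V 0 + (x - p) * g (x - p))" using f g(2) by metis
    then show "V (x - p) / (x - p)\<^sup>2 = deriv V 0 / (x - p) + deriv (\<lambda>x. Q (x - p) - V 0 / (x - p)) x"
      using x unfolding DERIV_imp_deriv[OF D[OF x]]
      by (cases "x - p = 0") (simp_all add: add_divide_distrib power2_eq_square distrib_left)
  qed
qed

text \<open>With \<open>s = 1 / x\<close> the remainder is \<open>s^2 * f s\<close>, and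
  \<open>s^2 dx = - ds\<close>. A primitive of \<open>f\<close> on the disc therefore yields, up to
  sign, a primitive outside a circle.\<close>

lemma residue_form_infinity:
  assumes V: "V holomorphic_on ball 0 r" and r: "r > 0"
  obtains P where "P holomorphic_on - cball 0 (1 / r)"
    "\<And>x. norm x > 1 / r \<Longrightarrow> V (1 / x) / x = V 0 / x + deriv P x"
proof -
  obtain f where f: "f holomorphic_on ball 0 r" "\<And>t. V t = V 0 + t * f t"
    using divided_difference[OF V] by metis
  obtain Q where Q: "\<And>t. t \<in> ball 0 r \<Longrightarrow> (Q has_field_derivative f t) (at t within ball 0 r)"
    using holomorphic_convex_primitive'[OF convex_ball open_ball f(1)] by blast
  have D: "((\<lambda>x. - Q (1 / x)) has_field_derivative f (1 / x) / x\<^sup>2) (at x)" if x: "norm x > 1 / r" for x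
  proof -
    have x0: "x \<noteq> 0" using x r by auto
    have m: "1 / x \<in> ball 0 r" using x x0 r by (simp add: norm_divide field_simps)
    have "(Q has_field_derivative f (1 / x)) (at (1 / x))"
      using Q[OF m] at_within_open[OF m open_ball] by simp
    moreover have "((\<lambda>x. 1 / x) has_field_derivative - (1 / x\<^sup>2)) (at x)"
      using x0 by (auto intro!: derivative_eq_intros simp: power2_eq_square)
    ultimately have "((\<lambda>x. Q (1 / x)) has_field_derivative f (1 / x) * - (1 / x\<^sup>2)) (at x)"
      by (rule DERIV_chain2)
    then show ?thesis using DERIV_minus by fastforce
  qed
  show thesis
  proof (rule that)
    show "(\<lambda>x. - Q (1 / x)) holomorphic_on - cball 0 (1 / r)"
      unfolding holomorphic_on_open[OF open_Compl[OF closed_cball]]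
      by (metis D ComplD mem_cball_0 not_le)
    fix x :: complex assume x: "norm x > 1 / r"
    then have "x \<noteq> 0" using r by auto
    then show "V (1 / x) / x = V 0 / x + deriv (\<lambda>x. - Q (1 / x)) x"
      unfolding DERIV_imp_deriv[OF D[OF x]] using f(2)[of "1 / x"] by (simp add: field_simps power2_eq_square)
  qed
qed

section \<open>The twisted equation on a punctured plane\<close>

lemma translate_neq:
  fixes p q t :: complex
  assumes "2 * r \<le> dist q p" "r > 0" "t \<in> ball 0 r" shows "p + t - q \<noteq> 0"
proof
  assume "p + t - q = 0"
  then have "t = q - p" by (simp add: algebra_simps)
  then have "norm t = dist q p" by (simp add: dist_norm)
  then show False using assms by simp
qed

lemma one_minus_neq:
  fixes w s :: complex
  assumes "norm w \<le> R / 3" "R > 0" "s \<in> ball 0 (3 / R)" shows "1 - w * s \<noteq> 0"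
proof
  assume "1 - w * s = 0"
  then have "norm w * norm s = 1" by (metis eq_iff_diff_eq_0 norm_mult norm_one)
  moreover have "norm w * norm s \<le> (R / 3) * norm s" using assms by (intro mult_right_mono) auto
  moreover have "(R / 3) * norm s < 1" using assms(2,3) by (simp add: field_simps)
  ultimately show False by linarith
qed

text \<open>\<open>G j\<close>, \<open>K j\<close> are the Laurent data of \<open>F\<close>, \<open>H\<close> at \<open>z j\<close> in the coordinate \<open>t = x - z j\<close>, and
  \<open>Gi\<close>, \<open>Ki\<close> those at infinity in the coordinate \<open>s = 1/x\<close>.\<close>

locale twisted_equation =
  fixes J :: "nat set" and z a :: "nat \<Rightarrow> complex" and r R :: real and m :: nat
    and F H :: "complex \<Rightarrow> complex" and G K :: "nat \<Rightarrow> complex \<Rightarrow> complex" and Gi Ki :: "complex \<Rightarrow> complex"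
  assumes J: "finite J" and r: "r > 0"
    and sep: "\<And>i j. i \<in> J \<Longrightarrow> j \<in> J \<Longrightarrow> i \<noteq> j \<Longrightarrow> 2 * r \<le> dist (z i) (z j)"
    and R: "\<And>j. j \<in> J \<Longrightarrow> norm (z j) + r \<le> R / 3" "R > 0"
    and a: "\<And>j. j \<in> J \<Longrightarrow> a j \<notin> \<int>" "(\<Sum>j\<in>J. a j) \<notin> \<int>"
    and F: "F holomorphic_on - z ` J" and H: "H holomorphic_on - z ` J"
    and G: "\<And>j. j \<in> J \<Longrightarrow> G j holomorphic_on ball 0 r" and K: "\<And>j. j \<in> J \<Longrightarrow> K j holomorphic_on ball 0 r"
    and F_near: "\<And>j t. j \<in> J \<Longrightarrow> t \<in> ball 0 r - {0} \<Longrightarrow> F (z j + t) = G j t / t\<^sup>2"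
    and H_near: "\<And>j t. j \<in> J \<Longrightarrow> t \<in> ball 0 r - {0} \<Longrightarrow> H (z j + t) = K j t / t"
    and Gi: "Gi holomorphic_on ball 0 (3 / R)" and Ki: "Ki holomorphic_on ball 0 (3 / R)"
    and F_inf: "\<And>s. s \<in> ball 0 (3 / R) - {0} \<Longrightarrow> F (1 / s) = s ^ (m + 1) * Gi s"
    and H_inf: "\<And>s. s \<in> ball 0 (3 / R) - {0} \<Longrightarrow> H (1 / s) = s * Ki s / s ^ m"
begin

definition "Om = - z ` J"
definition "A x = (\<Sum>j\<in>J. a j / (x - z j))"
definition "Bf j t = (\<Sum>k\<in>J - {j}. a k / (z j + t - z k))"
definition "Bi s = (\<Sum>k\<in>J. a k * z k / (1 - z k * s))"

lemma open_Om: "open Om"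
  unfolding Om_def using J by (intro open_Compl finite_imp_closed finite_imageI)

lemma A_holomorphic: "A holomorphic_on Om"
  unfolding A_def[abs_def] Om_def by (intro holomorphic_intros) auto

lemma near_neq:
  assumes "j \<in> J" "k \<in> J - {j}" "t \<in> ball 0 r" shows "z j + t - z k \<noteq> 0"
  by (rule translate_neq[OF sep r assms(3)]) (use assms in auto)

lemma Bf_holomorphic: "j \<in> J \<Longrightarrow> Bf j holomorphic_on ball 0 r"
  unfolding Bf_def[abs_def] by (intro holomorphic_intros) (use near_neq in blast)

lemma A_near: "j \<in> J \<Longrightarrow> A (z j + t) = a j / t + Bf j t"
  unfolding A_def Bf_def using J by (subst sum.remove[of J j]) auto

lemma punctured_ball_Om:
  assumes "j \<in> J" "x \<in> ball (z j) r - {z j}" shows "x \<in> Om"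
proof -
  have "x \<noteq> z k" if "k \<in> J" for k
  proof (cases "k = j")
    case False
    then have "2 * r \<le> dist (z k) (z j)" using sep that assms(1) by blast
    then show ?thesis using assms r by (auto simp: dist_commute)
  qed (use assms in auto)
  then show ?thesis by (auto simp: Om_def)
qed

lemma inf_neq:
  assumes "k \<in> J" "s \<in> ball 0 (3 / R)" shows "1 - z k * s \<noteq> 0"
  by (rule one_minus_neq[OF _ R(2) assms(2)]) (use R(1)[OF assms(1)] r in simp)

lemma Bi_holomorphic: "Bi holomorphic_on ball 0 (3 / R)"
  unfolding Bi_def[abs_def] by (intro holomorphic_intros) (use inf_neq in blast)

lemma A_inf:
  assumes "s \<in> ball 0 (3 / R) - {0}"
  shows "A (1 / s) = s * (sum a J + s * Bi s)"
proof -
  have "a k / (1 / s - z k) = s * (a k + s * (a k * z k / (1 - z k * s)))" if "k \<in> J" for k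
  proof -
    have "1 - z k * s \<noteq> 0" "s \<noteq> 0" using inf_neq[OF that] assms by auto
    moreover from this have "1 / s - z k = (1 - z k * s) / s" by (simp add: field_simps)
    ultimately show ?thesis by (simp add: field_simps)
  qed
  then show ?thesis
    unfolding A_def Bi_def by (simp add: sum_distrib_left sum.distrib distrib_left)
qed

lemma far_Om:
  assumes "norm x > R / 3" shows "x \<in> Om" "1 / x \<in> ball 0 (3 / R) - {0}"
proof -
  show "x \<in> Om" using assms R(1) r unfolding Om_def by force
  have "x \<noteq> 0" using assms R(2) by auto
  then show "1 / x \<in> ball 0 (3 / R) - {0}" using assms R(2) by (simp add: norm_divide field_simps)
qed

section \<open>Laurent solutions at the punctures and at infinity\<close>

text \<open>As \<open>F\<close> has at most a double pole, the solution is sought as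
  \<open>U / t\<close>. Multiplying its equation by \<open>t^2\<close> gives the one below;
  differentiating \<open>1 / t\<close> turns \<open>a j\<close> into \<open>a j - 1\<close>.\<close>

definition "U j = (SOME U. U holomorphic_on ball 0 r \<and>
  (\<forall>t\<in>ball 0 r. (a j - 1) * U t + t * deriv U t + t * Bf j t * U t = G j t))"

text \<open>The equation for the ansatz \<open>s^m * U s\<close> after division by
  \<open>- s^(m + 1)\<close>; the sign comes from \<open>d/dx = - s^2 d/ds\<close>.\<close>

definition "Ui = (SOME U. U holomorphic_on ball 0 (3 / R) \<and>
  (\<forall>s\<in>ball 0 (3 / R). (of_nat m - sum a J) * U s + s * deriv U s + s * (- Bi s) * U s = - Gi s))"

lemma U:
  assumes j: "j \<in> J"
  shows "U j holomorphic_on ball 0 r"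
    and "t \<in> ball 0 r \<Longrightarrow> (a j - 1) * U j t + t * deriv (U j) t + t * Bf j t * U j t = G j t"
proof -
  have "(a j - 1) + of_nat n \<noteq> 0" for n :: nat
  proof
    assume "(a j - 1) + of_nat n = 0"
    then have "a j = of_int (1 - int n)" by (simp add: algebra_simps)
    then show False using a(1)[OF j] by (metis Ints_of_int)
  qed
  then have "\<exists>U. U holomorphic_on ball 0 r \<and>
      (\<forall>t\<in>ball 0 r. (a j - 1) * U t + t * deriv U t + t * Bf j t * U t = G j t)"
    using local_solution_exists[OF Bf_holomorphic[OF j] G[OF j], of "a j - 1"] by metis
  from someI_ex[OF this] show "U j holomorphic_on ball 0 r"
    and "t \<in> ball 0 r \<Longrightarrow> (a j - 1) * U j t + t * deriv (U j) t + t * Bf j t * U j t = G j t"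
    unfolding U_def[symmetric] by auto
qed

lemma Ui:
  shows "Ui holomorphic_on ball 0 (3 / R)"
    and "s \<in> ball 0 (3 / R) \<Longrightarrow> (of_nat m - sum a J) * Ui s + s * deriv Ui s + s * (- Bi s) * Ui s = - Gi s"
proof -
  have "(of_nat m - sum a J) + of_nat n \<noteq> 0" for n :: nat
  proof
    assume "(of_nat m - sum a J) + of_nat n = 0"
    then have "sum a J = of_nat (m + n)" by (simp add: algebra_simps)
    then show False using a(2) by (metis Ints_of_nat)
  qed
  moreover have "(\<lambda>s. - Bi s) holomorphic_on ball 0 (3 / R)" "(\<lambda>s. - Gi s) holomorphic_on ball 0 (3 / R)"
    by (intro holomorphic_intros Bi_holomorphic Gi)+
  ultimately have "\<exists>U. U holomorphic_on ball 0 (3 / R) \<and>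
      (\<forall>s\<in>ball 0 (3 / R). (of_nat m - sum a J) * U s + s * deriv U s + s * (- Bi s) * U s = - Gi s)"
    using local_solution_exists[of "\<lambda>s. - Bi s" "3 / R" "\<lambda>s. - Gi s" "of_nat m - sum a J"] by metis
  from someI_ex[OF this] show "Ui holomorphic_on ball 0 (3 / R)"
    and "s \<in> ball 0 (3 / R) \<Longrightarrow> (of_nat m - sum a J) * Ui s + s * deriv Ui s + s * (- Bi s) * Ui s = - Gi s"
    unfolding Ui_def[symmetric] by auto
qed

definition "u j x = U j (x - z j) / (x - z j)"
definition "ui x = Ui (1 / x) * (1 / x) ^ m"

lemma u_derivative:
  assumes j: "j \<in> J" and x: "x \<in> ball (z j) r - {z j}"
  shows "(u j has_field_derivative F x - A x * u j x) (at x)"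
proof -
  define t where "t = x - z j"
  have t: "t \<in> ball 0 r - {0}" "x = z j + t" using x by (auto simp: t_def dist_norm norm_minus_commute)
  have "(U j has_field_derivative deriv (U j) t) (at (x - z j))"
    unfolding t_def[symmetric] by (rule holomorphic_derivI[OF U(1)[OF j] open_ball]) (use t in auto)
  then have "((\<lambda>x. U j (x - z j)) has_field_derivative deriv (U j) t * (1 - 0)) (at x)"
    by (rule DERIV_chain2) (intro DERIV_diff DERIV_ident DERIV_const)
  then have "(u j has_field_derivative (deriv (U j) t * (1 - 0) * (x - z j) - U j (x - z j) * (1 - 0)) / ((x - z j) * (x - z j))) (at x)"
    unfolding u_def[abs_def]
    by (rule DERIV_divide) (use x in \<open>auto intro!: derivative_eq_intros\<close>)
  moreover have "(deriv (U j) t * (1 - 0) * (x - z j) - U j (x - z j) * (1 - 0)) / ((x - z j) * (x - z j)) = F x - A x * u j x"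
  proof -
    have e: "F x = G j t / t\<^sup>2" "A x = a j / t + Bf j t" "u j x = U j t / t"
      using F_near[OF j t(1)] A_near[OF j, of t] t(2) by (auto simp: u_def)
    have G': "G j t = (a j - 1) * U j t + t * deriv (U j) t + t * Bf j t * U j t"
      using U(2)[OF j, of t] t(1) by simp
    show ?thesis
      unfolding e t_def[symmetric] G' using t(1) by (simp add: field_simps power2_eq_square)
  qed
  ultimately show ?thesis by simp
qed

lemma ui_derivative:
  assumes x: "norm x > R / 3"
  shows "(ui has_field_derivative F x - A x * ui x) (at x)"
proof -
  define s where "s = 1 / x"
  have s: "s \<in> ball 0 (3 / R) - {0}" "x = 1 / s" using far_Om(2)[OF x] by (auto simp: s_def)
  have "x \<noteq> 0" using s by auto
  then have inv: "((\<lambda>x. 1 / x) has_field_derivative - (s\<^sup>2)) (at x)"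
    unfolding s_def by (auto intro!: derivative_eq_intros simp: power2_eq_square)
  have "(Ui has_field_derivative deriv Ui s) (at (1 / x))"
    unfolding s_def[symmetric] by (rule holomorphic_derivI[OF Ui(1) open_ball]) (use s in auto)
  then have 1: "((\<lambda>x. Ui (1 / x)) has_field_derivative deriv Ui s * - (s\<^sup>2)) (at x)"
    by (rule DERIV_chain2[OF _ inv])
  have 2: "((\<lambda>x. (1 / x) ^ m) has_field_derivative of_nat m * (- (s\<^sup>2) * (1 / x) ^ (m - Suc 0))) (at x)"
    by (rule DERIV_power[OF inv])
  have "(ui has_field_derivative deriv Ui s * - (s\<^sup>2) * (1 / x) ^ m + of_nat m * (- (s\<^sup>2) * (1 / x) ^ (m - Suc 0)) * Ui (1 / x)) (at x)"
    unfolding ui_def[abs_def] by (rule DERIV_mult[OF 1 2])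
  moreover have "deriv Ui s * - (s\<^sup>2) * (1 / x) ^ m + of_nat m * (- (s\<^sup>2) * (1 / x) ^ (m - Suc 0)) * Ui (1 / x) = F x - A x * ui x"
  proof -
    have e: "of_nat m * (- (s\<^sup>2) * s ^ (m - Suc 0)) = - (of_nat m * s ^ (m + 1))"
      by (cases m) (simp_all add: power2_eq_square)
    have G': "Gi s = - ((of_nat m - sum a J) * Ui s + s * deriv Ui s + s * (- Bi s) * Ui s)"
      using Ui(2)[of s] s by auto
    have ux: "ui x = Ui s * s ^ m" "1 / x = s" by (simp_all add: ui_def s_def)
    show ?thesis
      unfolding ux e unfolding s(2) F_inf[OF s(1)] A_inf[OF s(1)] G'
      by (simp add: algebra_simps power2_eq_square)
  qed
  ultimately show ?thesis by simp
qed

lemma u_holomorphic: "j \<in> J \<Longrightarrow> u j holomorphic_on ball (z j) r - {z j}"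
  unfolding holomorphic_on_open[OF open_Diff[OF open_ball closed_singleton]]
  using u_derivative by blast

lemma ui_holomorphic: "ui holomorphic_on - cball 0 (R / 3)"
  unfolding holomorphic_on_open[OF open_Compl[OF closed_cball]]
  by (metis ui_derivative ComplD mem_cball_0 not_le)

section \<open>Gluing the local solutions\<close>

text \<open>On the first set \<open>u j\<close> is holomorphic and on the second the cutoff
  vanishes, so \<open>piece j\<close> is smooth on both, whatever values \<open>u j\<close> takes
  far from \<open>z j\<close>.\<close>

lemma cover_near: "Om \<subseteq> (ball (z j) r - {z j}) \<union> - cball (z j) (3/4 * r)" if "j \<in> J"
  using r that by (auto simp: Om_def)

definition "piece j x = cut (z j) r x * u j x"
definition "piece_inf x = (1 - cut 0 R x) * ui x"

lemma smooth_on_piece: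
  assumes j: "j \<in> J" shows "smooth_on Om (piece j)"
proof -
  have o: "open (ball (z j) r - {z j})" "open (- cball (z j) (3/4 * r))" by (auto intro!: open_Diff)
  have "smooth_on (ball (z j) r - {z j}) (piece j)"
    unfolding piece_def[abs_def]
    by (intro smooth_on_mult smooth_on_cut smooth_on_holomorphic u_holomorphic j o)
  moreover have "smooth_on (- cball (z j) (3/4 * r)) (piece j)"
    by (rule smooth_on_cong[OF o(2) smooth_on_const[of _ 0]])
      (auto simp: piece_def cut_eq_0[OF r] dist_norm norm_minus_commute)
  ultimately show ?thesis
    using smooth_on_subset[OF smooth_on_Un[OF o] cover_near[OF j]] by blast
qed

lemma dzb_piece:
  assumes j: "j \<in> J" and x: "x \<in> Om" shows "dzb (piece j) x = dzb (cut (z j) r) x * u j x"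
proof (cases "x \<in> ball (z j) r - {z j}")
  case True
  have "u j differentiable (at x)" "dzb (u j) x = 0"
    using u_derivative[OF j True] dz_field_derivative(2) by (auto simp: differentiable_def has_field_derivative_def)
  moreover have "cut (z j) r differentiable (at x)"
    using smooth_on_imp_differentiable[OF smooth_on_cut[OF open_UNIV]] by blast
  ultimately show ?thesis unfolding piece_def[abs_def] by (simp add: dz_mult)
next
  case False
  then have x': "x \<in> - cball (z j) (3/4 * r)" using cover_near[OF j] x by blast
  have "dzb (piece j) x = 0"
    by (rule dz_locally_const(2)[OF _ x', of _ 0])
      (auto simp: piece_def cut_eq_0[OF r] dist_norm norm_minus_commute)
  moreover have "x \<notin> annulus (z j) r" using x' by (simp add: annulus_def)
  ultimately show ?thesis by (simp add: dz_cut_eq_0[OF r])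
qed

text \<open>The discs around the punctures lie within radius \<open>R / 3\<close>. Beyond it
  \<open>ui\<close> is holomorphic, while its cutoff factor vanishes up to \<open>R / 2\<close>, so
  the two regions overlap.\<close>

lemma cover_far: "Om \<subseteq> - cball 0 (R / 3) \<union> ball 0 (R / 2)"
  using R(2) by (auto simp: field_simps)

lemma smooth_on_piece_inf: "smooth_on Om piece_inf"
proof -
  have o: "open (- cball (0::complex) (R / 3))" "open (ball (0::complex) (R / 2))" by auto
  have "smooth_on (- cball 0 (R / 3)) piece_inf"
    unfolding piece_inf_def[abs_def]
    by (intro smooth_on_mult smooth_on_diff smooth_on_const smooth_on_cut smooth_on_holomorphic ui_holomorphic o)
  moreover have "smooth_on (ball 0 (R / 2)) piece_inf"
    by (rule smooth_on_cong[OF o(2) smooth_on_const[of _ 0]]) (auto simp: piece_inf_def cut_eq_1[OF R(2)])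
  ultimately show ?thesis
    using smooth_on_subset[OF smooth_on_Un[OF o] cover_far] by blast
qed

lemma dzb_piece_inf:
  assumes x: "x \<in> Om" shows "dzb piece_inf x = - dzb (cut 0 R) x * ui x"
proof (cases "x \<in> - cball 0 (R / 3)")
  case True
  then have "norm x > R / 3" by simp
  then have "ui differentiable (at x)" "dzb ui x = 0"
    using ui_derivative dz_field_derivative(2) by (auto simp: differentiable_def has_field_derivative_def)
  moreover have "cut 0 R differentiable (at x)"
    using smooth_on_imp_differentiable[OF smooth_on_cut[OF open_UNIV]] by blast
  ultimately show ?thesis unfolding piece_inf_def[abs_def] by (simp add: dz_mult dz_diff)
next
  case False
  then have x': "x \<in> ball 0 (R / 2)" using cover_far x by blast
  have "dzb piece_inf x = 0"
    by (rule dz_locally_const(2)[OF _ x', of _ 0]) (auto simp: piece_inf_def cut_eq_1[OF R(2)])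
  moreover have "x \<notin> annulus 0 R" using x' by (simp add: annulus_def)
  ultimately show ?thesis by (simp add: dz_cut_eq_0[OF R(2)])
qed

definition "kap0 x = (\<Sum>j\<in>J. piece j x) + piece_inf x"

lemma smooth_on_kap0: "smooth_on Om kap0"
  unfolding kap0_def[abs_def]
  by (intro smooth_on_add smooth_on_sum open_Om smooth_on_piece smooth_on_piece_inf)

lemma dzb_kap0:
  assumes x: "x \<in> Om"
  shows "dzb kap0 x = (\<Sum>j\<in>J. dzb (cut (z j) r) x * u j x) - dzb (cut 0 R) x * ui x"
proof -
  have "\<And>j. j \<in> J \<Longrightarrow> piece j differentiable (at x)" "piece_inf differentiable (at x)"
    using smooth_on_imp_differentiable[OF smooth_on_piece x] smooth_on_imp_differentiable[OF smooth_on_piece_inf x] by auto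
  then show ?thesis
    unfolding kap0_def[abs_def] using J
    by (simp add: dz_add dz_sum dzb_piece dzb_piece_inf x)
qed

lemma kap0_near:
  assumes j: "j \<in> J" and x: "x \<in> ball (z j) (r / 2)"
  shows "kap0 x = u j x"
proof -
  have nx: "norm (x - z j) < r / 2" using x by (simp add: dist_norm norm_minus_commute)
  have "piece k x = 0" if "k \<in> J - {j}" for k
  proof -
    have "2 * r \<le> dist (z k) (z j)" using sep that j by auto
    also have "\<dots> \<le> norm (x - z k) + norm (x - z j)" by (metis dist_norm dist_triangle2 dist_commute)
    finally have "norm (x - z k) \<ge> 3/4 * r" using nx r by simp
    then show ?thesis by (simp add: piece_def cut_eq_0[OF r])
  qed
  then have "(\<Sum>k\<in>J. piece k x) = piece j x"
    using J j by (simp add: sum.remove)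
  moreover have "piece j x = u j x" using nx by (simp add: piece_def cut_eq_1[OF r])
  moreover have "piece_inf x = 0"
  proof -
    have "norm x \<le> norm (x - z j) + norm (z j)" using norm_triangle_ineq[of "x - z j" "z j"] by simp
    then have "norm x \<le> R / 2" using nx R(1)[OF j] R(2) r by linarith
    then show ?thesis by (simp add: piece_inf_def cut_eq_1[OF R(2)])
  qed
  ultimately show ?thesis by (simp add: kap0_def)
qed

lemma kap0_far:
  assumes x: "norm x > 3/4 * R"
  shows "kap0 x = ui x"
proof -
  have "piece j x = 0" if j: "j \<in> J" for j
  proof -
    have "norm x \<le> norm (x - z j) + norm (z j)" using norm_triangle_ineq[of "x - z j" "z j"] by simp
    then have "norm (x - z j) \<ge> 3/4 * r" using x R(1)[OF j] R(2) r by linarith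
    then show ?thesis by (simp add: piece_def cut_eq_0[OF r])
  qed
  then show ?thesis using x by (simp add: kap0_def piece_inf_def cut_eq_0[OF R(2)])
qed

section \<open>Solutions modulo compact support\<close>

text \<open>Planar counterpart of \<open>is_reg\<close>: \<open>F dx\<close> minus the twisted
  derivative of \<open>\<kappa>\<close> is supported in \<open>C\<close>. The first equation is its
  \<open>d(cnj x)\<close> component, the second its \<open>dx\<close> component.\<close>

definition is_solution :: "(complex \<Rightarrow> complex) \<Rightarrow> complex set \<Rightarrow> bool" where
  "is_solution \<kappa> C \<longleftrightarrow> smooth_on Om \<kappa> \<and> compact C \<and> C \<subseteq> Om \<and>
     (\<forall>x\<in>Om - C. dzb \<kappa> x = 0 \<and> dz \<kappa> x + A x * \<kappa> x = F x)"

text \<open>Outside this set a single piece survives, with cutoff factor 1, so \<open>kap0\<close>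
  coincides locally with one of the Laurent solutions.\<close>

lemma is_solution_kap0: "is_solution kap0 (cball 0 (3/4 * R) - (\<Union>j\<in>J. ball (z j) (r / 2)))"
  unfolding is_solution_def
proof (intro conjI ballI)
  let ?C = "cball 0 (3/4 * R) - (\<Union>j\<in>J. ball (z j) (r / 2))"
  show "smooth_on Om kap0" by (rule smooth_on_kap0)
  show "compact ?C" by (intro compact_diff compact_cball open_UN ballI open_ball)
  show "?C \<subseteq> Om" using r by (auto simp: Om_def)
  fix x assume x: "x \<in> Om - ?C"
  have *: "dzb kap0 x = 0 \<and> dz kap0 x + A x * kap0 x = F x"
    if V: "open V" "x \<in> V" "\<And>y. y \<in> V \<Longrightarrow> v y = kap0 y" and v: "(v has_field_derivative F x - A x * v x) (at x)" for v V
  proof -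
    have "v differentiable (at x)" using v by (auto simp: differentiable_def has_field_derivative_def)
    from dz_cong[OF V this] show ?thesis
      using dz_field_derivative[OF v] V(3)[OF V(2)] by simp
  qed
  consider j where "j \<in> J" "x \<in> ball (z j) (r / 2)" | "x \<in> - cball 0 (3/4 * R)" using x by blast
  then have "dzb kap0 x = 0 \<and> dz kap0 x + A x * kap0 x = F x"
  proof cases
    case 1
    have "x \<in> ball (z j) r - {z j}" using 1 x r by (auto simp: Om_def)
    from *[OF open_ball 1(2) kap0_near[OF 1(1), symmetric] u_derivative[OF 1(1) this]]
    show ?thesis by simp
  next
    case 2
    then have "norm x > R / 3" using R(2) by simp
    from *[OF open_Compl[OF closed_cball] 2 kap0_far[symmetric] ui_derivative[OF this]]
    show ?thesis by simp
  qed
  then show "dzb kap0 x = 0" "dz kap0 x + A x * kap0 x = F x" by auto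
qed

text \<open>Off \<open>C\<close> the function is holomorphic, as \<open>dzb\<close> vanishes there.
  Every puncture has a punctured disc that misses \<open>C\<close>, where monodromy forces the
  function to be 0, and likewise near infinity; what is left of the plane is compact.\<close>

lemma homogeneous_compact_support:
  assumes \<delta>: "smooth_on Om \<delta>" and C: "compact C" "C \<subseteq> Om"
    and eq: "\<And>x. x \<in> Om - C \<Longrightarrow> dzb \<delta> x = 0 \<and> dz \<delta> x + A x * \<delta> x = 0"
  obtains C' where "compact C'" "C' \<subseteq> Om" "\<And>x. x \<in> Om - C' \<Longrightarrow> \<delta> x = 0"
proof -
  have d: "(\<delta> has_field_derivative - A x * \<delta> x) (at x)" if x: "x \<in> Om - C" for x
  proof -
    have "\<delta> differentiable (at x)" using smooth_on_imp_differentiable[OF \<delta>] x by blast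
    moreover have "dzb \<delta> x = 0" "dz \<delta> x = - A x * \<delta> x"
      using eq[OF x] by (simp_all add: eq_neg_iff_add_eq_0)
    ultimately have "frechet_derivative \<delta> (at x) = (*) (- A x * \<delta> x)"
      by (intro ext) (simp add: frechet_derivative_Wirtinger)
    with \<open>\<delta> differentiable (at x)\<close> show ?thesis
      by (simp add: frechet_derivative_works has_field_derivative_def)
  qed
  have near: "\<exists>\<rho>. 0 < \<rho> \<and> \<rho> \<le> r \<and> (\<forall>x\<in>ball (z j) \<rho> - {z j}. \<delta> x = 0)" if j: "j \<in> J" for j
  proof -
    have "z j \<in> - C" "open (- C)" using C j compact_imp_closed[OF C(1)] by (auto simp: Om_def)
    then obtain e where e: "e > 0" "ball (z j) e \<subseteq> - C" by (meson openE)
    let ?\<rho> = "min e r"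
    have "\<delta> x = 0" if x: "x \<in> ball (z j) ?\<rho> - {z j}" for x
    proof -
      have "(\<lambda>t. \<delta> (z j + t)) (x - z j) = 0"
      proof (rule homogeneous_solution_zero[where \<delta> = "\<lambda>t. \<delta> (z j + t)" and ?t0.0 = "x - z j",
            OF holomorphic_on_subset[OF Bf_holomorphic[OF j]] a(1)[OF j]])
        show "ball 0 ?\<rho> \<subseteq> ball 0 r" by auto
        show "x - z j \<in> ball 0 ?\<rho> - {0}" using x by (auto simp: dist_norm norm_minus_commute)
        fix t :: complex assume t: "t \<in> ball 0 ?\<rho> - {0}"
        have "z j + t \<in> Om - C"
        proof -
          have "z j + t \<in> ball (z j) e" using t by (simp add: dist_norm)
          then show ?thesis
            using punctured_ball_Om[OF j, of "z j + t"] subsetD[OF e(2)] t by (auto simp: dist_norm)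
        qed
        from d[OF this] have "(\<delta> has_field_derivative - (a j / t + Bf j t) * \<delta> (z j + t)) (at (z j + t))"
          by (simp add: A_near[OF j])
        moreover have "((\<lambda>t. z j + t) has_field_derivative 1) (at t)" by (auto intro!: derivative_eq_intros)
        ultimately show "((\<lambda>t. \<delta> (z j + t)) has_field_derivative - (a j / t + Bf j t) * \<delta> (z j + t)) (at t)"
          using DERIV_chain2 by fastforce
      qed
      then show ?thesis by simp
    qed
    then show ?thesis using e(1) r by (intro exI[of _ ?\<rho>]) auto
  qed
  then obtain \<rho> where \<rho>: "\<And>j. j \<in> J \<Longrightarrow> 0 < \<rho> j \<and> \<rho> j \<le> r \<and> (\<forall>x\<in>ball (z j) (\<rho> j) - {z j}. \<delta> x = 0)" by metis
  obtain R1 where R1: "\<And>x. x \<in> C \<Longrightarrow> norm x \<le> R1" using compact_imp_bounded[OF C(1)] unfolding bounded_iff by blast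
  \<comment> \<open>Beyond \<open>R'\<close> the points avoid \<open>C\<close>, and
    \<open>1 / x\<close> stays in the disc on which \<open>Bi\<close> is holomorphic.\<close>
  define R' where "R' = max R (\<bar>R1\<bar> + 1)"
  have R': "R' \<ge> R" "R' > R1" "R' > 0" using R(2) by (auto simp: R'_def)
  have far: "\<delta> x = 0" if x: "norm x > R'" for x
  proof -
    have "(\<lambda>s. \<delta> (1 / s)) (1 / x) = 0"
    \<comment> \<open>In the coordinate \<open>s = 1 / x\<close> the equation keeps its shape;
      \<open>dx = - ds / s^2\<close> turns the exponent into \<open>- sum a J\<close> and
      \<open>Bi\<close> into \<open>- Bi\<close>.\<close>
    proof (rule homogeneous_solution_zero[where \<delta> = "\<lambda>s. \<delta> (1 / s)" and ?t0.0 = "1 / x"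
          and B = "\<lambda>s. - Bi s" and r = "1 / R'" and a = "- sum a J"])
      have sub: "1 / R' \<le> 3 / R" using R' R(2) by (simp add: field_simps)
      show "(\<lambda>s. - Bi s) holomorphic_on ball 0 (1 / R')"
        by (intro holomorphic_on_minus holomorphic_on_subset[OF Bi_holomorphic]) (use sub in auto)
      show "- sum a J \<notin> \<int>" using a(2) by simp
      show "1 / x \<in> ball 0 (1 / R') - {0}" using x R' less_trans[OF R'(3) x] by (auto simp: norm_divide field_simps)
      fix s :: complex assume s: "s \<in> ball 0 (1 / R') - {0}"
      then have "norm (1 / s) > R'" using R' by (auto simp: norm_divide field_simps)
      then have m: "1 / s \<in> Om - C" using far_Om(1)[of "1 / s"] R' R(2) R1[of "1 / s"] by auto
      have s': "s \<in> ball 0 (3 / R) - {0}" using s sub by auto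
      have "((\<lambda>s. 1 / s) has_field_derivative - (1 / s\<^sup>2)) (at s)"
        using s by (auto intro!: derivative_eq_intros simp: power2_eq_square)
      from DERIV_chain2[OF d[OF m] this]
      have "((\<lambda>s. \<delta> (1 / s)) has_field_derivative - A (1 / s) * \<delta> (1 / s) * - (1 / s\<^sup>2)) (at s)" .
      moreover have "- A (1 / s) * \<delta> (1 / s) * - (1 / s\<^sup>2) = - (- sum a J / s + - Bi s) * \<delta> (1 / s)"
        unfolding A_inf[OF s'] using s by (simp add: field_simps power2_eq_square)
      ultimately show "((\<lambda>s. \<delta> (1 / s)) has_field_derivative - (- sum a J / s + - Bi s) * \<delta> (1 / s)) (at s)"
        by simp
    qed
    then show ?thesis by simp
  qed
  show thesis
  proof (rule that[of "cball 0 R' - (\<Union>j\<in>J. ball (z j) (\<rho> j))"])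
    show "compact (cball 0 R' - (\<Union>j\<in>J. ball (z j) (\<rho> j)))"
      by (intro compact_diff compact_cball open_UN ballI open_ball)
    show "cball 0 R' - (\<Union>j\<in>J. ball (z j) (\<rho> j)) \<subseteq> Om"
    proof
      fix x assume x: "x \<in> cball 0 R' - (\<Union>j\<in>J. ball (z j) (\<rho> j))"
      have "x \<noteq> z j" if "j \<in> J" for j using x \<rho>[OF that] that by auto
      then show "x \<in> Om" by (auto simp: Om_def)
    qed
    fix x assume x: "x \<in> Om - (cball 0 R' - (\<Union>j\<in>J. ball (z j) (\<rho> j)))"
    then consider "norm x > R'" | j where "j \<in> J" "x \<in> ball (z j) (\<rho> j)" by force
    then show "\<delta> x = 0"
    proof cases
      case 2
      then show ?thesis using \<rho>[OF 2(1)] x by (auto simp: Om_def)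
    qed (rule far)
  qed
qed

section \<open>Residues and the value of the planar integral\<close>

text \<open>The residue of \<open>u j * H = U j * K j / t^2\<close> at \<open>z j\<close>, that is
  the derivative of \<open>U j * K j\<close> at 0, with \<open>U j 0\<close> and
  \<open>deriv (U j) 0\<close> expressed through the data.\<close>

definition "res j = G j 0 / (a j - 1) * deriv (K j) 0
  + (deriv (G j) 0 - Bf j 0 * (G j 0 / (a j - 1))) / a j * K j 0"

text \<open>The coefficient of \<open>1 / x\<close> in \<open>ui * H\<close> at infinity, namely
  \<open>Ui 0 * Ki 0\<close>.\<close>

definition "res_inf = Gi 0 * Ki 0 / (sum a J - of_nat m)"

lemma set_integrable_solution:
  assumes s: "is_solution \<kappa> C" and h: "continuous_on Om h"
  shows "set_integrable lborel Om (\<lambda>x. dzb \<kappa> x * h x)"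
proof (rule set_integrable_support[of C])
  have "continuous_on Om (dzb \<kappa>)"
    using s smooth_on_imp_continuous_on[OF smooth_on_dzb[OF open_Om]] unfolding is_solution_def by blast
  then show "continuous_on Om (\<lambda>x. dzb \<kappa> x * h x)" using h by (intro continuous_on_mult)
qed (use s in \<open>auto simp: is_solution_def\<close>)

text \<open>No residues are needed here: off a compact set the integrand is a combination of
  derivatives of compactly supported functions.\<close>

lemma integral_exact_zero:
  assumes s: "is_solution \<kappa> C" and g: "g holomorphic_on Om"
  shows "(LINT x:Om|lborel. dzb \<kappa> x * (deriv g x - A x * g x)) = 0"
proof -
  have \<kappa>: "smooth_on Om \<kappa>" and C: "compact C" "C \<subseteq> Om"
    and off: "\<And>x. x \<in> Om - C \<Longrightarrow> dzb \<kappa> x = 0" "\<And>x. x \<in> Om - C \<Longrightarrow> dz \<kappa> x + A x * \<kappa> x = F x"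
    using s by (auto simp: is_solution_def)
  \<comment> \<open>Aim: \<open>dzb \<kappa> * (g' - A * g) = dz P - dzb Q\<close> with
    \<open>P = g * dzb \<kappa>\<close> and \<open>Q = (dz \<kappa> + A * \<kappa> - F) * g\<close>.
    Both vanish off \<open>C\<close> by the definition of a solution, and the mixed second
    derivatives of \<open>\<kappa>\<close> cancel.\<close>
  have sg: "smooth_on Om g" "smooth_on Om A" "smooth_on Om F"
    using smooth_on_holomorphic[OF open_Om] g A_holomorphic F Om_def by auto
  let ?P = "\<lambda>x. g x * dzb \<kappa> x" and ?Q = "\<lambda>x. (dz \<kappa> x + A x * \<kappa> x - F x) * g x"
  have s: "smooth_on Om ?P" "smooth_on Om ?Q"
    by (intro smooth_on_mult smooth_on_add smooth_on_diff smooth_on_dz smooth_on_dzb open_Om sg \<kappa>)+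
  have z: "?P x = 0" "?Q x = 0" if "x \<in> Om - C" for x using off[OF that] by auto
  have i1: "(LINT x:Om|lborel. dz ?P x) = 0"
    by (rule integral_Wirtinger_zero(1)[OF open_Om C s(1) z(1)])
  have i2: "(LINT x:Om|lborel. dzb ?Q x) = 0"
    by (rule integral_Wirtinger_zero(2)[OF open_Om C s(2) z(2)])
  have eq: "dzb \<kappa> x * (deriv g x - A x * g x) = dz ?P x - dzb ?Q x" if x: "x \<in> Om" for x
  proof -
    have d: "\<kappa> differentiable (at x)" "dz \<kappa> differentiable (at x)" "dzb \<kappa> differentiable (at x)"
      "g differentiable (at x)" "A differentiable (at x)" "F differentiable (at x)"
      using smooth_on_imp_differentiable[OF _ x] smooth_on_dz[OF open_Om \<kappa>] smooth_on_dzb[OF open_Om \<kappa>] \<kappa> sg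
      by auto
    have h: "dz g x = deriv g x" "dzb g x = 0" "dzb A x = 0" "dzb F x = 0"
      using dz_field_derivative[OF holomorphic_derivI[OF _ open_Om x]] g A_holomorphic F Om_def by auto
    show ?thesis
      by (simp add: dz_mult dz_add dz_diff d differentiable_add differentiable_diff differentiable_mult h
          dz_dzb_commute[OF open_Om x \<kappa>] algebra_simps)
  qed
  have "(LINT x:Om|lborel. dzb \<kappa> x * (deriv g x - A x * g x)) = (LINT x:Om|lborel. dz ?P x - dzb ?Q x)"
    unfolding set_lebesgue_integral_def
    by (intro Bochner_Integration.integral_cong refl) (auto simp: indicator_def eq)
  also have "\<dots> = (LINT x:Om|lborel. dz ?P x) - (LINT x:Om|lborel. dzb ?Q x)"
    by (rule set_integral_diff(2)[OF set_integrable_Wirtinger(1)[OF open_Om C s(1) z(1)]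
            set_integrable_Wirtinger(2)[OF open_Om C s(2) z(2)]])
  also have "\<dots> = 0" unfolding i1 i2 by simp
  finally show ?thesis .
qed

lemma integral_solution_unique:
  assumes s: "is_solution \<kappa> C" and s': "is_solution \<kappa>' C'"
  shows "(LINT x:Om|lborel. dzb \<kappa> x * H x) = (LINT x:Om|lborel. dzb \<kappa>' x * H x)"
proof -
  have \<kappa>: "smooth_on Om \<kappa>" "smooth_on Om \<kappa>'" using s s' by (auto simp: is_solution_def)
  have d: "\<kappa> differentiable (at x)" "\<kappa>' differentiable (at x)" if "x \<in> Om" for x
    using smooth_on_imp_differentiable that \<kappa> by blast+
  let ?d = "\<lambda>x. \<kappa> x - \<kappa>' x"
  have sd: "smooth_on Om ?d" by (intro smooth_on_diff open_Om \<kappa>)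
  have "compact (C \<union> C')" "C \<union> C' \<subseteq> Om"
    using s s' by (auto simp: is_solution_def)
  moreover have "dzb ?d x = 0 \<and> dz ?d x + A x * ?d x = 0" if "x \<in> Om - (C \<union> C')" for x
  proof -
    have "dzb \<kappa> x = 0 \<and> dz \<kappa> x + A x * \<kappa> x = F x" "dzb \<kappa>' x = 0 \<and> dz \<kappa>' x + A x * \<kappa>' x = F x"
      using s s' that by (auto simp: is_solution_def)
    then show ?thesis using d that by (simp add: dz_diff right_diff_distrib) (metis add_diff_add diff_self)
  qed
  ultimately obtain E where E: "compact E" "E \<subseteq> Om" "\<And>x. x \<in> Om - E \<Longrightarrow> ?d x = 0"
    using homogeneous_compact_support[OF sd] by blast
  have sH: "smooth_on Om H" using smooth_on_holomorphic[OF open_Om] H Om_def by simp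
  have cH: "continuous_on Om H" by (rule smooth_on_imp_continuous_on[OF sH])
  have "(LINT x:Om|lborel. dzb \<kappa> x * H x) - (LINT x:Om|lborel. dzb \<kappa>' x * H x)
      = (LINT x:Om|lborel. dzb \<kappa> x * H x - dzb \<kappa>' x * H x)"
    by (rule set_integral_diff(2)[symmetric, OF set_integrable_solution[OF s cH] set_integrable_solution[OF s' cH]])
  also have "\<dots> = (LINT x:Om|lborel. dzb (\<lambda>x. ?d x * H x) x)"
    unfolding set_lebesgue_integral_def
  proof (intro Bochner_Integration.integral_cong refl)
    fix x
    have "dzb \<kappa> x * H x - dzb \<kappa>' x * H x = dzb (\<lambda>x. ?d x * H x) x" if x: "x \<in> Om"
    proof -
      have "H differentiable (at x)" using smooth_on_imp_differentiable[OF sH x] .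
      moreover have "dzb H x = 0"
        by (rule dz_field_derivative(2)[OF holomorphic_derivI[OF H _]]) (use x open_Om Om_def in auto)
      ultimately show ?thesis
        by (simp add: dz_mult dz_diff d[OF x] differentiable_diff left_diff_distrib)
    qed
    then show "indicat_real Om x *\<^sub>R (dzb \<kappa> x * H x - dzb \<kappa>' x * H x) = indicat_real Om x *\<^sub>R dzb (\<lambda>x. ?d x * H x) x"
      by (auto simp: indicator_def)
  qed
  also have "\<dots> = 0"
    by (rule integral_Wirtinger_zero(2)[OF open_Om E(1,2)]) (use E(3) in \<open>auto intro!: smooth_on_mult open_Om sd sH\<close>)
  finally show ?thesis by simp
qed

lemma integral_piece:
  assumes j: "j \<in> J"
  shows "(LINT x:Om|lborel. dzb (piece j) x * H x) = - of_real pi * res j"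
proof -
  let ?K = "annulus (z j) r" and ?N = "ball (z j) r - {z j}"
  have KN: "?K \<subseteq> ?N" using r by (auto simp: annulus_def)
  have NO: "?N \<subseteq> Om" using punctured_ball_Om[OF j] by blast
  let ?V = "\<lambda>t. U j t * K j t"
  have V: "?V holomorphic_on ball 0 r" by (intro holomorphic_intros U(1) K j)
  obtain P where P: "P holomorphic_on ?N"
    "\<And>x. x \<in> ?N \<Longrightarrow> ?V (x - z j) / (x - z j)\<^sup>2 = deriv ?V 0 / (x - z j) + deriv P x"
    using residue_form_double_pole[OF V] by blast
  have 0: "0 \<in> ball (0::complex) r" using r by simp
  have "deriv ?V 0 = U j 0 * deriv (K j) 0 + deriv (U j) 0 * K j 0"
    by (rule DERIV_imp_deriv, rule DERIV_mult')
      (auto intro!: holomorphic_derivI[OF _ open_ball 0] U(1) K j)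
  moreover have "U j 0 = G j 0 / (a j - 1)" "deriv (U j) 0 = (deriv (G j) 0 - Bf j 0 * (G j 0 / (a j - 1))) / a j"
  proof -
    have n: "a j - 1 \<noteq> 0" "a j \<noteq> 0" using a(1)[OF j] by auto
    note v = local_solution_values[OF r U(1)[OF j] Bf_holomorphic[OF j] U(2)[OF j]]
    from v(1) n show e: "U j 0 = G j 0 / (a j - 1)" by (simp add: field_simps)
    show "deriv (U j) 0 = (deriv (G j) 0 - Bf j 0 * (G j 0 / (a j - 1))) / a j"
      using v(2) n unfolding e by (simp add: field_simps)
  qed
  ultimately have V': "deriv ?V 0 = res j" by (simp add: res_def)
  have "(LINT x:Om|lborel. dzb (piece j) x * H x) = (LINT x:?K|lborel. dzb (piece j) x * H x)"
    by (rule set_integral_support) (use KN NO in \<open>auto simp: dzb_piece[OF j] dz_cut_eq_0[OF r]\<close>)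
  also have "\<dots> = (LINT x:?K|lborel. dzb (cut (z j) r) x * (u j x * H x))"
    unfolding set_lebesgue_integral_def
    by (intro Bochner_Integration.integral_cong refl)
      (use KN NO in \<open>auto simp: indicator_def dzb_piece[OF j] mult.assoc\<close>)
  also have "\<dots> = - of_real pi * res j"
  proof (rule integral_dzb_cut_residue[OF r _ KN P(1)])
    show "open ?N" by (auto intro: open_Diff)
    fix x assume "x \<in> ?K"
    then have x: "x \<in> ?N" using KN by blast
    then have "x - z j \<in> ball 0 r - {0}" by (auto simp: dist_norm norm_minus_commute)
    from H_near[OF j this] have "H x = K j (x - z j) / (x - z j)" by simp
    then show "u j x * H x = res j / (x - z j) + deriv P x"
      unfolding V'[symmetric] P(2)[OF x, symmetric] by (simp add: u_def power2_eq_square)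
  qed
  finally show ?thesis .
qed

lemma integral_piece_inf: "(LINT x:Om|lborel. dzb piece_inf x * H x) = of_real pi * res_inf"
proof -
  let ?K = "annulus 0 R" and ?N = "- cball (0::complex) (R / 3)"
  have KN: "?K \<subseteq> ?N" using R(2) by (auto simp: annulus_def)
  have NO: "?N \<subseteq> Om" using far_Om(1) by auto
  let ?V = "\<lambda>t. Ui t * Ki t"
  have V: "?V holomorphic_on ball 0 (3 / R)" by (intro holomorphic_intros Ui(1) Ki)
  obtain P where P: "P holomorphic_on - cball 0 (1 / (3 / R))"
    "\<And>x. norm x > 1 / (3 / R) \<Longrightarrow> ?V (1 / x) / x = ?V 0 / x + deriv P x"
    using residue_form_infinity[OF V] R(2) by auto
  have Ui0: "Ui 0 = Gi 0 / (sum a J - of_nat m)"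
  proof -
    have "sum a J - of_nat m \<noteq> 0"
    proof
      assume "sum a J - of_nat m = 0"
      then have "sum a J = of_nat m" by simp
      then show False using a(2) by (metis Ints_of_nat)
    qed
    then show ?thesis using Ui(2)[of 0] R(2) by (simp add: field_simps)
  qed
  have V0: "?V 0 = res_inf" by (simp add: res_inf_def Ui0)
  have "(LINT x:Om|lborel. dzb piece_inf x * H x) = (LINT x:?K|lborel. dzb piece_inf x * H x)"
    by (rule set_integral_support) (use KN NO in \<open>auto simp: dzb_piece_inf dz_cut_eq_0[OF R(2)]\<close>)
  \<comment> \<open>The cutoff enters as \<open>1 - cut 0 R\<close>, so infinity counts with the
    sign opposite to that of the finite punctures.\<close>
  also have "\<dots> = (LINT x:?K|lborel. - (dzb (cut 0 R) x * (ui x * H x)))"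
    unfolding set_lebesgue_integral_def
    by (intro Bochner_Integration.integral_cong refl)
      (use KN NO in \<open>auto simp: indicator_def dzb_piece_inf mult.assoc\<close>)
  also have "\<dots> = - (LINT x:?K|lborel. dzb (cut 0 R) x * (ui x * H x))"
    by (simp add: set_lebesgue_integral_def)
  also have "(LINT x:?K|lborel. dzb (cut 0 R) x * (ui x * H x)) = - of_real pi * res_inf"
  proof (rule integral_dzb_cut_residue[OF R(2) _ KN])
    show "open ?N" by auto
    show "P holomorphic_on ?N" using P(1) by simp
    fix x assume "x \<in> ?K"
    then have x: "norm x > R / 3" using KN by auto
    have s: "1 / x \<in> ball 0 (3 / R) - {0}" by (rule far_Om(2)[OF x])
    have "H x = 1 / x * Ki (1 / x) / (1 / x) ^ m" using H_inf[OF s] by simp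
    then have "ui x * H x = ?V (1 / x) / x" using s by (simp add: ui_def field_simps)
    then show "ui x * H x = res_inf / (x - 0) + deriv P x"
      using P(2)[of x] x unfolding V0 by simp
  qed
  finally show ?thesis by simp
qed

lemma integral_kap0:
  "(LINT x:Om|lborel. dzb kap0 x * H x) = - of_real pi * (\<Sum>j\<in>J. res j) + of_real pi * res_inf"
proof -
  have cH: "continuous_on Om H" using H Om_def holomorphic_on_imp_continuous_on by auto
  have cp: "continuous_on Om (dzb (piece j))" if "j \<in> J" for j
    by (rule smooth_on_imp_continuous_on[OF smooth_on_dzb[OF open_Om smooth_on_piece[OF that]]])
  have cpi: "continuous_on Om (dzb piece_inf)"
    by (rule smooth_on_imp_continuous_on[OF smooth_on_dzb[OF open_Om smooth_on_piece_inf]])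
  have i1: "set_integrable lborel Om (\<lambda>x. dzb (piece j) x * H x)" if j: "j \<in> J" for j
  proof (rule set_integrable_support[of "annulus (z j) r"])
    have "annulus (z j) r \<subseteq> ball (z j) r - {z j}" using r by (auto simp: annulus_def)
    then show "annulus (z j) r \<subseteq> Om" using punctured_ball_Om[OF j] by blast
    show "continuous_on Om (\<lambda>x. dzb (piece j) x * H x)" by (intro continuous_on_mult cp j cH)
  qed (auto simp: compact_annulus dzb_piece[OF j] dz_cut_eq_0[OF r])
  have i2: "set_integrable lborel Om (\<lambda>x. dzb piece_inf x * H x)"
  proof (rule set_integrable_support[of "annulus 0 R"])
    show "annulus 0 R \<subseteq> Om" using far_Om(1) R(2) by (auto simp: annulus_def)
    show "continuous_on Om (\<lambda>x. dzb piece_inf x * H x)" by (intro continuous_on_mult cpi cH)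
  qed (auto simp: compact_annulus dzb_piece_inf dz_cut_eq_0[OF R(2)])
  have "dzb kap0 x = (\<Sum>j\<in>J. dzb (piece j) x) + dzb piece_inf x" if "x \<in> Om" for x
    using that by (simp add: dzb_kap0 dzb_piece dzb_piece_inf)
  then have "(LINT x:Om|lborel. dzb kap0 x * H x)
      = (LINT x:Om|lborel. (\<Sum>j\<in>J. dzb (piece j) x * H x) + dzb piece_inf x * H x)"
    unfolding set_lebesgue_integral_def
    by (intro Bochner_Integration.integral_cong refl) (auto simp: indicator_def distrib_right sum_distrib_right)
  also have "\<dots> = (LINT x:Om|lborel. (\<Sum>j\<in>J. dzb (piece j) x * H x)) + (LINT x:Om|lborel. dzb piece_inf x * H x)"
    by (rule set_integral_add(2)[OF _ i2]) (use i1 in \<open>auto simp: set_integrable_def scaleR_sum_right intro!: Bochner_Integration.integrable_sum\<close>)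
  also have "(LINT x:Om|lborel. (\<Sum>j\<in>J. dzb (piece j) x * H x)) = (\<Sum>j\<in>J. LINT x:Om|lborel. dzb (piece j) x * H x)"
    unfolding set_lebesgue_integral_def scaleR_sum_right
    by (rule Bochner_Integration.integral_sum) (use i1 in \<open>auto simp: set_integrable_def\<close>)
  finally show ?thesis
    by (simp add: integral_piece integral_piece_inf sum_distrib_left sum_negf)
qed

text \<open>The summand with \<open>g\<close> is the image of \<open>g\<close> under the dual
  connection; it accounts for the choice of a representative of the second class.\<close>

lemma integral_solution:
  assumes s: "is_solution \<kappa> C" and g: "g holomorphic_on Om"
  shows "(LINT x:Om|lborel. dzb \<kappa> x * (H x + (deriv g x - A x * g x)))
    = - of_real pi * (\<Sum>j\<in>J. res j) + of_real pi * res_inf"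
proof -
  have c: "continuous_on Om H" "continuous_on Om (\<lambda>x. deriv g x - A x * g x)"
  proof -
    show "continuous_on Om H" using H Om_def by (auto intro: holomorphic_on_imp_continuous_on)
    show "continuous_on Om (\<lambda>x. deriv g x - A x * g x)"
      by (intro holomorphic_on_imp_continuous_on holomorphic_on_diff holomorphic_on_mult
          holomorphic_deriv[OF g open_Om] g A_holomorphic)
  qed
  show ?thesis
    unfolding distrib_left
      set_integral_add(2)[OF set_integrable_solution[OF s c(1)] set_integrable_solution[OF s c(2)]]
      integral_exact_zero[OF s g] integral_solution_unique[OF s is_solution_kap0] integral_kap0
    by simp
qed

end

section \<open>Even and odd parts on the curve\<close>

locale branch_points =
  fixes z :: "nat \<Rightarrow> complex"
  assumes inj: "inj_on z {..4}"
begin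

definition "base = - z ` {..4::nat}"
definition "L b x = (\<Sum>j\<le>4. b j / (x - z j))"

lemma open_base: "open base"
  unfolding base_def by (intro open_Compl finite_imp_closed finite_imageI) simp

lemma quintic_eq_0_iff: "quintic z x = 0 \<longleftrightarrow> x \<notin> base"
  unfolding quintic_def base_def by auto

lemma quintic_holomorphic: "quintic z holomorphic_on S"
  unfolding quintic_def[abs_def] by (intro holomorphic_intros)

lemma quintic_derivative:
  assumes "x \<in> base"
  shows "(quintic z has_field_derivative quintic z x * L (\<lambda>_. 1) x) (at x)"
proof -
  have nz: "x - z j \<noteq> 0" if "j \<le> 4" for j using assms that by (auto simp: base_def)
  have "(quintic z has_field_derivative (\<Sum>j\<le>4. 1 * (\<Prod>k\<in>{..4} - {j}. x - z k))) (at x)"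
    unfolding quintic_def[abs_def]
    by (rule has_field_derivative_prod) (auto intro!: derivative_eq_intros)
  moreover have "(\<Sum>j\<le>4. 1 * (\<Prod>k\<in>{..4} - {j}. x - z k)) = quintic z x * L (\<lambda>_. 1) x"
    unfolding L_def sum_distrib_left
  proof (rule sum.cong[OF refl])
    fix j :: nat assume j: "j \<in> {..4}"
    have "quintic z x = (x - z j) * (\<Prod>k\<in>{..4} - {j}. x - z k)"
      unfolding quintic_def using j by (subst prod.remove[of _ j]) auto
    then show "1 * (\<Prod>k\<in>{..4} - {j}. x - z k) = quintic z x * (1 / (x - z j))"
      using nz[of j] j by simp
  qed
  ultimately show ?thesis by simp
qed

lemma L_holomorphic: "L b holomorphic_on base"
  unfolding L_def[abs_def] base_def by (intro holomorphic_intros) auto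

lemma curveX_iff: "(x, y) \<in> curveX z \<longleftrightarrow> x \<in> base \<and> y\<^sup>2 = quintic z x"
proof -
  have "y = 0" if "y\<^sup>2 = quintic z x" "x \<notin> base" using quintic_eq_0_iff[of x] that by simp
  then show ?thesis unfolding curveX_def using quintic_eq_0_iff by (auto simp: base_def)
qed

lemma curveX_nonzero: "(x, y) \<in> curveX z \<Longrightarrow> y \<noteq> 0"
  using curveX_iff quintic_eq_0_iff by auto

lemma curveX_uminus: "(x, y) \<in> curveX z \<Longrightarrow> (x, - y) \<in> curveX z"
  by (simp add: curveX_iff)

lemma curveX_csqrt: "x \<in> base \<Longrightarrow> (x, csqrt (quintic z x)) \<in> curveX z"
  by (simp add: curveX_iff)

lemma fibre: "(x, y) \<in> curveX z \<Longrightarrow> (x, y') \<in> curveX z \<longleftrightarrow> y' = y \<or> y' = - y"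
  using power2_eq_iff[of y' y] by (auto simp: curveX_iff)

section \<open>Charts of the double covering\<close>

text \<open>The quotient has to avoid the branch cut of \<open>csqrt\<close> for
  \<open>branch p\<close> to be holomorphic; at \<open>fst p\<close> it is 1.\<close>

definition "chart_dom p = {x \<in> base. quintic z x / quintic z (fst p) \<in> - \<real>\<^sub>\<le>\<^sub>0}"
definition "branch p x = snd p * csqrt (quintic z x / quintic z (fst p))"

lemma in_chart_branch: "in_chart z g p x = g (x, branch p x)"
  by (simp add: in_chart_def branch_def)

lemma chart_dom:
  assumes p: "p \<in> curveX z"
  shows "open (chart_dom p)" "fst p \<in> chart_dom p" "chart_dom p \<subseteq> base"
proof -
  have nz: "quintic z (fst p) \<noteq> 0" "fst p \<in> base"
    using p curveX_iff[of "fst p" "snd p"] quintic_eq_0_iff by auto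
  have "continuous_on base (\<lambda>x. quintic z x / quintic z (fst p))"
    by (intro continuous_intros holomorphic_on_imp_continuous_on quintic_holomorphic) (use nz in auto)
  from continuous_open_preimage[OF this open_base, of "- \<real>\<^sub>\<le>\<^sub>0"]
  show "open (chart_dom p)"
    unfolding chart_dom_def by (simp add: vimage_def Int_def conj_commute open_Compl)
  show "fst p \<in> chart_dom p" using nz by (simp add: chart_dom_def)
  show "chart_dom p \<subseteq> base" by (auto simp: chart_dom_def)
qed

lemma branch_curveX:
  assumes "p \<in> curveX z" "x \<in> base" shows "(x, branch p x) \<in> curveX z"
proof -
  have "(snd p)\<^sup>2 = quintic z (fst p)" "quintic z (fst p) \<noteq> 0"
    using assms(1) curveX_iff[of "fst p" "snd p"] quintic_eq_0_iff by auto
  then show ?thesis using assms(2) by (simp add: curveX_iff branch_def power_mult_distrib)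
qed

lemma branch_at:
  assumes "p \<in> curveX z" shows "branch p (fst p) = snd p"
proof -
  have "quintic z (fst p) \<noteq> 0" using chart_dom(2,3)[OF assms] quintic_eq_0_iff by blast
  then show ?thesis by (simp add: branch_def)
qed

lemma branch_uminus: "branch (x, - y) = (\<lambda>t. - branch (x, y) t)"
  by (auto simp: branch_def)

lemma branch_holomorphic:
  assumes "p \<in> curveX z" shows "branch p holomorphic_on chart_dom p"
  unfolding branch_def[abs_def]
proof (intro holomorphic_on_mult holomorphic_on_const holomorphic_on_csqrt')
  show "(\<lambda>x. quintic z x / quintic z (fst p)) holomorphic_on chart_dom p"
    using chart_dom[OF assms] quintic_eq_0_iff by (intro holomorphic_intros quintic_holomorphic) auto
qed (auto simp: chart_dom_def)

text \<open>Obtained by differentiating \<open>branch^2 = quintic\<close>: half the logarithmic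
  derivative of the quintic. This is the origin of the shift \<open>1 / 2\<close> in the odd
  exponents.\<close>

lemma branch_derivative:
  assumes p: "p \<in> curveX z"
  shows "(branch p has_field_derivative snd p * L (\<lambda>_. 1 / 2) (fst p)) (at (fst p))"
proof -
  let ?x = "fst p"
  have x: "?x \<in> chart_dom p" "?x \<in> base" using chart_dom[OF p] by auto
  obtain D where D: "(branch p has_field_derivative D) (at ?x)"
    using branch_holomorphic[OF p] x chart_dom(1)[OF p] holomorphic_derivI by blast
  have y: "snd p \<noteq> 0" "(snd p)\<^sup>2 = quintic z ?x" using p curveX_nonzero curveX_iff by (metis prod.collapse)+
  have "((\<lambda>x. branch p x * branch p x) has_field_derivative D * branch p ?x + D * branch p ?x) (at ?x)"
    by (rule DERIV_mult[OF D D])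
  then have "(quintic z has_field_derivative D * branch p ?x + D * branch p ?x) (at ?x)"
    by (rule has_field_derivative_transform_within_open[OF _ open_base x(2)])
       (use branch_curveX[OF p] in \<open>auto simp: curveX_iff power2_eq_square\<close>)
  then have "D * snd p + D * snd p = quintic z ?x * L (\<lambda>_. 1) ?x"
    using DERIV_unique[OF _ quintic_derivative[OF x(2)]] branch_at[OF p] by fastforce
  then have "2 * D * snd p = (snd p * L (\<lambda>_. 1) ?x) * snd p" unfolding y(2)[symmetric] by (simp add: power2_eq_square mult.commute)
  then have "2 * D = snd p * L (\<lambda>_. 1) ?x" using y(1) by simp
  moreover have "L (\<lambda>_. 1 / 2) ?x = L (\<lambda>_. 1) ?x / 2" by (simp only: L_def sum_divide_distrib divide_divide_eq_left mult.commute)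
  moreover have "D = (2 * D) / 2" by simp
  ultimately have "D = snd p * L (\<lambda>_. 1 / 2) ?x" by (metis times_divide_eq_right)
  then show ?thesis using D by simp
qed

section \<open>Decomposition under the exchange of sheets\<close>

text \<open>\<open>csqrt\<close> jumps along its cut, but \<open>ev\<close> and \<open>od\<close> do
  not change when the root is replaced by its negative. Any local branch computes them, and they
  inherit its regularity.\<close>

definition "ev h x = (h (x, csqrt (quintic z x)) + h (x, - csqrt (quintic z x))) / (2::complex)"
definition "od h x = (h (x, csqrt (quintic z x)) - h (x, - csqrt (quintic z x))) / (2 * csqrt (quintic z x) :: complex)"

lemma ev_od:
  assumes "(x, y) \<in> curveX z"
  shows "ev h x = (h (x, y) + h (x, - y)) / 2" "od h x = (h (x, y) - h (x, - y)) / (2 * y)"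
    "h (x, y) = ev h x + y * od h x"
proof -
  have "x \<in> base" using assms curveX_iff by blast
  then have "csqrt (quintic z x) = y \<or> csqrt (quintic z x) = - y"
    using fibre[OF assms] curveX_csqrt by blast
  then show e: "ev h x = (h (x, y) + h (x, - y)) / 2" and o: "od h x = (h (x, y) - h (x, - y)) / (2 * y)"
    by (auto simp: ev_def od_def add.commute divide_simps algebra_simps)
  show "h (x, y) = ev h x + y * od h x"
    unfolding e o using curveX_nonzero[OF assms] by (simp add: field_simps)
qed

definition "parts h k0 k1 \<longleftrightarrow> (\<forall>x y. (x, y) \<in> curveX z \<longrightarrow> h (x, y) = k0 x + y * k1 x)"

lemma partsD: "parts h k0 k1 \<Longrightarrow> (x, y) \<in> curveX z \<Longrightarrow> h (x, y) = k0 x + y * k1 x"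
  by (simp add: parts_def)

lemma parts_ev_od: "parts h (ev h) (od h)"
  using ev_od(3) by (simp add: parts_def)

lemma ev_od_chart:
  assumes p: "(x0, y0) \<in> curveX z" and x: "x \<in> base"
  shows "ev h x = (in_chart z h (x0, y0) x + in_chart z h (x0, - y0) x) / 2"
    "od h x = (in_chart z h (x0, y0) x - in_chart z h (x0, - y0) x) / (2 * branch (x0, y0) x)"
  using ev_od(1,2)[OF branch_curveX[OF p x], of h] by (simp_all add: in_chart_branch branch_uminus)

text \<open>Smoothness on the curve is given around each point separately, so both points of the
  fibre over \<open>x0\<close> are used, on the intersection of their neighbourhoods.\<close>

lemma smooth_on_ev_od:
  assumes h: "smooth_onX z h"
  shows "smooth_on base (ev h)" "smooth_on base (od h)"
proof -
  have loc: "\<exists>V. open V \<and> x0 \<in> V \<and> smooth_on V (ev h) \<and> smooth_on V (od h)" if x0: "x0 \<in> base" for x0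
  proof -
    define y0 where "y0 = csqrt (quintic z x0)"
    have p: "(x0, y0) \<in> curveX z" "(x0, - y0) \<in> curveX z"
      using curveX_csqrt[OF x0] curveX_uminus by (auto simp: y0_def)
    obtain U1 where U1: "open U1" "x0 \<in> U1" "smooth_on U1 (in_chart z h (x0, y0))"
      using h p(1) unfolding smooth_onX_def smooth_on_def by fastforce
    obtain U2 where U2: "open U2" "x0 \<in> U2" "smooth_on U2 (in_chart z h (x0, - y0))"
      using h p(2) unfolding smooth_onX_def smooth_on_def by fastforce
    let ?V = "U1 \<inter> U2 \<inter> chart_dom (x0, y0)"
    have V: "open ?V" "x0 \<in> ?V" "?V \<subseteq> base" using U1 U2 chart_dom[OF p(1)] by auto
    have s: "smooth_on ?V (in_chart z h (x0, y0))" "smooth_on ?V (in_chart z h (x0, - y0))"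
      by (rule smooth_on_subset[OF U1(3)], blast, rule smooth_on_subset[OF U2(3)], blast)
    have b: "smooth_on ?V (branch (x0, y0))"
      by (rule smooth_on_subset[OF smooth_on_holomorphic[OF chart_dom(1)[OF p(1)] branch_holomorphic[OF p(1)]]]) blast
    have nz: "branch (x0, y0) x \<noteq> 0" if "x \<in> base" for x
      using curveX_nonzero[OF branch_curveX[OF p(1) that]] .
    have "smooth_on ?V (\<lambda>x. (in_chart z h (x0, y0) x + in_chart z h (x0, - y0) x) / 2)"
      by (intro smooth_on_divide smooth_on_add smooth_on_const s V) auto
    moreover have "smooth_on ?V (\<lambda>x. (in_chart z h (x0, y0) x - in_chart z h (x0, - y0) x) / (2 * branch (x0, y0) x))"
      by (intro smooth_on_divide smooth_on_diff smooth_on_mult smooth_on_const s b V) (use nz V(3) in auto)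
    ultimately have "smooth_on ?V (ev h)" "smooth_on ?V (od h)"
      by (auto intro: smooth_on_cong[OF V(1)] ev_od_chart[OF p(1) subsetD[OF V(3)], symmetric])
    then show ?thesis using V(1,2) by blast
  qed
  show "smooth_on base (ev h)" "smooth_on base (od h)"
    by (rule smooth_on_local, use loc in blast)+
qed

lemma regular_fun_ev_od:
  assumes g: "regular_fun z g"
  shows "ev g holomorphic_on base" "od g holomorphic_on base"
proof -
  obtain P n where P: "\<And>x y. (x, y) \<in> curveX z \<Longrightarrow> g (x, y) = poly (poly P [:y:]) x / y ^ n"
    using g unfolding regular_fun_def by blast
  have hol: "(\<lambda>x. poly (poly P [:s x:]) x) holomorphic_on S"
    if "s holomorphic_on S" for s and S :: "complex set" and P :: "complex poly poly"
  proof (induction P)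
    case (pCons a P)
    have "(\<lambda>x. poly a x + s x * poly (poly P [:s x:]) x) holomorphic_on S"
      by (intro holomorphic_intros that pCons)
    then show ?case by simp
  qed simp
  have loc: "\<exists>V. open V \<and> x0 \<in> V \<and> V \<subseteq> base \<and> ev g holomorphic_on V \<and> od g holomorphic_on V" if x0: "x0 \<in> base" for x0
  proof -
    define y0 where "y0 = csqrt (quintic z x0)"
    have p: "(x0, y0) \<in> curveX z" "(x0, - y0) \<in> curveX z"
      using curveX_csqrt[OF x0] curveX_uminus by (auto simp: y0_def)
    let ?V = "chart_dom (x0, y0)"
    note V = chart_dom[OF p(1)]
    note b = branch_holomorphic[OF p(1)]
    have b': "branch (x0, - y0) holomorphic_on ?V" unfolding branch_uminus by (intro holomorphic_intros b)
    have nz: "branch (x0, y0) x \<noteq> 0" "branch (x0, - y0) x \<noteq> 0" if "x \<in> base" for x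
      using curveX_nonzero[OF branch_curveX[OF p(1) that]] curveX_nonzero[OF branch_curveX[OF p(2) that]] by auto
    have c: "in_chart z g (x0, y0) x = poly (poly P [:branch (x0, y0) x:]) x / branch (x0, y0) x ^ n"
      "in_chart z g (x0, - y0) x = poly (poly P [:branch (x0, - y0) x:]) x / branch (x0, - y0) x ^ n"
      if "x \<in> ?V" for x
      using P branch_curveX[OF p(1)] branch_curveX[OF p(2)] V(3) that by (auto simp: in_chart_branch)
    have s: "(\<lambda>x. in_chart z g (x0, y0) x) holomorphic_on ?V" "(\<lambda>x. in_chart z g (x0, - y0) x) holomorphic_on ?V"
    proof -
      have "(\<lambda>x. poly (poly P [:branch (x0, y0) x:]) x / branch (x0, y0) x ^ n) holomorphic_on ?V"
        by (intro holomorphic_intros hol b) (use nz V(3) in auto)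
      then show "(\<lambda>x. in_chart z g (x0, y0) x) holomorphic_on ?V"
        by (rule holomorphic_transform) (simp add: c)
      have "(\<lambda>x. poly (poly P [:branch (x0, - y0) x:]) x / branch (x0, - y0) x ^ n) holomorphic_on ?V"
        by (intro holomorphic_intros hol b') (use nz V(3) in auto)
      then show "(\<lambda>x. in_chart z g (x0, - y0) x) holomorphic_on ?V"
        by (rule holomorphic_transform) (simp add: c)
    qed
    have "(\<lambda>x. (in_chart z g (x0, y0) x + in_chart z g (x0, - y0) x) / 2) holomorphic_on ?V"
      by (intro holomorphic_intros s) auto
    moreover have "(\<lambda>x. (in_chart z g (x0, y0) x - in_chart z g (x0, - y0) x) / (2 * branch (x0, y0) x)) holomorphic_on ?V"
      by (intro holomorphic_intros s b) (use nz V(3) in auto)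
    ultimately have "ev g holomorphic_on ?V" "od g holomorphic_on ?V"
      by (auto intro: holomorphic_transform ev_od_chart[OF p(1) subsetD[OF V(3)], symmetric])
    then show ?thesis using V by (intro exI[of _ ?V]) auto
  qed
  have "\<exists>f'. (ev g has_field_derivative f') (at x)" "\<exists>f'. (od g has_field_derivative f') (at x)" if "x \<in> base" for x
    using loc[OF that] holomorphic_on_open by (metis, metis)
  then show "ev g holomorphic_on base" "od g holomorphic_on base"
    by (auto simp: holomorphic_on_open[OF open_base])
qed

lemma smooth_on_chart:
  assumes p: "p \<in> curveX z" and h: "parts h k0 k1"
    and k: "smooth_on base k0" "smooth_on base k1"
  shows "smooth_on (chart_dom p) (in_chart z h p)"
proof (rule smooth_on_cong[OF chart_dom(1)[OF p]])
  show "smooth_on (chart_dom p) (\<lambda>x. k0 x + branch p x * k1 x)"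
    by (intro smooth_on_add smooth_on_mult smooth_on_holomorphic branch_holomorphic p chart_dom(1)
        smooth_on_subset[OF k(1) chart_dom(3)] smooth_on_subset[OF k(2) chart_dom(3)])
  fix x assume "x \<in> chart_dom p"
  then show "k0 x + branch p x * k1 x = in_chart z h p x"
    using partsD[OF h] branch_curveX[OF p] chart_dom(3)[OF p] by (auto simp: in_chart_branch)
qed

lemma ext_d_even_odd:
  assumes p: "(x, y) \<in> curveX z" and h: "parts h k0 k1"
    and k: "smooth_on base k0" "smooth_on base k1"
  shows "ext_d z h (x, y) = (dz k0 x + y * (dz k1 x + L (\<lambda>_. 1 / 2) x * k1 x), dzb k0 x + y * dzb k1 x)"
proof -
  note V = chart_dom[OF p, simplified]
  have xb: "x \<in> base" using V by auto
  have d: "k0 differentiable (at x)" "k1 differentiable (at x)"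
    using k xb smooth_on_imp_differentiable by blast+
  have b: "(branch (x, y) has_field_derivative y * L (\<lambda>_. 1 / 2) x) (at x)"
    using branch_derivative[OF p] by simp
  have bd: "branch (x, y) differentiable (at x)"
    using b by (auto simp: differentiable_def has_field_derivative_def)
  have e: "k0 t + branch (x, y) t * k1 t = in_chart z h (x, y) t" if "t \<in> chart_dom (x, y)" for t
    using partsD[OF h] branch_curveX[OF p] V(3) that by (auto simp: in_chart_branch)
  have "(\<lambda>t. k0 t + branch (x, y) t * k1 t) differentiable (at x)"
    by (intro differentiable_add differentiable_mult d bd)
  note c = dz_cong[OF V(1,2) e this]
  have "ext_d z h (x, y) = (dz (in_chart z h (x, y)) x, dzb (in_chart z h (x, y)) x)"
    by (simp add: ext_d_def Let_def dz_def dzb_def)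
  also have "\<dots> = (dz k0 x + y * (dz k1 x + L (\<lambda>_. 1 / 2) x * k1 x), dzb k0 x + y * dzb k1 x)"
    using branch_at[OF p] by (simp add: c dz_add dz_mult d bd differentiable_mult dz_field_derivative[OF b] algebra_simps)
  finally show ?thesis .
qed

text \<open>Even and odd parts decouple. Under the dual connection the odd exponent is
  \<open>1 / 2 - 2 * c j\<close>, not the negative of \<open>2 * c j + 1 / 2\<close>; the
  discrepancy is the logarithmic derivative of \<open>quintic\<close>.\<close>

lemma nabla_even_odd:
  assumes p: "(x, y) \<in> curveX z" and h: "parts h k0 k1"
    and k: "smooth_on base k0" "smooth_on base k1"
  shows "nabla z c h (x, y) =
      (dz k0 x + L (\<lambda>j. 2 * c j) x * k0 x + y * (dz k1 x + L (\<lambda>j. 2 * c j + 1 / 2) x * k1 x),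
       dzb k0 x + y * dzb k1 x)"
    and "nabla_dual z c h (x, y) =
      (dz k0 x - L (\<lambda>j. 2 * c j) x * k0 x + y * (dz k1 x + (L (\<lambda>_. 1 / 2) x - L (\<lambda>j. 2 * c j) x) * k1 x),
       dzb k0 x + y * dzb k1 x)"
proof -
  have "L (\<lambda>j. 2 * c j + 1 / 2) x = L (\<lambda>j. 2 * c j) x + L (\<lambda>_. 1 / 2) x"
    unfolding L_def by (simp add: add_divide_distrib sum.distrib)
  then show "nabla z c h (x, y) =
      (dz k0 x + L (\<lambda>j. 2 * c j) x * k0 x + y * (dz k1 x + L (\<lambda>j. 2 * c j + 1 / 2) x * k1 x),
       dzb k0 x + y * dzb k1 x)"
    unfolding nabla_def ext_d_even_odd[OF p h k] dlogT_def dx_form_def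
    unfolding L_def[of "\<lambda>j. 2 * c j", symmetric] by (simp add: partsD[OF h p] algebra_simps)
  show "nabla_dual z c h (x, y) =
      (dz k0 x - L (\<lambda>j. 2 * c j) x * k0 x + y * (dz k1 x + (L (\<lambda>_. 1 / 2) x - L (\<lambda>j. 2 * c j) x) * k1 x),
       dzb k0 x + y * dzb k1 x)"
    unfolding nabla_dual_def ext_d_even_odd[OF p h k] dlogT_def dx_form_def
    unfolding L_def[of "\<lambda>j. 2 * c j", symmetric] by (simp add: partsD[OF h p] algebra_simps)
qed

section \<open>Reduction of the intersection form to the plane\<close>

definition planar_solution :: "(nat \<Rightarrow> complex) \<Rightarrow> (complex \<Rightarrow> complex) \<Rightarrow> (complex \<Rightarrow> complex) \<Rightarrow> complex set \<Rightarrow> bool" where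
  "planar_solution b F \<kappa> C \<longleftrightarrow> smooth_on base \<kappa> \<and> compact C \<and> C \<subseteq> base \<and>
     (\<forall>x\<in>base - C. dzb \<kappa> x = 0 \<and> dz \<kappa> x + L b x * \<kappa> x = F x)"

text \<open>Existence of a solution, and independence of it and of \<open>g\<close>, are built in,
  because they are what the description operator in \<open>intersection_form\<close> asks
  for.\<close>

definition planar_value :: "(nat \<Rightarrow> complex) \<Rightarrow> (complex \<Rightarrow> complex) \<Rightarrow> (complex \<Rightarrow> complex) \<Rightarrow> complex \<Rightarrow> bool" where
  "planar_value b F H v \<longleftrightarrow> F holomorphic_on base \<and> H holomorphic_on base \<and> (\<exists>\<kappa> C. planar_solution b F \<kappa> C) \<and>
     (\<forall>\<kappa> C g. planar_solution b F \<kappa> C \<longrightarrow> g holomorphic_on base \<longrightarrow>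
        (LINT x:base|lborel. dzb \<kappa> x * (H x + (deriv g x - L b x * g x))) = v)"

lemma even_odd_zero:
  fixes u v y :: complex
  assumes "u + y * v = 0" "u - y * v = 0" "y \<noteq> 0"
  shows "u = 0" "v = 0"
proof -
  have "2 * u = (u + y * v) + (u - y * v)" "2 * (y * v) = (u + y * v) - (u - y * v)" by simp_all
  then show "u = 0" "v = 0" using assms by simp_all
qed

lemma planar_solution_of_reg:
  assumes h: "parts h k0 k1"
    and k: "smooth_on base k0" "smooth_on base k1"
    and \<phi>: "\<And>x y. (x, y) \<in> curveX z \<Longrightarrow> \<phi> (x, y) = (F0 x + y * F1 x, 0)"
    and \<rho>: "\<And>p. p \<in> curveX z \<Longrightarrow> \<rho> p = \<phi> p - nabla z c h p" and supp: "compact_supp z \<rho>"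
  obtains C where "planar_solution (\<lambda>j. 2 * c j) F0 k0 C" "planar_solution (\<lambda>j. 2 * c j + 1 / 2) F1 k1 C"
proof -
  obtain K where K: "compact K" "K \<subseteq> curveX z" "\<And>p. p \<in> curveX z - K \<Longrightarrow> \<rho> p = (0, 0)"
    using supp unfolding compact_supp_def by blast
  have C: "compact (fst ` K)" "fst ` K \<subseteq> base"
    using K(1,2) curveX_iff by (auto intro!: compact_continuous_image continuous_intros)
  have "dzb k0 x = 0 \<and> dz k0 x + L (\<lambda>j. 2 * c j) x * k0 x = F0 x \<and>
      dzb k1 x = 0 \<and> dz k1 x + L (\<lambda>j. 2 * c j + 1 / 2) x * k1 x = F1 x"
    if x: "x \<in> base - fst ` K" for x
  proof -
    define y where "y = csqrt (quintic z x)"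
    have p: "(x, y) \<in> curveX z" "(x, - y) \<in> curveX z"
      using curveX_csqrt curveX_uminus x by (auto simp: y_def)
    have y: "y \<noteq> 0" by (rule curveX_nonzero[OF p(1)])
    \<comment> \<open>Both points of the fibre lie outside \<open>K\<close>; sum and difference of
      the two vanishing conditions separate even from odd part.\<close>
    have "(x, y) \<notin> K" "(x, - y) \<notin> K" using x by force+
    then have z: "\<rho> (x, y) = (0, 0)" "\<rho> (x, - y) = (0, 0)" using K(3) p by auto
    let ?u = "F0 x - (dz k0 x + L (\<lambda>j. 2 * c j) x * k0 x)"
    let ?v = "F1 x - (dz k1 x + L (\<lambda>j. 2 * c j + 1 / 2) x * k1 x)"
    have r: "\<rho> (x, y') = (?u + y' * ?v, - (dzb k0 x + y' * dzb k1 x))" if "(x, y') \<in> curveX z" for y'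
      unfolding \<rho>[OF that] \<phi>[OF that] nabla_even_odd(1)[OF that h k] by (simp add: algebra_simps)
    have "?u + y * ?v = 0 \<and> dzb k0 x + y * dzb k1 x = 0"
      using z(1) unfolding r[OF p(1)] prod.inject neg_equal_0_iff_equal .
    then have 1: "?u + y * ?v = 0" "dzb k0 x + y * dzb k1 x = 0" by blast+
    have "?u + - y * ?v = 0 \<and> dzb k0 x + - y * dzb k1 x = 0"
      using z(2) unfolding r[OF p(2)] prod.inject neg_equal_0_iff_equal .
    then have 2: "?u - y * ?v = 0" "dzb k0 x - y * dzb k1 x = 0" by simp_all
    show ?thesis using even_odd_zero[OF 1(1) 2(1) y] even_odd_zero[OF 1(2) 2(2) y] by simp
  qed
  then show thesis
    using that[of "fst ` K"] C k unfolding planar_solution_def by blast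
qed

lemma in_chart_Pair:
  "in_chart z g p = (\<lambda>x. (in_chart z (\<lambda>p. fst (g p)) p x, in_chart z (\<lambda>p. snd (g p)) p x))"
  by (auto simp: in_chart_def)

lemma reg_of_planar_solution:
  assumes k: "planar_solution (\<lambda>j. 2 * c j) F0 k0 C0" "planar_solution (\<lambda>j. 2 * c j + 1 / 2) F1 k1 C1"
    and F: "F0 holomorphic_on base" "F1 holomorphic_on base"
    and \<phi>: "\<And>x y. (x, y) \<in> curveX z \<Longrightarrow> \<phi> (x, y) = (F0 x + y * F1 x, 0)"
  shows "is_reg z c \<phi> (\<lambda>p. \<phi> p - nabla z c (\<lambda>(x, y). k0 x + y * k1 x) p)"
    (is "is_reg z c \<phi> ?\<rho>")
proof -
  let ?h = "\<lambda>(x, y). k0 x + y * k1 x"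
  have s: "smooth_on base k0" "smooth_on base k1" and C: "compact C0" "compact C1" "C0 \<subseteq> base" "C1 \<subseteq> base"
    using k by (auto simp: planar_solution_def)
  have hp: "parts ?h k0 k1" by (simp add: parts_def)
  let ?u = "\<lambda>x. F0 x - (dz k0 x + L (\<lambda>j. 2 * c j) x * k0 x)"
  let ?v = "\<lambda>x. F1 x - (dz k1 x + L (\<lambda>j. 2 * c j + 1 / 2) x * k1 x)"
  let ?u' = "\<lambda>x. - dzb k0 x" and ?v' = "\<lambda>x. - dzb k1 x"
  have \<rho>: "?\<rho> (x, y) = (?u x + y * ?v x, ?u' x + y * ?v' x)" if p: "(x, y) \<in> curveX z" for x y
    unfolding \<phi>[OF p] nabla_even_odd(1)[OF p hp s] by (simp add: algebra_simps)
  have su: "smooth_on base ?u" "smooth_on base ?v" "smooth_on base ?u'" "smooth_on base ?v'"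
    by (intro smooth_on_diff smooth_on_add smooth_on_mult smooth_on_uminus smooth_on_dz smooth_on_dzb
        smooth_on_holomorphic[OF open_base L_holomorphic] smooth_on_holomorphic[OF open_base F(1)]
        smooth_on_holomorphic[OF open_base F(2)] open_base s)+
  have "smooth_onX z ?\<rho>"
    unfolding smooth_onX_def
  proof (intro ballI exI conjI allI)
    fix p k assume p: "p \<in> curveX z"
    show "open (chart_dom p)" "fst p \<in> chart_dom p" by (rule chart_dom[OF p])+
    have "smooth_on (chart_dom p) (\<lambda>x. (in_chart z (\<lambda>p. fst (?\<rho> p)) p x, in_chart z (\<lambda>p. snd (?\<rho> p)) p x))"
    proof (rule smooth_on_Pair[OF chart_dom(1)[OF p]])
      show "smooth_on (chart_dom p) (in_chart z (\<lambda>p. fst (?\<rho> p)) p)"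
        by (rule smooth_on_chart[OF p _ su(1,2)], unfold parts_def, intro allI impI) (simp only: \<rho> fst_conv)
      show "smooth_on (chart_dom p) (in_chart z (\<lambda>p. snd (?\<rho> p)) p)"
        by (rule smooth_on_chart[OF p _ su(3,4)], unfold parts_def, intro allI impI) (simp only: \<rho> snd_conv)
    qed
    then show "Ck_on k (chart_dom p) (in_chart z ?\<rho> p)"
      unfolding in_chart_Pair[of ?\<rho> p] by (rule smooth_onD)
  qed
  moreover have "compact_supp z ?\<rho>"
    unfolding compact_supp_def
  proof (intro exI conjI ballI)
    let ?C = "C0 \<union> C1"
    \<comment> \<open>The full preimage of \<open>?C\<close> in the curve. It is bounded, because a
      bound for \<open>quintic\<close> on \<open>?C\<close> bounds \<open>y\<close>.\<close>
    let ?K = "{p. fst p \<in> ?C \<and> (snd p)\<^sup>2 = quintic z (fst p)}"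
    have cC: "compact ?C" using C by auto
    have "compact (quintic z ` ?C)"
      by (intro compact_continuous_image cC holomorphic_on_imp_continuous_on quintic_holomorphic)
    then obtain B where B: "\<And>x. x \<in> ?C \<Longrightarrow> norm (quintic z x) \<le> B"
      using compact_imp_bounded[of "quintic z ` ?C"] unfolding bounded_iff by blast
    have "?K = ?C \<times> cball 0 (sqrt B) \<inter> {p. (snd p)\<^sup>2 = quintic z (fst p)}"
    proof (intro equalityI subsetI IntI)
      fix p assume p: "p \<in> ?K"
      then have "(norm (snd p))\<^sup>2 \<le> B" using B[of "fst p"] by (metis (mono_tags, lifting) mem_Collect_eq norm_power)
      then have "norm (snd p) \<le> sqrt B" by (rule real_le_rsqrt)
      then show "p \<in> ?C \<times> cball 0 (sqrt B)" using p by (auto simp: mem_Times_iff)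
    qed auto
    moreover have "closed {p. (snd p)\<^sup>2 = quintic z (fst p)}"
      unfolding quintic_def by (intro closed_Collect_eq continuous_intros)
    ultimately show "compact ?K"
      by (simp only:) (intro compact_Int_closed compact_Times cC compact_cball)
    show "?K \<subseteq> curveX z" using C curveX_iff by auto
    fix p assume p: "p \<in> curveX z - ?K"
    obtain x y where xy: "p = (x, y)" by (cases p)
    have "x \<in> base - C0" "x \<in> base - C1" using p curveX_iff unfolding xy by auto
    then have "?u x = 0" "?v x = 0" "?u' x = 0" "?v' x = 0"
      using k by (auto simp: planar_solution_def)
    moreover have "?\<rho> p = (?u x + y * ?v x, ?u' x + y * ?v' x)"
      using \<rho>[of x y] p unfolding xy by blast
    ultimately show "?\<rho> p = (0, 0)" by simp
  qed
  moreover have "smooth_onX z ?h"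
    unfolding smooth_onX_def
  proof (intro ballI exI conjI allI)
    fix p k assume p: "p \<in> curveX z"
    show "open (chart_dom p)" "fst p \<in> chart_dom p" by (rule chart_dom[OF p])+
    show "Ck_on k (chart_dom p) (in_chart z ?h p)" by (rule smooth_onD[OF smooth_on_chart[OF p hp s]])
  qed
  ultimately show ?thesis unfolding is_reg_def by blast
qed

text \<open>The two sheets together give twice the even part \<open>S\<close>, and the area form
  contributes \<open>-2 * \<i>\<close>.\<close>

lemma integralX_even_odd:
  assumes F: "\<And>x y. (x, y) \<in> curveX z \<Longrightarrow> F (x, y) + F (x, - y) = 2 * S x"
  shows "integralX z F = - 4 * \<i> * (LINT x:base|lborel. S x)"
proof -
  have "(\<Sum>y\<in>{y. (x, y) \<in> curveX z}. - 2 * \<i> * F (x, y)) = - 4 * \<i> * (indicat_real base x *\<^sub>R S x)" for x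
  proof (cases "x \<in> base")
    case True
    define y where "y = csqrt (quintic z x)"
    have p: "(x, y) \<in> curveX z" using curveX_csqrt[OF True] by (simp add: y_def)
    have "{y. (x, y) \<in> curveX z} = {y, - y}" using fibre[OF p] by auto
    moreover have "y \<noteq> - y" using curveX_nonzero[OF p] by auto
    ultimately have "(\<Sum>y\<in>{y. (x, y) \<in> curveX z}. - 2 * \<i> * F (x, y)) = - 2 * \<i> * (F (x, y) + F (x, - y))"
      by (simp add: distrib_left)
    then show ?thesis using True by (simp add: F[OF p])
  next
    case False
    then have "{y. (x, y) \<in> curveX z} = {}" using curveX_iff by auto
    then show ?thesis using False by simp
  qed
  then show ?thesis unfolding integralX_def set_lebesgue_integral_def by (simp only: integral_mult_right_zero)
qed

lemma set_integrable_planar_solution: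
  assumes "planar_solution b F \<kappa> C" "continuous_on base h"
  shows "set_integrable lborel base (\<lambda>x. dzb \<kappa> x * h x)"
proof (rule set_integrable_support[of C])
  show "continuous_on base (\<lambda>x. dzb \<kappa> x * h x)"
    using assms smooth_on_imp_continuous_on[OF smooth_on_dzb[OF open_base]] unfolding planar_solution_def
    by (intro continuous_on_mult) auto
qed (use assms in \<open>auto simp: planar_solution_def\<close>)

text \<open>The odd part of \<open>\<phi>'\<close> is written \<open>N1 / y\<close> rather than \<open>y N\<close>: the resulting factor \<open>quintic z\<close>
  in the exact terms changes their exponents to the ones dual to those of the odd part of \<open>h\<close>.\<close>

lemma intersection_form_value:
  assumes reg: "regular_form z \<phi>" "regular_form z \<phi>'"
    and \<phi>: "\<And>x y. (x, y) \<in> curveX z \<Longrightarrow> \<phi> (x, y) = (F0 x + y * F1 x, 0)"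
    and \<phi>': "\<And>x y. (x, y) \<in> curveX z \<Longrightarrow> \<phi>' (x, y) = (N0 x + N1 x / y, 0)"
    and v: "planar_value (\<lambda>j. 2 * c j) F0 N0 v0" "planar_value (\<lambda>j. 2 * c j + 1 / 2) F1 N1 v1"
  shows "intersection_form z c (cls z (nabla z c) \<phi>) (cls z (nabla_dual z c) \<phi>') = - 4 * \<i> * (v0 + v1)"
  unfolding intersection_form_def
proof (rule the_equality)
  have hol: "F0 holomorphic_on base" "F1 holomorphic_on base" "N0 holomorphic_on base" "N1 holomorphic_on base"
    using v by (auto simp: planar_value_def)
  \<comment> \<open>The zero function witnesses that each form lies in its own class.\<close>
  have zero: "regular_fun z (\<lambda>p. 0)" unfolding regular_fun_def by (intro exI[of _ 0]) auto
  have "nabla z c (\<lambda>p. 0) (x, y) = 0" "nabla_dual z c (\<lambda>p. 0) (x, y) = 0" if "(x, y) \<in> curveX z" for x y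
    using nabla_even_odd[OF that, of "\<lambda>p. 0" "\<lambda>x. 0" "\<lambda>x. 0" c] by (simp_all add: parts_def smooth_on_const zero_prod_def)
  then have mem: "\<phi> \<in> cls z (nabla z c) \<phi>" "\<phi>' \<in> cls z (nabla_dual z c) \<phi>'"
    unfolding cls_def cohomologous_def using reg zero by (fastforce simp: Image_def)+
  have key: "w = - 4 * \<i> * (v0 + v1)"
    if w: "\<exists>\<psi>\<in>cls z (nabla z c) \<phi>. \<exists>\<psi>'\<in>cls z (nabla_dual z c) \<phi>'. \<exists>\<rho>. is_reg z c \<psi> \<rho> \<and> w = integralX z (wedge \<rho> \<psi>')"
    for w
  proof -
    obtain \<psi> \<psi>' \<rho> where 1: "\<psi> \<in> cls z (nabla z c) \<phi>" "\<psi>' \<in> cls z (nabla_dual z c) \<phi>'" "is_reg z c \<psi> \<rho>"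
      and weq: "w = integralX z (wedge \<rho> \<psi>')" using w by blast
    obtain g where g: "regular_fun z g" "\<And>p. p \<in> curveX z \<Longrightarrow> \<psi> p = \<phi> p + nabla z c g p"
      using 1(1) unfolding cls_def cohomologous_def by auto
    obtain g' where g': "regular_fun z g'" "\<And>p. p \<in> curveX z \<Longrightarrow> \<psi>' p = \<phi>' p + nabla_dual z c g' p"
      using 1(2) unfolding cls_def cohomologous_def by auto
    obtain h where h: "smooth_onX z h" "\<And>p. p \<in> curveX z \<Longrightarrow> \<rho> p = \<psi> p - nabla z c h p"
      and supp: "compact_supp z \<rho>" using 1(3) unfolding is_reg_def by blast
    have sg: "smooth_on base (ev g)" "smooth_on base (od g)"
      by (rule smooth_on_holomorphic[OF open_base], rule regular_fun_ev_od[OF g(1)])+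
    have hg': "ev g' holomorphic_on base" "od g' holomorphic_on base" by (rule regular_fun_ev_od[OF g'(1)])+
    have sg': "smooth_on base (ev g')" "smooth_on base (od g')"
      by (rule smooth_on_holomorphic[OF open_base], rule hg')+
    note sh = smooth_on_ev_od[OF h(1)]
    \<comment> \<open>The exact difference of \<open>\<psi>\<close> and \<open>\<phi>\<close> is
      absorbed into the regularizing function, so that \<open>\<rho>\<close> becomes a
      regularization of \<open>\<phi>\<close> itself.\<close>
    let ?ke = "\<lambda>x. ev h x - ev g x" and ?ko = "\<lambda>x. od h x - od g x"
    let ?hh = "\<lambda>(x, y). ?ke x + y * ?ko x"
    have sk: "smooth_on base ?ke" "smooth_on base ?ko" by (intro smooth_on_diff open_base sh sg)+
    have kk: "parts ?hh ?ke ?ko" by (simp add: parts_def)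
    have \<rho>: "\<rho> p = \<phi> p - nabla z c ?hh p" if p: "p \<in> curveX z" for p
    proof -
      obtain x y where xy: "p = (x, y)" by (cases p)
      have pc: "(x, y) \<in> curveX z" using p xy by simp
      have xb: "x \<in> base" using pc curveX_iff by blast
      have d: "ev h differentiable (at x)" "od h differentiable (at x)" "ev g differentiable (at x)" "od g differentiable (at x)"
        using smooth_on_imp_differentiable[OF _ xb] sh sg by auto
      have "\<rho> p = \<phi> p + nabla z c g p - nabla z c h p" using h(2)[OF p] g(2)[OF p] by simp
      also have "\<dots> = \<phi> p - nabla z c ?hh p"
        unfolding xy nabla_even_odd(1)[OF pc parts_ev_od sg] nabla_even_odd(1)[OF pc parts_ev_od sh]
          nabla_even_odd(1)[OF pc kk sk] dz_diff[OF d(1,3)] dz_diff[OF d(2,4)]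
        by (cases "\<phi> (x, y)") (simp add: algebra_simps)
      finally show ?thesis .
    qed
    obtain C where C: "planar_solution (\<lambda>j. 2 * c j) F0 ?ke C" "planar_solution (\<lambda>j. 2 * c j + 1 / 2) F1 ?ko C"
      using planar_solution_of_reg[OF kk sk \<phi> \<rho> supp] by blast
    let ?Ge = "ev g'" and ?Go = "\<lambda>x. quintic z x * od g' x"
    have hG: "?Ge holomorphic_on base" "?Go holomorphic_on base"
      by (intro holomorphic_intros quintic_holomorphic hg')+
    let ?We = "\<lambda>x. N0 x + (deriv ?Ge x - L (\<lambda>j. 2 * c j) x * ?Ge x)"
    let ?Wo = "\<lambda>x. N1 x + (deriv ?Go x - L (\<lambda>j. 2 * c j + 1 / 2) x * ?Go x)"
    have fst\<psi>': "fst (\<psi>' (x, y)) = ?We x + ?Wo x / y" if p: "(x, y) \<in> curveX z" for x y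
    proof -
      have xb: "x \<in> base" and yy: "y\<^sup>2 = quintic z x" "y \<noteq> 0" using p curveX_iff curveX_nonzero by auto
      have d0: "dz (ev g') x = deriv (ev g') x" "dz (od g') x = deriv (od g') x"
        using dz_field_derivative[OF holomorphic_derivI[OF hg'(1) open_base xb]]
          dz_field_derivative[OF holomorphic_derivI[OF hg'(2) open_base xb]] by auto
      have d1: "deriv ?Go x = quintic z x * L (\<lambda>_. 1) x * od g' x + deriv (od g') x * quintic z x"
        by (rule DERIV_imp_deriv[OF DERIV_mult[OF quintic_derivative[OF xb] holomorphic_derivI[OF hg'(2) open_base xb]]])
      have L1: "L (\<lambda>j. 2 * c j + 1 / 2) x = L (\<lambda>j. 2 * c j) x + L (\<lambda>_. 1 / 2) x"
        unfolding L_def by (simp add: add_divide_distrib sum.distrib)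
      have L2: "L (\<lambda>_. 1) x = 2 * L (\<lambda>_. 1 / 2) x"
        unfolding L_def sum_distrib_left by (simp only: times_divide_eq_right) simp
      have "?Wo x / y = N1 x / y + y * (deriv (od g') x + (L (\<lambda>_. 1 / 2) x - L (\<lambda>j. 2 * c j) x) * od g' x)"
        unfolding d1 L1 L2 yy(1)[symmetric] using yy(2) by (simp add: field_simps power2_eq_square)
      then show ?thesis
        unfolding g'(2)[OF p] \<phi>'[OF p] nabla_even_odd(2)[OF p parts_ev_od sg'] d0
        by (simp add: algebra_simps)
    qed
    have snd\<rho>: "snd (\<rho> (x, y)) = - (dzb ?ke x + y * dzb ?ko x)" if p: "(x, y) \<in> curveX z" for x y
      unfolding \<rho>[OF p] \<phi>[OF p] nabla_even_odd(1)[OF p kk sk] by simp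
    have snd\<psi>': "snd (\<psi>' (x, y)) = 0" if p: "(x, y) \<in> curveX z" for x y
    proof -
      have "x \<in> base" using p curveX_iff by blast
      then have "dzb (ev g') x = 0" "dzb (od g') x = 0"
        using dz_field_derivative(2)[OF holomorphic_derivI[OF _ open_base]] hg' by auto
      then show ?thesis unfolding g'(2)[OF p] \<phi>'[OF p] nabla_even_odd(2)[OF p parts_ev_od sg'] by simp
    qed
    have "w = - 4 * \<i> * (LINT x:base|lborel. dzb ?ke x * ?We x + dzb ?ko x * ?Wo x)"
      unfolding weq
    proof (rule integralX_even_odd)
      fix x y assume p: "(x, y) \<in> curveX z"
      show "wedge \<rho> \<psi>' (x, y) + wedge \<rho> \<psi>' (x, - y) = 2 * (dzb ?ke x * ?We x + dzb ?ko x * ?Wo x)"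
        unfolding wedge_def snd\<rho>[OF p] snd\<rho>[OF curveX_uminus[OF p]] fst\<psi>'[OF p] fst\<psi>'[OF curveX_uminus[OF p]]
          snd\<psi>'[OF p] snd\<psi>'[OF curveX_uminus[OF p]]
        using curveX_nonzero[OF p] by (simp add: field_simps)
    qed
    also have "(LINT x:base|lborel. dzb ?ke x * ?We x + dzb ?ko x * ?Wo x)
        = (LINT x:base|lborel. dzb ?ke x * ?We x) + (LINT x:base|lborel. dzb ?ko x * ?Wo x)"
      by (rule set_integral_add(2); rule set_integrable_planar_solution, rule C)
        (intro continuous_intros holomorphic_on_imp_continuous_on hol hG L_holomorphic
          holomorphic_deriv[OF _ open_base])+
    also have "(LINT x:base|lborel. dzb ?ke x * ?We x) = v0"
      using v(1) C(1) hG(1) unfolding planar_value_def by blast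
    also have "(LINT x:base|lborel. dzb ?ko x * ?Wo x) = v1"
      using v(2) C(2) hG(2) unfolding planar_value_def by blast
    finally show ?thesis .
  qed
  then show "w = - 4 * \<i> * (v0 + v1)"
    if "\<exists>\<psi>\<in>cls z (nabla z c) \<phi>. \<exists>\<psi>'\<in>cls z (nabla_dual z c) \<phi>'. \<exists>\<rho>. is_reg z c \<psi> \<rho> \<and> w = integralX z (wedge \<rho> \<psi>')"
    for w using that by blast
  \<comment> \<open>The existence half of the description: planar solutions are lifted to a
    regularization on the curve.\<close>
  obtain k0 C0 k1 C1 where "planar_solution (\<lambda>j. 2 * c j) F0 k0 C0" "planar_solution (\<lambda>j. 2 * c j + 1 / 2) F1 k1 C1"
    using v unfolding planar_value_def by blast
  from reg_of_planar_solution[OF this hol(1,2) \<phi>]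
  obtain \<rho> where \<rho>: "is_reg z c \<phi> \<rho>" by blast
  then show "\<exists>\<psi>\<in>cls z (nabla z c) \<phi>. \<exists>\<psi>'\<in>cls z (nabla_dual z c) \<phi>'. \<exists>\<rho>. is_reg z c \<psi> \<rho>
      \<and> - 4 * \<i> * (v0 + v1) = integralX z (wedge \<rho> \<psi>')"
    using key[of "integralX z (wedge \<rho> \<phi>')"] mem by metis
qed

section \<open>Forms with simple poles\<close>

definition "others j = {..4} - {j :: nat}"
text \<open>The regular part of \<open>L b\<close> at \<open>z j\<close> in the coordinate
  \<open>t = x - z j\<close>.\<close>

definition "Lr b j t = (\<Sum>k\<in>others j. b k / (z j + t - z k))"

lemma planar_value_twisted:
  assumes "twisted_equation {..4} z a r R m F H G K Gi Ki"
  shows "planar_value a F H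
    (- of_real pi * (\<Sum>j\<le>4. G j 0 / (a j - 1) * deriv (K j) 0
        + (deriv (G j) 0 - Lr a j 0 * (G j 0 / (a j - 1))) / a j * K j 0)
      + of_real pi * (Gi 0 * Ki 0 / ((\<Sum>j\<le>4. a j) - of_nat m)))"
proof -
  interpret twisted_equation "{..4}" z a r R m F H G K Gi Ki by (rule assms)
  have Om: "Om = base" by (simp add: Om_def base_def)
  have A: "A = L a" by (simp add: fun_eq_iff A_def L_def)
  have sol: "planar_solution a F \<kappa> C \<longleftrightarrow> is_solution \<kappa> C" for \<kappa> C
    by (simp add: planar_solution_def is_solution_def Om A)
  have Bf: "Bf j 0 = Lr a j 0" for j by (simp add: Bf_def Lr_def others_def)
  show ?thesis
    unfolding planar_value_def sol
  proof (intro conjI allI impI)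
    show "F holomorphic_on base" "H holomorphic_on base" using F H by (simp_all add: base_def)
    show "\<exists>\<kappa> C. is_solution \<kappa> C" using is_solution_kap0 by blast
    fix \<kappa> C g assume s: "is_solution \<kappa> C" and g: "g holomorphic_on base"
    from integral_solution[OF s g[folded Om]]
    show "(LINT x:base|lborel. dzb \<kappa> x * (H x + (deriv g x - L a x * g x))) =
        - of_real pi * (\<Sum>j\<le>4. G j 0 / (a j - 1) * deriv (K j) 0
          + (deriv (G j) 0 - Lr a j 0 * (G j 0 / (a j - 1))) / a j * K j 0)
        + of_real pi * (Gi 0 * Ki 0 / ((\<Sum>j\<le>4. a j) - of_nat m))"
      unfolding Om A res_def res_inf_def Bf .
  qed
qed

lemma separation_radii:
  obtains r R where "r > 0" "\<And>i j. i \<in> {..4} \<Longrightarrow> j \<in> {..4} \<Longrightarrow> i \<noteq> j \<Longrightarrow> 2 * r \<le> dist (z i) (z j)"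
    "\<And>j. j \<in> {..4} \<Longrightarrow> norm (z j) + r \<le> R / 3" "R > (0::real)"
proof -
  \<comment> \<open>Inserting 1 makes the set visibly nonempty, so that \<open>Min\<close> is
    meaningful.\<close>
  let ?D = "insert 1 ((\<lambda>(i, j). dist (z i) (z j)) ` {(i, j). i \<in> {..4} \<and> j \<in> {..4} \<and> i \<noteq> j})"
  have fin: "finite ?D"
    by (intro finite.insertI finite_imageI, rule finite_subset[of _ "{..4::nat} \<times> {..4::nat}"]) auto
  have "Min ?D > 0"
    using fin inj by (subst Min_gr_iff) (auto simp: inj_on_def)
  define r where "r = Min ?D / 2"
  define R where "R = 3 * ((\<Sum>j\<le>4. norm (z j)) + r)"
  have r: "r > 0" using \<open>Min ?D > 0\<close> by (simp add: r_def)
  show thesis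
  proof (rule that[of r R])
    show "2 * r \<le> dist (z i) (z j)" if "i \<in> {..4}" "j \<in> {..4}" "i \<noteq> j" for i j
    proof -
      have "Min ?D \<le> dist (z i) (z j)" by (rule Min_le[OF fin]) (use that in auto)
      then show ?thesis by (simp add: r_def)
    qed
    show "norm (z j) + r \<le> R / 3" if "j \<in> {..4}" for j
      unfolding R_def using member_le_sum[of j "{..4}" "\<lambda>j. norm (z j)"] that by simp
    show "R > 0" unfolding R_def using r by (intro mult_pos_pos add_nonneg_pos sum_nonneg) auto
  qed (rule r)
qed

section \<open>Functions with at most simple poles\<close>

text \<open>The coefficients of the eight forms have this shape, once \<open>1 / y\<close> is split
  off from the last four. Locally, \<open>linr\<close> is \<open>t * lin\<close> and
  \<open>qr\<close> is \<open>quintic / t\<close> at \<open>z j\<close>; \<open>lini\<close> is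
  \<open>s * lin\<close> and \<open>qi\<close> is \<open>s^5 * quintic\<close> at
  \<open>s = 1 / x\<close>.\<close>

definition "lin p0 p1 b x = p0 + p1 * x + L b x"
definition "linr p0 p1 b j t = b j + t * (p0 + p1 * (z j + t) + Lr b j t)"
definition "qr j t = (\<Prod>k\<in>others j. z j + t - z k)"
definition "lini p0 p1 b s = p1 + s * p0 + s\<^sup>2 * (\<Sum>k\<le>4. b k / (1 - z k * s))"
definition "qi s = (\<Prod>k\<le>4. 1 - z k * s)"

lemma lin_near: "j \<le> 4 \<Longrightarrow> t \<noteq> 0 \<Longrightarrow> lin p0 p1 b (z j + t) = linr p0 p1 b j t / t"
proof -
  assume j: "j \<le> 4" and t: "t \<noteq> 0"
  have "L b (z j + t) = b j / t + Lr b j t"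
    unfolding L_def Lr_def others_def using j by (subst sum.remove[of _ j]) auto
  then show ?thesis using t by (simp add: lin_def linr_def field_simps)
qed

lemma quintic_near: "j \<le> 4 \<Longrightarrow> quintic z (z j + t) = t * qr j t"
  unfolding quintic_def qr_def others_def by (subst prod.remove[of _ j]) auto

lemma lin_inf:
  assumes "s \<noteq> 0" "\<And>k. k \<le> 4 \<Longrightarrow> 1 - z k * s \<noteq> 0"
  shows "lin p0 p1 b (1 / s) = lini p0 p1 b s / s" "quintic z (1 / s) = qi s / s ^ 5"
proof -
  have e: "1 / s - z k = (1 - z k * s) / s" for k using assms(1) by (simp add: field_simps)
  have "L b (1 / s) = s * (\<Sum>k\<le>4. b k / (1 - z k * s))"
    unfolding L_def e sum_distrib_left by (simp add: mult.commute)
  then show "lin p0 p1 b (1 / s) = lini p0 p1 b s / s"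
    using assms(1) by (simp add: lin_def lini_def field_simps power2_eq_square)
  show "quintic z (1 / s) = qi s / s ^ 5"
    unfolding quintic_def qi_def e by (simp add: prod_dividef)
qed

lemma lin_holomorphic: "lin p0 p1 b holomorphic_on base"
  unfolding lin_def[abs_def] by (intro holomorphic_intros L_holomorphic)

text \<open>This is \<open>res\<close> for \<open>G = linr / qr\<close> and \<open>K = linr\<close>,
  with the values and first derivatives at \<open>t = 0\<close> written out.\<close>

definition "odd_residue a p0 p1 b p0' p1' b' j =
  b j * (p0' + p1' * z j + Lr b' j 0) / (qr j 0 * (a j - 1))
  + b' j * ((p0 + p1 * z j + Lr b j 0 - b j * Lr (\<lambda>_. 1) j 0) / qr j 0
      - Lr a j 0 * b j / (qr j 0 * (a j - 1))) / a j"

context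
  fixes r R :: real
  assumes r: "r > 0" and sep: "\<And>i j. i \<in> {..4} \<Longrightarrow> j \<in> {..4} \<Longrightarrow> i \<noteq> j \<Longrightarrow> 2 * r \<le> dist (z i) (z j)"
    and R: "\<And>j. j \<in> {..4} \<Longrightarrow> norm (z j) + r \<le> R / 3" "R > 0"
begin

lemma others_neq:
  assumes "j \<le> 4" "k \<in> others j" "t \<in> ball 0 r" shows "z j + t - z k \<noteq> 0"
  by (rule translate_neq[OF sep r assms(3)]) (use assms in \<open>auto simp: others_def\<close>)

lemma infinity_neq:
  assumes "k \<le> 4" "s \<in> ball 0 (3 / R)" shows "1 - z k * s \<noteq> 0"
  by (rule one_minus_neq[OF _ R(2) assms(2)]) (use R(1)[of k] assms(1) r in simp)

lemma linr_holomorphic: "j \<le> 4 \<Longrightarrow> linr p0 p1 b j holomorphic_on ball 0 r"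
  unfolding linr_def[abs_def] Lr_def by (intro holomorphic_intros) (use others_neq in blast)

lemma qr_holomorphic: "qr j holomorphic_on S"
  unfolding qr_def[abs_def] by (intro holomorphic_intros)

lemma qr_nonzero: "j \<le> 4 \<Longrightarrow> t \<in> ball 0 r \<Longrightarrow> qr j t \<noteq> 0"
  unfolding qr_def using others_neq by (auto simp: others_def)

lemma lini_holomorphic: "lini p0 p1 b holomorphic_on ball 0 (3 / R)"
  unfolding lini_def[abs_def] by (intro holomorphic_intros) (use infinity_neq in auto)

lemma qi_holomorphic: "qi holomorphic_on S"
  unfolding qi_def[abs_def] by (intro holomorphic_intros)

lemma qi_nonzero: "s \<in> ball 0 (3 / R) \<Longrightarrow> qi s \<noteq> 0"
  unfolding qi_def using infinity_neq by auto

lemma linr_derivative: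
  assumes j: "j \<le> 4"
  shows "(linr p0 p1 b j has_field_derivative p0 + p1 * z j + Lr b j 0) (at 0)"
proof -
  have 0: "0 \<in> ball (0::complex) r" using r by simp
  have "Lr b j holomorphic_on ball 0 r"
    unfolding Lr_def[abs_def] by (intro holomorphic_intros) (use others_neq[OF j] in blast)
  then have "(\<lambda>t. p0 + p1 * (z j + t) + Lr b j t) holomorphic_on ball 0 r" by (intro holomorphic_intros)
  from holomorphic_derivI[OF this open_ball 0]
  have "((\<lambda>t. b j + t * (p0 + p1 * (z j + t) + Lr b j t)) has_field_derivative
      0 + (1 * (p0 + p1 * (z j + 0) + Lr b j 0) + deriv (\<lambda>t. p0 + p1 * (z j + t) + Lr b j t) 0 * 0)) (at 0)"
    by (intro DERIV_add DERIV_const DERIV_mult DERIV_ident)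
  then show ?thesis unfolding linr_def[abs_def] by simp
qed

lemma qr_derivative:
  assumes j: "j \<le> 4"
  shows "(qr j has_field_derivative qr j 0 * Lr (\<lambda>_. 1) j 0) (at 0)"
proof -
  have "(qr j has_field_derivative (\<Sum>k\<in>others j. 1 * (\<Prod>i\<in>others j - {k}. z j + 0 - z i))) (at 0)"
    unfolding qr_def[abs_def] by (rule has_field_derivative_prod) (auto intro!: derivative_eq_intros)
  moreover have "(\<Sum>k\<in>others j. 1 * (\<Prod>i\<in>others j - {k}. z j + 0 - z i)) = qr j 0 * Lr (\<lambda>_. 1) j 0"
    unfolding Lr_def sum_distrib_left
  proof (rule sum.cong[OF refl])
    fix k assume k: "k \<in> others j"
    have "qr j 0 = (z j + 0 - z k) * (\<Prod>i\<in>others j - {k}. z j + 0 - z i)"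
      unfolding qr_def using k by (intro prod.remove) (auto simp: others_def)
    then show "1 * (\<Prod>i\<in>others j - {k}. z j + 0 - z i) = qr j 0 * (1 / (z j + 0 - z k))"
      using others_neq[OF j k, of 0] r by simp
  qed
  ultimately show ?thesis by simp
qed

text \<open>Here \<open>F\<close> has only simple poles, while the locale measures it against double
  ones; hence the extra factor \<open>t\<close>. At infinity both functions are of order
  \<open>s\<close>, so \<open>m = 0\<close>.\<close>

lemma twisted_equation_even:
  assumes "\<And>j. j \<le> 4 \<Longrightarrow> a j \<notin> \<int>" "(\<Sum>j\<le>4. a j) \<notin> \<int>"
  shows "twisted_equation {..4} z a r R 0 (lin 0 0 b) (lin 0 0 b')
    (\<lambda>j t. t * linr 0 0 b j t) (linr 0 0 b')
    (\<lambda>s. \<Sum>k\<le>4. b k / (1 - z k * s)) (\<lambda>s. \<Sum>k\<le>4. b' k / (1 - z k * s))"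
proof
  show "2 * r \<le> dist (z i) (z j)" if "i \<in> {..4}" "j \<in> {..4}" "i \<noteq> j" for i j using sep that .
  show "norm (z j) + r \<le> R / 3" if "j \<in> {..4}" for j using R(1) that .
  show "lin 0 0 b holomorphic_on - z ` {..4}" "lin 0 0 b' holomorphic_on - z ` {..4}"
    using lin_holomorphic by (auto simp: base_def)
  show "(\<lambda>t. t * linr 0 0 b j t) holomorphic_on ball 0 r" "linr 0 0 b' j holomorphic_on ball 0 r" if "j \<in> {..4}" for j
    using that by (auto intro!: holomorphic_intros linr_holomorphic)
  show "lin 0 0 b (z j + t) = t * linr 0 0 b j t / t\<^sup>2" "lin 0 0 b' (z j + t) = linr 0 0 b' j t / t"
    if "j \<in> {..4}" "t \<in> ball 0 r - {0}" for j t
    using that by (auto simp: lin_near power2_eq_square)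
  show "(\<lambda>s. \<Sum>k\<le>4. b k / (1 - z k * s)) holomorphic_on ball 0 (3 / R)"
    "(\<lambda>s. \<Sum>k\<le>4. b' k / (1 - z k * s)) holomorphic_on ball 0 (3 / R)"
    by (intro holomorphic_intros; use infinity_neq in auto)+
  show "lin 0 0 b (1 / s) = s ^ (0 + 1) * (\<Sum>k\<le>4. b k / (1 - z k * s))"
    "lin 0 0 b' (1 / s) = s * (\<Sum>k\<le>4. b' k / (1 - z k * s)) / s ^ 0"
    if "s \<in> ball 0 (3 / R) - {0}" for s
    using that lin_inf(1)[of s] infinity_neq by (auto simp: lini_def power2_eq_square)
qed (use assms r R(2) in auto)

text \<open>\<open>H\<close> may grow like \<open>x = s / s^2\<close>, hence \<open>m = 2\<close>.
  Since \<open>F\<close> is of order \<open>s^4\<close>, a factor \<open>s\<close> remains in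
  \<open>Gi\<close>, and the residue at infinity is 0.\<close>

lemma twisted_equation_odd:
  assumes "\<And>j. j \<le> 4 \<Longrightarrow> a j \<notin> \<int>" "(\<Sum>j\<le>4. a j) \<notin> \<int>"
  shows "twisted_equation {..4} z a r R 2 (\<lambda>x. lin p0 p1 b x / quintic z x) (lin p0' p1' b')
    (\<lambda>j t. linr p0 p1 b j t / qr j t) (linr p0' p1' b')
    (\<lambda>s. s * lini p0 p1 b s / qi s) (lini p0' p1' b')"
proof
  show "2 * r \<le> dist (z i) (z j)" if "i \<in> {..4}" "j \<in> {..4}" "i \<noteq> j" for i j using sep that .
  show "norm (z j) + r \<le> R / 3" if "j \<in> {..4}" for j using R(1) that .
  have "(\<lambda>x. lin p0 p1 b x / quintic z x) holomorphic_on base"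
    by (intro holomorphic_intros lin_holomorphic quintic_holomorphic) (use quintic_eq_0_iff in auto)
  then show "(\<lambda>x. lin p0 p1 b x / quintic z x) holomorphic_on - z ` {..4}" "lin p0' p1' b' holomorphic_on - z ` {..4}"
    using lin_holomorphic by (auto simp: base_def)
  show "(\<lambda>t. linr p0 p1 b j t / qr j t) holomorphic_on ball 0 r" "linr p0' p1' b' j holomorphic_on ball 0 r"
    if "j \<in> {..4}" for j
    using that qr_nonzero[of j] by (auto intro!: holomorphic_intros linr_holomorphic qr_holomorphic)
  show "lin p0 p1 b (z j + t) / quintic z (z j + t) = linr p0 p1 b j t / qr j t / t\<^sup>2"
    "lin p0' p1' b' (z j + t) = linr p0' p1' b' j t / t"
    if "j \<in> {..4}" "t \<in> ball 0 r - {0}" for j t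
  proof -
    have jt: "j \<le> 4" "t \<noteq> 0" using that by auto
    show "lin p0' p1' b' (z j + t) = linr p0' p1' b' j t / t" by (rule lin_near[OF jt])
    show "lin p0 p1 b (z j + t) / quintic z (z j + t) = linr p0 p1 b j t / qr j t / t\<^sup>2"
      unfolding lin_near[OF jt] quintic_near[OF jt(1)]
      by (simp add: power2_eq_square mult.commute mult.left_commute)
  qed
  show "(\<lambda>s. s * lini p0 p1 b s / qi s) holomorphic_on ball 0 (3 / R)"
    by (intro holomorphic_intros lini_holomorphic qi_holomorphic) (use qi_nonzero in auto)
  show "lini p0' p1' b' holomorphic_on ball 0 (3 / R)" by (rule lini_holomorphic)
  show "lin p0 p1 b (1 / s) / quintic z (1 / s) = s ^ (2 + 1) * (s * lini p0 p1 b s / qi s)"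
    "lin p0' p1' b' (1 / s) = s * lini p0' p1' b' s / s\<^sup>2"
    if "s \<in> ball 0 (3 / R) - {0}" for s
  proof -
    have s: "s \<noteq> 0" "\<And>k. k \<le> 4 \<Longrightarrow> 1 - z k * s \<noteq> 0" "qi s \<noteq> 0"
      using that infinity_neq qi_nonzero by auto
    have i: "lin p0 p1 b (1 / s) = lini p0 p1 b s / s" "lin p0' p1' b' (1 / s) = lini p0' p1' b' s / s"
      "quintic z (1 / s) = qi s / s ^ 5" using lin_inf[OF s(1,2)] by auto
    show "lin p0 p1 b (1 / s) / quintic z (1 / s) = s ^ (2 + 1) * (s * lini p0 p1 b s / qi s)"
      unfolding i using s(1,3) by (simp add: field_simps eval_nat_numeral)
    show "lin p0' p1' b' (1 / s) = s * lini p0' p1' b' s / s\<^sup>2"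
      unfolding i using s(1) by (simp add: power2_eq_square)
  qed
qed (use assms r R(2) in auto)

text \<open>For logarithmic forms each puncture contributes the product of the residues divided by
  the exponent. Infinity follows the same rule, its residues and exponent being the negated
  sums.\<close>

lemma planar_value_even:
  assumes "\<And>j. j \<le> 4 \<Longrightarrow> a j \<notin> \<int>" "(\<Sum>j\<le>4. a j) \<notin> \<int>"
  shows "planar_value a (lin 0 0 b) (lin 0 0 b')
    (- of_real pi * ((\<Sum>j\<le>4. b j * b' j / a j) - (\<Sum>j\<le>4. b j) * (\<Sum>j\<le>4. b' j) / (\<Sum>j\<le>4. a j)))"
proof -
  have d: "deriv (\<lambda>t. t * linr 0 0 b j t) 0 = b j" if "j \<le> 4" for j
    using DERIV_imp_deriv[OF DERIV_mult[OF DERIV_ident linr_derivative[OF that, of 0 0 b]]]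
    by (simp add: linr_def)
  have e: "0 * linr 0 0 b j 0 / (a j - 1) * deriv (linr 0 0 b' j) 0
      + (deriv (\<lambda>t. t * linr 0 0 b j t) 0 - Lr a j 0 * (0 * linr 0 0 b j 0 / (a j - 1))) / a j * linr 0 0 b' j 0
      = b j * b' j / a j" if "j \<in> {..4}" for j
    using d[of j] that by (simp add: linr_def)
  show ?thesis
    using planar_value_twisted[OF twisted_equation_even[OF assms, of b b']]
    by (simp only: e cong: sum.cong) (simp add: right_diff_distrib)
qed

lemma planar_value_odd:
  assumes "\<And>j. j \<le> 4 \<Longrightarrow> a j \<notin> \<int>" "(\<Sum>j\<le>4. a j) \<notin> \<int>"
  shows "planar_value a (\<lambda>x. lin p0 p1 b x / quintic z x) (lin p0' p1' b')
    (- of_real pi * (\<Sum>j\<le>4. odd_residue a p0 p1 b p0' p1' b' j))"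
proof -
  let ?G = "\<lambda>j t. linr p0 p1 b j t / qr j t"
  have e: "?G j 0 / (a j - 1) * deriv (linr p0' p1' b' j) 0
      + (deriv (?G j) 0 - Lr a j 0 * (?G j 0 / (a j - 1))) / a j * linr p0' p1' b' j 0
      = odd_residue a p0 p1 b p0' p1' b' j" if j: "j \<in> {..4}" for j
  proof -
    have j: "j \<le> 4" using j by simp
    have q: "qr j 0 \<noteq> 0" using qr_nonzero[OF j] r by simp
    have 1: "deriv (linr p0' p1' b' j) 0 = p0' + p1' * z j + Lr b' j 0"
      by (rule DERIV_imp_deriv[OF linr_derivative[OF j]])
    have 2: "deriv (?G j) 0 = (p0 + p1 * z j + Lr b j 0 - b j * Lr (\<lambda>_. 1) j 0) / qr j 0"
      using DERIV_imp_deriv[OF DERIV_divide[OF linr_derivative[OF j, of p0 p1 b] qr_derivative[OF j] q]] q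
      by (simp add: linr_def diff_divide_distrib)
    show ?thesis unfolding 1 2 odd_residue_def by (simp add: linr_def mult.commute)
  qed
  show ?thesis
    using planar_value_twisted[OF twisted_equation_odd[OF assms, of p0 p1 b p0' p1' b']]
    by (simp only: e cong: sum.cong) simp
qed

end

section \<open>Intersection numbers of forms with simple poles\<close>

lemma regular_form_lin:
  assumes \<phi>: "\<And>x y. (x, y) \<in> curveX z \<Longrightarrow> \<phi> (x, y) = (lin 0 0 b x + lin p0 p1 d x / y, 0)"
  shows "regular_form z \<phi>"
proof -
  define N where "N b = (\<Sum>j\<le>4. Polynomial.smult (b j) (\<Prod>k\<in>others j. [:- z k, 1:]))" for b
  define Q where "Q = (\<Prod>k\<le>4. [:- z k, 1:])"
  have Q: "poly Q x = quintic z x" for x by (simp add: Q_def quintic_def poly_prod)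
  have N: "poly (N b) x = quintic z x * L b x" if x: "x \<in> base" for b x
    unfolding N_def L_def poly_sum sum_distrib_left
  proof (rule sum.cong[OF refl])
    fix j :: nat assume j: "j \<in> {..4}"
    have "quintic z x = (x - z j) * (\<Prod>k\<in>others j. x - z k)"
      unfolding quintic_def others_def using j by (subst prod.remove[of _ j]) auto
    moreover have "x - z j \<noteq> 0" using x j by (auto simp: base_def)
    ultimately show "poly (Polynomial.smult (b j) (\<Prod>k\<in>others j. [:- z k, 1:])) x = quintic z x * (b j / (x - z j))"
      by (simp add: poly_prod)
  qed
  \<comment> \<open>Multiplication by \<open>y^3\<close> clears all denominators, as
    \<open>y^2 * L b x = quintic z x * L b x\<close> is the polynomial \<open>N b\<close>.\<close>
  have "fst (\<phi> (x, y)) = poly (poly [:[:p0, p1:] * Q + N d, N b:] [:y:]) x / y ^ 3" if p: "(x, y) \<in> curveX z" for x y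
  proof -
    have x: "x \<in> base" and y: "y \<noteq> 0" "quintic z x = y\<^sup>2" using p curveX_iff curveX_nonzero by auto
    have "poly (poly [:[:p0, p1:] * Q + N d, N b:] [:y:]) x = y\<^sup>2 * (lin p0 p1 d x + y * L b x)"
      by (simp add: Q N[OF x] y(2) lin_def algebra_simps)
    then show ?thesis
      unfolding \<phi>[OF p] using y(1) by (simp add: lin_def field_simps eval_nat_numeral)
  qed
  then have "regular_fun z (\<lambda>p. fst (\<phi> p))"
    unfolding regular_fun_def by (intro exI[of _ "[:[:p0, p1:] * Q + N d, N b:]"] exI[of _ 3]) auto
  moreover have "snd (\<phi> p) = 0" if "p \<in> curveX z" for p
    using \<phi>[of "fst p" "snd p"] that by simp
  ultimately show ?thesis by (simp add: regular_form_def)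
qed

lemma intersection_form_lin:
  assumes c: "\<And>j. j \<le> 4 \<Longrightarrow> 4 * c j \<notin> \<int>" "4 * (\<Sum>j\<le>4. c j) \<notin> \<int>"
    and \<phi>: "\<And>x y. (x, y) \<in> curveX z \<Longrightarrow> \<phi> (x, y) = (lin 0 0 b x + lin p0 p1 d x / y, 0)"
    and \<phi>': "\<And>x y. (x, y) \<in> curveX z \<Longrightarrow> \<phi>' (x, y) = (lin 0 0 b' x + lin p0' p1' d' x / y, 0)"
  shows "intersection_form z c (cls z (nabla z c) \<phi>) (cls z (nabla_dual z c) \<phi>') =
    4 * of_real pi * \<i> * ((\<Sum>j\<le>4. b j * b' j / (2 * c j)) - (\<Sum>j\<le>4. b j) * (\<Sum>j\<le>4. b' j) / (\<Sum>j\<le>4. 2 * c j)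
      + (\<Sum>j\<le>4. odd_residue (\<lambda>j. 2 * c j + 1 / 2) p0 p1 d p0' p1' d' j))"
proof -
  obtain r R where rR: "r > 0" "\<And>i j. i \<in> {..4} \<Longrightarrow> j \<in> {..4} \<Longrightarrow> i \<noteq> j \<Longrightarrow> 2 * r \<le> dist (z i) (z j)"
    "\<And>j. j \<in> {..4} \<Longrightarrow> norm (z j) + r \<le> R / 3" "R > (0::real)"
    using separation_radii by blast
  \<comment> \<open>Used with \<open>n = 1\<close> at the finite points and with
    \<open>n = 5\<close> at infinity, where five halves add up.\<close>
  have a: "2 * w \<notin> \<int>" "2 * w + of_nat n / 2 \<notin> \<int>" if w: "4 * w \<notin> \<int>" for w :: complex and n :: nat
  proof -
    have "4 * w = 2 * (2 * w)" "4 * w = 2 * (2 * w + of_nat n / 2) - of_nat n" by (simp_all add: algebra_simps)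
    then show "2 * w \<notin> \<int>" "2 * w + of_nat n / 2 \<notin> \<int>"
      using w by (metis Ints_mult Ints_numeral, metis Ints_diff Ints_mult Ints_numeral Ints_of_nat)
  qed
  have s: "(\<Sum>j\<le>4. 2 * c j) = 2 * (\<Sum>j\<le>4. c j)" "(\<Sum>j\<le>4. 2 * c j + 1 / 2) = 2 * (\<Sum>j\<le>4. c j) + of_nat 5 / 2"
    by (simp_all add: sum_distrib_left sum.distrib)
  have e: "planar_value (\<lambda>j. 2 * c j) (lin 0 0 b) (lin 0 0 b')
    (- of_real pi * ((\<Sum>j\<le>4. b j * b' j / (2 * c j)) - (\<Sum>j\<le>4. b j) * (\<Sum>j\<le>4. b' j) / (\<Sum>j\<le>4. 2 * c j)))"
    by (rule planar_value_even[OF rR]) (use a(1) c in \<open>auto simp: s\<close>)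
  have o: "planar_value (\<lambda>j. 2 * c j + 1 / 2) (\<lambda>x. lin p0 p1 d x / quintic z x) (lin p0' p1' d')
    (- of_real pi * (\<Sum>j\<le>4. odd_residue (\<lambda>j. 2 * c j + 1 / 2) p0 p1 d p0' p1' d' j))"
    by (rule planar_value_odd[OF rR]) (use a(2)[OF c(1), of _ 1] a(2)[OF c(2), of 5] in \<open>auto simp: s\<close>)
  have "\<phi> (x, y) = (lin 0 0 b x + y * (lin p0 p1 d x / quintic z x), 0)" if p: "(x, y) \<in> curveX z" for x y
  proof -
    have "quintic z x = y\<^sup>2" "y \<noteq> 0" using p curveX_iff curveX_nonzero by auto
    then show ?thesis by (simp add: \<phi>[OF p] power2_eq_square)
  qed
  from intersection_form_value[OF regular_form_lin[OF \<phi>] regular_form_lin[OF \<phi>'] this \<phi>' e o]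
  show ?thesis by (simp add: algebra_simps)
qed

section \<open>The eight forms and the entries of the matrix\<close>

lemma sum_le4: "(\<Sum>j\<le>4::nat. f j) = f 0 + f 1 + f 2 + f 3 + f 4"
  by (simp add: eval_nat_numeral)

lemma others_1: "others 1 = {0, 2, 3, 4}" and others_2: "others 2 = {0, 1, 3, 4}"
  by (auto simp: others_def)

text \<open>Residues of the first four forms by partial fractions: 1 at \<open>z 4\<close> and, for
  \<open>i > 0\<close>, \<open>-1\<close> at \<open>z (i - 1)\<close>.\<close>

definition "even_coeff (i::nat) (j::nat) = (if i < 4 \<and> j = 4 then 1 else if i < 4 \<and> i = j + 1 \<and> j < 3 then - 1 else (0::complex))"
definition "const_coeff (i::nat) = (if i = 5 then 1 else if i = 6 then 1 - z 1 else if i = 7 then 1 - z 2 else 0)"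
definition "linear_coeff i = (if i = (4::nat) then 1 else (0::complex))"
text \<open>From \<open>x / (x - w) = 1 + w / (x - w)\<close>, times \<open>1 - w\<close>; the
  constant term is in \<open>const_coeff\<close>.\<close>

definition "odd_coeff (i::nat) (j::nat) = (if (j = 1 \<or> j = 2) \<and> i = j + 5 then (1 - z j) * z j else 0)"

lemma even_coeff_odd: "i \<ge> 4 \<Longrightarrow> even_coeff i j = 0"
  by (auto simp: even_coeff_def)

definition "odd_entry a i j =
  odd_residue a (const_coeff i) (linear_coeff i) (odd_coeff i) (const_coeff j) (linear_coeff j) (odd_coeff j)"

lemma basis_forms_coeff:
  assumes z: "z 0 = 0" "z 4 = 1" and i: "i < 8" and p: "(x, y) \<in> curveX z"
  shows "(basis_forms z ! i) (x, y) =
    (lin 0 0 (even_coeff i) x + lin (const_coeff i) (linear_coeff i) (odd_coeff i) x / y, 0)"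
proof -
  have "x \<in> base" using p curveX_iff by blast
  then have nz: "x \<noteq> 0" "x - z 1 \<noteq> 0" "x - z 2 \<noteq> 0" "x - 1 \<noteq> 0"
    using z by (auto simp: base_def image_iff)
  have y: "y \<noteq> 0" using curveX_nonzero[OF p] .
  have pf: "(1 - w) / ((x - 1) * (x - w)) = 1 / (x - 1) - 1 / (x - w)"
    "(1 - w) * x / ((x - w) * y) = (1 - w + (1 - w) * w / (x - w)) / y" if "x - w \<noteq> 0" for w
  proof -
    show "(1 - w) / ((x - 1) * (x - w)) = 1 / (x - 1) - 1 / (x - w)"
      using that nz(4) by (simp add: divide_simps)
    have "1 - w + (1 - w) * w / (x - w) = (1 - w) * (x / (x - w))"
      using that by (simp add: divide_simps) (simp add: algebra_simps)
    then show "(1 - w) * x / ((x - w) * y) = (1 - w + (1 - w) * w / (x - w)) / y"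
      by simp
  qed
  have pf0: "1 / (x * (x - 1)) = 1 / (x - 1) - 1 / x"
    using nz(1,4) by (simp add: divide_simps)
  have "i = 0 \<or> i = 1 \<or> i = 2 \<or> i = 3 \<or> i = 4 \<or> i = 5 \<or> i = 6 \<or> i = 7" using i by linarith
  then show ?thesis
    by (elim disjE) (simp_all add: basis_forms_def dx_form_def lin_def L_def sum_le4 z even_coeff_def
      const_coeff_def linear_coeff_def odd_coeff_def pf(1)[OF nz(2)] pf(1)[OF nz(3)]
      pf(2)[OF nz(2)] pf(2)[OF nz(3)] pf0 del: One_nat_def)
qed

text \<open>\<open>n\<close> and \<open>m\<close> are the indices 1 and 2 in either order, so that
  one computation serves both nodes.\<close>

lemma node:
  assumes nm: "n = 1 \<and> m = 2 \<or> n = 2 \<and> m = (1::nat)" and z: "z 0 = 0" "z 4 = 1"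
  shows "qr n 0 = z n * (z n - z m) * (z n - z 3) * (z n - 1)"
    "Lr b n 0 = b 0 / z n + b m / (z n - z m) + b 3 / (z n - z 3) + b 4 / (z n - 1)"
  using nm by (elim disjE conjE; simp add: qr_def Lr_def others_1 others_2 z del: One_nat_def)+

text \<open>The value at \<open>z n\<close> of the coefficient function with its pole there removed;
  equally the derivative of \<open>linr\<close> at 0.\<close>

definition "slope n i = const_coeff i + linear_coeff i * z n + Lr (odd_coeff i) n 0"

lemma slope:
  assumes nm: "n = 1 \<and> m = 2 \<or> n = 2 \<and> m = (1::nat)" and z: "z 0 = 0" "z 4 = 1" "z n \<noteq> z m"
  shows "slope n 4 = z n" "slope n 5 = 1" "slope n (n + 5) = 1 - z n" "slope n (m + 5) = (1 - z m) * z n / (z n - z m)"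
proof -
  show "slope n 4 = z n" "slope n 5 = 1" "slope n (n + 5) = 1 - z n"
    using nm unfolding slope_def node(2)[OF nm z(1,2)]
    by (elim disjE conjE; simp add: z const_coeff_def linear_coeff_def odd_coeff_def del: One_nat_def)+
  have "slope n (m + 5) = (1 - z m) + (1 - z m) * z m / (z n - z m)"
    using nm unfolding slope_def node(2)[OF nm z(1,2)]
    by (elim disjE conjE; simp add: z const_coeff_def linear_coeff_def odd_coeff_def del: One_nat_def)
  also have "\<dots> = (1 - z m) * z n / (z n - z m)" using z(3) by (simp add: field_simps)
  finally show "slope n (m + 5) = (1 - z m) * z n / (z n - z m)" .
qed

text \<open>A pole of the first form brings the divisor \<open>a n - 1\<close>, a pole of the second
  the divisor \<open>a n\<close>: for \<open>a n = 2 * c n + 1/2\<close> these are the two shifts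
  seen in the matrix. The residue \<open>(1 - z n) * z n\<close> cancels against
  \<open>qr n 0\<close> up to sign and leaves \<open>D\<close>.\<close>

lemma odd_entry_node:
  assumes nm: "n = 1 \<and> m = 2 \<or> n = 2 \<and> m = (1::nat)" and z: "z 0 = 0" "z 4 = 1" "z n \<noteq> 0" "z n \<noteq> 1" "z n \<noteq> z m" "z n \<noteq> z 3"
  defines "D \<equiv> (z n - z m) * (z n - z 3)"
  shows "i \<noteq> n + 5 \<Longrightarrow> j \<noteq> n + 5 \<Longrightarrow> odd_entry a i j n = 0"
    "j \<noteq> n + 5 \<Longrightarrow> odd_entry a (n + 5) j n
      = - slope n j / (D * (a n - 1))"
    "i \<noteq> n + 5 \<Longrightarrow> odd_entry a i (n + 5) n
      = - slope n i / (D * a n)"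
    "a n \<noteq> 0 \<Longrightarrow> a n - 1 \<noteq> 0 \<Longrightarrow>
      odd_entry a (n + 5) (n + 5) n
      = (1 - z n) * z n * (Lr (\<lambda>k. a k + a n - 1) n 0 - (2 * a n - 1) / z n) / (D * (a n * (a n - 1)))"
proof -
  let ?e = "(1 - z n) * z n"
  have D: "D \<noteq> 0" and e: "?e \<noteq> 0" using z by (auto simp: D_def)
  have q: "qr n 0 = - ?e * D" unfolding node(1)[OF nm z(1,2)] D_def by (simp add: algebra_simps)
  have o: "odd_coeff i n = (if i = n + 5 then ?e else 0)" for i using nm by (elim disjE conjE) (simp_all add: odd_coeff_def)
  have r: "odd_entry a i j n
      = odd_coeff i n * slope n j / (- ?e * D * (a n - 1))
        + odd_coeff j n * ((slope n i - odd_coeff i n * Lr (\<lambda>_. 1) n 0) / (- ?e * D)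
          - Lr a n 0 * odd_coeff i n / (- ?e * D * (a n - 1))) / a n" for i j
    unfolding odd_entry_def odd_residue_def slope_def q ..
  show "i \<noteq> n + 5 \<Longrightarrow> j \<noteq> n + 5 \<Longrightarrow> odd_entry a i j n = 0"
    unfolding r o by simp
  have 1: "?e * s / (- ?e * D * t) = - s / (D * t)" for s t
    using e by (metis minus_mult_left minus_divide_left minus_divide_right mult.assoc mult_divide_mult_cancel_left)
  have 2: "?e * (s / (- ?e * D)) / t = - s / (D * t)" for s t
    unfolding times_divide_eq_right divide_divide_eq_left by (rule 1)
  show "j \<noteq> n + 5 \<Longrightarrow> odd_entry a (n + 5) j n
      = - slope n j / (D * (a n - 1))"
    unfolding r o if_P[OF refl] 1 by simp
  show "i \<noteq> n + 5 \<Longrightarrow> odd_entry a i (n + 5) n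
      = - slope n i / (D * a n)"
    unfolding r o if_P[OF refl] using 2[of "slope n i" "a n"] by simp
  assume a: "a n \<noteq> 0" "a n - 1 \<noteq> 0"
  let ?S = "Lr (\<lambda>_. 1) n 0" and ?B = "Lr a n 0" and ?n = "1 - z n"
  have sl: "slope n (n + 5) = ?n" by (rule slope(3)[OF nm z(1,2,5)])
  have LL: "Lr (\<lambda>k. a k + a n - 1) n 0 = ?B + (a n - 1) * ?S"
    by (simp add: Lr_def sum_distrib_left sum.distrib[symmetric] add_divide_distrib[symmetric] diff_divide_distrib[symmetric] add_diff_eq)
  have "odd_entry a (n + 5) (n + 5) n
      = - ?n / (D * (a n - 1)) + ?e * ((?n - ?e * ?S) / (- ?e * D) - ?B * ?e / (- ?e * D * (a n - 1))) / a n"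
    unfolding r o if_P[OF refl] 1 sl ..
  also have "?B * ?e / (- ?e * D * (a n - 1)) = ?e * (?B / (a n - 1)) / (- ?e * D)"
    by (simp add: mult.commute)
  also have "?e * ((?n - ?e * ?S) / (- ?e * D) - ?e * (?B / (a n - 1)) / (- ?e * D)) / a n
      = - (?n - ?e * ?S - ?e * (?B / (a n - 1))) / (D * a n)"
    unfolding diff_divide_distrib[symmetric] by (rule 2)
  \<comment> \<open>Over the common denominator the two terms \<open>- ?n\<close> combine with
    weight \<open>a n + (a n - 1)\<close>.\<close>
  also have "- ?n / (D * (a n - 1)) + - (?n - ?e * ?S - ?e * (?B / (a n - 1))) / (D * a n)
      = (?e * (?B + (a n - 1) * ?S) - ?n * (2 * a n - 1)) / (D * (a n * (a n - 1)))"
    using a D by (simp add: divide_simps) (simp add: algebra_simps)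
  also have "?n * (2 * a n - 1) = ?e * ((2 * a n - 1) / z n)" using z(3) by simp
  also have "?e * (?B + (a n - 1) * ?S) - ?e * ((2 * a n - 1) / z n) = ?e * (Lr (\<lambda>k. a k + a n - 1) n 0 - (2 * a n - 1) / z n)"
    unfolding LL by (simp only: right_diff_distrib)
  finally show "odd_entry a (n + 5) (n + 5) n
      = ?e * (Lr (\<lambda>k. a k + a n - 1) n 0 - (2 * a n - 1) / z n) / (D * (a n * (a n - 1)))" .
qed

definition "entry c i j = (\<Sum>k\<le>4. even_coeff i k * even_coeff j k / (2 * c k))
  - (\<Sum>k\<le>4. even_coeff i k) * (\<Sum>k\<le>4. even_coeff j k) / (\<Sum>k\<le>4. 2 * c k)
  + (\<Sum>k\<le>4. odd_entry (\<lambda>k. 2 * c k + 1 / 2) i j k)"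

lemma odd_part_zero:
  assumes "i < 4 \<or> j < 4"
  shows "odd_entry a i j k = 0"
  using assms by (auto simp: odd_entry_def odd_residue_def const_coeff_def linear_coeff_def odd_coeff_def Lr_def)

lemma entry_mixed:
  assumes "i < 4 \<and> 4 \<le> j \<or> j < 4 \<and> 4 \<le> i" shows "entry c i j = 0"
  unfolding entry_def using assms by (auto simp: odd_part_zero even_coeff_odd)

text \<open>The relation for the sum of the \<open>c k\<close> turns the term at infinity into one
  with \<open>c 5\<close>. It is nonzero only in the corner entry, as only the first form has finite
  residues with nonzero sum.\<close>

lemma entry_even:
  assumes i: "i < 4" and j: "j < 4" and c: "\<And>k. k \<le> 5 \<Longrightarrow> c k \<noteq> 0" and s: "(\<Sum>k\<le>4. c k) = - c 5"
  shows "2 * entry c i j = C_plus c $$ (i, j)"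
proof -
  have c': "c 0 \<noteq> 0" "c 1 \<noteq> 0" "c 2 \<noteq> 0" "c 4 \<noteq> 0" "c 5 \<noteq> 0" using c by auto
  have "(\<Sum>k\<le>4. 2 * c k) = - 2 * c 5" using s by (simp add: sum_distrib_left[symmetric])
  then have e: "entry c i j = (\<Sum>k\<le>4. even_coeff i k * even_coeff j k / (2 * c k))
      + (\<Sum>k\<le>4. even_coeff i k) * (\<Sum>k\<le>4. even_coeff j k) / (2 * c 5)"
    using i by (simp add: entry_def odd_part_zero)
  have "i = 0 \<or> i = 1 \<or> i = 2 \<or> i = 3" "j = 0 \<or> j = 1 \<or> j = 2 \<or> j = 3" using i j by linarith+
  then show ?thesis
    unfolding e
    by (elim disjE) (simp_all add: sum_le4 even_coeff_def C_plus_def mat_of_rows_list_def add_divide_distrib c' del: One_nat_def)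
qed

text \<open>\<open>odd_residue\<close> is zero at a node where neither form has a residue, and the
  odd forms have residues only at nodes 1 and 2.\<close>

lemma odd_sum:
  assumes "z 0 = 0" "z 4 = 1" "i \<ge> 4" "j \<ge> 4"
  shows "entry c i j =
    odd_entry (\<lambda>k. 2 * c k + 1 / 2) i j 1
    + odd_entry (\<lambda>k. 2 * c k + 1 / 2) i j 2"
proof -
  have "odd_entry a i j k = 0"
    if "k \<in> {0, 3, 4}" for a k
    using that by (auto simp: odd_entry_def odd_residue_def odd_coeff_def)
  then show ?thesis using assms by (simp add: entry_def sum_le4 even_coeff_odd)
qed

lemma entry_odd:
  assumes z: "z 0 = 0" "z 4 = 1" "z 1 \<notin> {0, 1}" "z 2 \<notin> {0, 1}" "z 1 \<noteq> z 2" "z 1 \<noteq> z 3" "z 2 \<noteq> z 3"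
    and i: "i < 4" and j: "j < 4"
    and a: "\<And>k. k \<le> 4 \<Longrightarrow> 2 * c k + 1 / 2 \<noteq> 0" "\<And>k. k \<le> 4 \<Longrightarrow> 2 * c k - 1 / 2 \<noteq> 0"
  shows "2 * entry c (i + 4) (j + 4) = C_minus z c $$ (i, j)"
proof -
  let ?a = "\<lambda>k. 2 * c k + 1 / 2"
  have am: "?a k - 1 = 2 * c k - 1 / 2" for k by (simp add: algebra_simps)
  have z': "z 1 \<noteq> 0" "z 1 \<noteq> 1" "z 2 \<noteq> 0" "z 2 \<noteq> 1" "z 2 \<noteq> z 1" using z by auto
  have nz: "z 1 - z 2 \<noteq> 0" "z 1 - z 3 \<noteq> 0" "z 2 - z 3 \<noteq> 0" "2 * c 1 + 1 / 2 \<noteq> 0" "2 * c 1 - 1 / 2 \<noteq> 0"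
    "2 * c 2 + 1 / 2 \<noteq> 0" "2 * c 2 - 1 / 2 \<noteq> 0"
    using z a by auto
  have an: "?a 1 \<noteq> 0" "?a 1 - 1 \<noteq> 0" "?a 2 \<noteq> 0" "?a 2 - 1 \<noteq> 0" using nz unfolding am by auto
  have nm: "1 = (1::nat) \<and> 2 = (2::nat) \<or> 1 = (2::nat) \<and> 2 = (1::nat)"
    "2 = (1::nat) \<and> 1 = (2::nat) \<or> 2 = (2::nat) \<and> 1 = (1::nat)" by simp_all
  have num: "1 + 5 = (6::nat)" "2 + 5 = (7::nat)" by simp_all
  \<comment> \<open>Here \<open>?a k + ?a 1 - 1 = 2 * c k + 2 * c 1\<close> and
    \<open>2 * ?a 1 - 1 = 4 * c 1\<close>. The latter affects only the term over
    \<open>z 1 - z 0 = z 1\<close>, where it changes the sign of \<open>2 * c 1\<close>.\<close>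
  have C33: "Lr (\<lambda>k. ?a k + ?a 1 - 1) 1 0 - (2 * ?a 1 - 1) / z 1
      = (2 * c 0 - 2 * c 1) / z 1 + (2 * c 2 + 2 * c 1) / (z 1 - z 2)
        + (2 * c 3 + 2 * c 1) / (z 1 - z 3) + (2 * c 1 + 2 * c 4) / (z 1 - 1)"
    unfolding node(2)[OF nm(1) z(1,2)] by (simp add: add_divide_distrib diff_divide_distrib algebra_simps del: One_nat_def)
  have C44: "Lr (\<lambda>k. ?a k + ?a 2 - 1) 2 0 - (2 * ?a 2 - 1) / z 2
      = (2 * c 0 - 2 * c 2) / z 2 + (2 * c 1 + 2 * c 2) / (z 2 - z 1)
        + (2 * c 3 + 2 * c 2) / (z 2 - z 3) + (2 * c 2 + 2 * c 4) / (z 2 - 1)"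
    unfolding node(2)[OF nm(2) z(1,2)] by (simp add: add_divide_distrib diff_divide_distrib algebra_simps del: One_nat_def)
  note n1 = odd_entry_node(1-3)[OF nm(1) z(1,2) z'(1,2) z(5,6), where a = ?a, unfolded am num]
    odd_entry_node(4)[where a = ?a, OF nm(1) z(1,2) z'(1,2) z(5,6) an(1,2), unfolded C33 am num]
  note n2 = odd_entry_node(1-3)[OF nm(2) z(1,2) z'(3,4,5) z(7), where a = ?a, unfolded am num]
    odd_entry_node(4)[where a = ?a, OF nm(2) z(1,2) z'(3,4,5) z(7) an(3,4), unfolded C44 am num]
  note s = slope[OF nm(1) z(1,2,5), unfolded num] slope[OF nm(2) z(1,2) z'(5), unfolded num]
  have o: "2 * entry c (i + 4) (j + 4) = 2 * (
      odd_entry ?a (i + 4) (j + 4) 1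
    + odd_entry ?a (i + 4) (j + 4) 2)"
    by (subst odd_sum[OF z(1,2)]) simp_all
  \<comment> \<open>Gives \<open>z 1 - z 2\<close> and \<open>z 2 - z 1\<close> a common normal form
    up to sign.\<close>
  define D where "D = z 1 - z 2"
  have e: "z 1 - z 2 = D" "z 2 - z 1 = - D" by (simp_all add: D_def)
  have "i = 0 \<or> i = 1 \<or> i = 2 \<or> i = 3" "j = 0 \<or> j = 1 \<or> j = 2 \<or> j = 3" using i j by linarith+
  then show ?thesis
    unfolding o
    by (elim disjE; simp add: n1 n2 s C33 C44 C_minus_def mat_of_rows_list_def C33_def C34_def C43_def C44_def
        del: One_nat_def;
      simp add: e add_divide_distrib mult.assoc mult.commute mult.left_commute del: One_nat_def)
qed

end

section \<open>Assembly of the intersection matrix\<close>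

theorem theorem4p1:
  fixes z c :: "nat \<Rightarrow> complex"
  assumes "z 0 = 0" and "z 4 = 1"
    and "z 1 \<notin> {0, 1}" and "z 2 \<notin> {0, 1}" and "z 3 \<notin> {0, 1}"
    and "z 1 \<noteq> z 2" and "z 1 \<noteq> z 3" and "z 2 \<noteq> z 3"
    and "(\<Sum>j\<le>5. c j) = 0"
    and "\<forall>j\<le>5. 4 * c j \<notin> \<int>"
  shows "Matrix.mat 8 8 (\<lambda>(i, j). intersection_form z c
            (cls z (nabla z c) (basis_forms z ! i))
            (cls z (nabla_dual z c) (basis_forms z ! j)))
         = (2 * of_real pi * \<i>) \<cdot>\<^sub>m
             four_block_mat (C_plus c) (0\<^sub>m 4 4) (0\<^sub>m 4 4) (C_minus z c)"
proof -
  have le4: "{..4::nat} = {0, 1, 2, 3, 4}" and le5: "{..5::nat} = insert 5 {..4}" by auto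
  interpret branch_points z
    by unfold_locales (use assms in \<open>auto simp: le4 inj_on_def\<close>)
  have s: "(\<Sum>k\<le>4. c k) = - c 5"
    using assms(9) unfolding le5 by (simp add: add_eq_0_iff)
  have c: "4 * c k \<notin> \<int>" if "k \<le> 5" for k using assms(10) that by blast
  have "c k \<noteq> 0" if "k \<le> 5" for k using c[OF that] by auto
  moreover have "2 * c k + 1 / 2 \<noteq> 0" "2 * c k - 1 / 2 \<noteq> 0" if "k \<le> 4" for k
  proof -
    have "4 * c k \<notin> \<int>" using c that by simp
    \<comment> \<open>The divisors \<open>2 * c k + 1/2\<close> and \<open>2 * c k - 1/2\<close>
      vanish only for these two integer values of \<open>4 * c k\<close>.\<close>
    then have "4 * c k \<noteq> - 1" "4 * c k \<noteq> 1" by (metis Ints_1 Ints_minus)+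
    moreover have "4 * c k = 2 * (2 * c k + 1 / 2) - 1" "4 * c k = 2 * (2 * c k - 1 / 2) + 1" by simp_all
    ultimately show "2 * c k + 1 / 2 \<noteq> 0" "2 * c k - 1 / 2 \<noteq> 0" by (metis diff_0 mult_zero_right, metis add_0 mult_zero_right)
  qed
  ultimately have vals: "2 * entry c i j = C_plus c $$ (i, j)" "2 * entry c (i + 4) (j + 4) = C_minus z c $$ (i, j)"
    if "i < 4" "j < 4" for i j
    using entry_even[of i j c] entry_odd[of i j c] assms(1-8) s that by blast+
  \<comment> \<open>Non-integrality at infinity, from the hypothesis at index 5.\<close>
  have s4: "4 * (\<Sum>k\<le>4. c k) \<notin> \<int>"
    unfolding s using c[of 5] by (simp add: minus_in_Ints_iff)
  have form: "intersection_form z c (cls z (nabla z c) (basis_forms z ! i)) (cls z (nabla_dual z c) (basis_forms z ! j))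
      = (2 * of_real pi * \<i>) * (2 * entry c i j)" if "i < 8" "j < 8" for i j
    using intersection_form_lin[OF _ s4 basis_forms_coeff[OF assms(1,2) that(1)] basis_forms_coeff[OF assms(1,2) that(2)]] c
    by (simp add: entry_def odd_entry_def)
  have dims: "dim_row (C_plus c) = 4" "dim_col (C_plus c) = 4" "dim_row (C_minus z c) = 4" "dim_col (C_minus z c) = 4"
    by (simp_all add: C_plus_def C_minus_def mat_of_rows_list_def)
  show ?thesis
  proof (rule eq_matI)
    fix i j
    assume "i < dim_row ((2 * of_real pi * \<i>) \<cdot>\<^sub>m four_block_mat (C_plus c) (0\<^sub>m 4 4) (0\<^sub>m 4 4) (C_minus z c))"
      "j < dim_col ((2 * of_real pi * \<i>) \<cdot>\<^sub>m four_block_mat (C_plus c) (0\<^sub>m 4 4) (0\<^sub>m 4 4) (C_minus z c))"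
    then have ij: "i < 8" "j < 8" by (simp_all add: dims)
    have "2 * entry c i j = four_block_mat (C_plus c) (0\<^sub>m 4 4) (0\<^sub>m 4 4) (C_minus z c) $$ (i, j)"
      using ij vals(1)[of i j] vals(2)[of "i - 4" "j - 4"] entry_mixed[of i j c]
      by (auto simp: dims not_less)
    then show "Matrix.mat 8 8 (\<lambda>(i, j). intersection_form z c (cls z (nabla z c) (basis_forms z ! i))
          (cls z (nabla_dual z c) (basis_forms z ! j))) $$ (i, j)
        = ((2 * of_real pi * \<i>) \<cdot>\<^sub>m four_block_mat (C_plus c) (0\<^sub>m 4 4) (0\<^sub>m 4 4) (C_minus z c)) $$ (i, j)"
      using ij by (simp add: form dims)
  qed (simp_all add: dims)
qed

end
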